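(* Let $M(\phi,\xi,\eta,g_M)$ be a cosymplectic manifold, let $(N,g_N)$ be a Riemannian manifold, and let $F:M(\phi,\xi,\eta,g_M)\to(N,g_N)$ be an anti-invariant Riemannian submersion such that $\phi(\ker F_* )=(\ker F_* )^\perp$. Then $M$ is a locally product manifold if and only if $\mathcal{A}_X\phi Y=0$ and $\mathcal{T}_V\phi W=0$ for all $W,V\in\Gamma(\ker F_* )$ and $X,Y\in\Gamma((\ker F_* )^\perp)$.
   Context: An almost contact metric structure $(\phi,\xi,\eta,g)$ on a $(2m+1)$-dimensional manifold $M$ consists of a $(1,1)$-tensor field $\phi$, a vector field $\xi$, a 1-form $\eta$ and a Riemannian metric $g$ with $\phi^2=-I+\eta\otimes\xi$, $\phi\xi=0$, $\eta\circ\phi=0$, $\eta(\xi)=1$, $g(\phi X,\phi Y)=g(X,Y)-\eta(X)\eta(Y)$, $\eta(X)=g(X,\xi)$. It is cosymplectic if it is normal ($[\phi,\phi]+2d\eta\otimes\xi=0$) and both $\eta$ and $\Phi(X,Y)=g(X,\phi Y)$ are closed; the structure equation of a cosymplectic manifold is $(\nabla_X\phi)Y=0$, where $\nabla$ is the Levi-Civita connection of $g$, and then $\nabla_X\xi=0$. A Riemannian submersion $F:(M,g_M)\to(N,g_N)$ is a smooth surjective map of maximal rank whose differential $F_*$ preserves the lengths of horizontal vectors. Vectors in $\ker F_*$ are vertical and vectors in $(\ker F_* )^\perp$ are horizontal; $\mathcal{V}$ and $\mathcal{H}$ are the orthogonal projections on $\ker F_*$ and $(\ker F_* )^\perp$.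 $F$ is anti-invariant if $\phi(\ker F_* )\subseteq(\ker F_* )^\perp$. O'Neill's tensors: for vector fields $E,G$ on $M$, $\mathcal{T}_EG=\mathcal{H}\nabla_{\mathcal{V}E}\mathcal{V}G+\mathcal{V}\nabla_{\mathcal{V}E}\mathcal{H}G$ and $\mathcal{A}_EG=\mathcal{V}\nabla_{\mathcal{H}E}\mathcal{H}G+\mathcal{H}\nabla_{\mathcal{H}E}\mathcal{V}G$. "$M$ is a locally product manifold" means that $M$ is locally a Riemannian product whose two canonical foliations are given by $\ker F_*$ and $(\ker F_* )^\perp$; equivalently, both distributions define totally geodesic foliations on $M$. *)

theory Defs
  imports "HOL-Analysis.Analysis"
begin

section \<open>Smooth maps between Euclidean spaces\<close>

fun C_k_on :: "nat \<Rightarrow> 'e::real_normed_vector set \<Rightarrow> ('e \<Rightarrow> 'f::real_normed_vector) \<Rightarrow> bool" where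
  "C_k_on 0 S f \<longleftrightarrow> continuous_on S f"
| "C_k_on (Suc k) S f \<longleftrightarrow>
     (\<forall>x\<in>S. f differentiable (at x)) \<and>
     (\<forall>v. C_k_on k S (\<lambda>x. frechet_derivative f (at x) v))"

text \<open>Only used for open \<open>S\<close>; the derivatives are taken at interior points.\<close>

definition smooth_on :: "'e::real_normed_vector set \<Rightarrow> ('e \<Rightarrow> 'f::real_normed_vector) \<Rightarrow> bool" where
  "smooth_on S f \<longleftrightarrow> (\<forall>k. C_k_on k S f)"


section \<open>Smooth manifolds\<close>

text \<open>A chart is a pair of its domain and its coordinate map, the values of the latter outside
  the domain being irrelevant. The points of a manifold are all the points of a Hausdorff second
  countable type; the dimension is \<open>DIM('e)\<close>.\<close>

type_synonym ('a, 'e) chart = "'a set \<times> ('a \<Rightarrow> 'e)"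

definition cdom :: "('a, 'e) chart \<Rightarrow> 'a set" where
  "cdom c = fst c"

definition cmap :: "('a, 'e) chart \<Rightarrow> 'a \<Rightarrow> 'e" where
  "cmap c = snd c"

definition cinv :: "('a, 'e) chart \<Rightarrow> 'e \<Rightarrow> 'a" where
  "cinv c = inv_into (cdom c) (cmap c)"

definition topological_chart ::
  "('a::topological_space, 'e::euclidean_space) chart \<Rightarrow> bool" where
  "topological_chart c \<longleftrightarrow> open (cdom c) \<and> open (cmap c ` cdom c) \<and>
     homeomorphism (cdom c) (cmap c ` cdom c) (cmap c) (cinv c)"

definition smooth_transition ::
  "('a, 'e::euclidean_space) chart \<Rightarrow> ('a, 'e) chart \<Rightarrow> bool" where
  "smooth_transition c d \<longleftrightarrow> smooth_on (cmap c ` (cdom c \<inter> cdom d)) (cmap d \<circ> cinv c)"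

definition smooth_manifold ::
  "('a::{t2_space, second_countable_topology}, 'e::euclidean_space) chart set \<Rightarrow> bool" where
  "smooth_manifold A \<longleftrightarrow> (\<Union>c\<in>A. cdom c) = UNIV \<and> (\<forall>c\<in>A. topological_chart c) \<and>
     (\<forall>c\<in>A. \<forall>d\<in>A. smooth_transition c d)"

text \<open>Membership in the maximal atlas generated by \<open>A\<close>:\<close>

definition admissible_chart ::
  "('a::topological_space, 'e::euclidean_space) chart set \<Rightarrow> ('a, 'e) chart \<Rightarrow> bool" where
  "admissible_chart A c \<longleftrightarrow> topological_chart c \<and>
     (\<forall>d\<in>A. smooth_transition c d \<and> smooth_transition d c)"

definition smooth_fun ::
  "('a, 'e::euclidean_space) chart set \<Rightarrow> ('a \<Rightarrow> real) \<Rightarrow> bool" where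
  "smooth_fun A f \<longleftrightarrow> (\<forall>c\<in>A. smooth_on (cmap c ` cdom c) (f \<circ> cinv c))"

definition smooth_map ::
  "('a::topological_space, 'e::euclidean_space) chart set \<Rightarrow>
   ('b::topological_space, 'f::euclidean_space) chart set \<Rightarrow> ('a \<Rightarrow> 'b) \<Rightarrow> bool" where
  "smooth_map A B F \<longleftrightarrow> continuous_on UNIV F \<and>
     (\<forall>c\<in>A. \<forall>d\<in>B. smooth_on (cmap c ` (cdom c \<inter> F -` cdom d)) (cmap d \<circ> F \<circ> cinv c))"


section \<open>Tangent vectors and tensor fields\<close>

text \<open>A tangent vector at \<open>p\<close> is an equivalence class of pairs of a chart around \<open>p\<close> and a vector
  of \<open>'e\<close>, two pairs being equivalent if the derivative of the transition map relates the vectors.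
  Each class has exactly one representative for the chart \<open>chart_at A p\<close>, so every tangent space
  \<open>T_p M\<close> is represented by the vector space \<open>'e\<close>, and \<open>u :: 'e\<close> stands for the tangent vector at
  \<open>p\<close> with components \<open>u\<close> in \<open>chart_at A p\<close>. As \<open>chart_at A\<close> need not depend continuously on \<open>p\<close>,
  smoothness of fields is always expressed in the components with respect to fixed charts.\<close>

definition chart_at :: "('a, 'e) chart set \<Rightarrow> 'a \<Rightarrow> ('a, 'e) chart" where
  "chart_at A p = (SOME c. c \<in> A \<and> p \<in> cdom c)"

text \<open>The components in the chart \<open>c\<close> of the tangent vector \<open>u\<close> at \<open>p\<close>, and conversely the
  tangent vector at \<open>p\<close> with components \<open>u\<close> in the chart \<open>c\<close>:\<close>

definition to_chart ::
  "('a, 'e::euclidean_space) chart set \<Rightarrow> ('a, 'e) chart \<Rightarrow> 'a \<Rightarrow> 'e \<Rightarrow> 'e" where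
  "to_chart A c p u =
     frechet_derivative (cmap c \<circ> cinv (chart_at A p)) (at (cmap (chart_at A p) p)) u"

definition of_chart ::
  "('a, 'e::euclidean_space) chart set \<Rightarrow> ('a, 'e) chart \<Rightarrow> 'a \<Rightarrow> 'e \<Rightarrow> 'e" where
  "of_chart A c p u = frechet_derivative (cmap (chart_at A p) \<circ> cinv c) (at (cmap c p)) u"

text \<open>The differential of \<open>F\<close> at \<open>p\<close>, applied to \<open>u\<close>:\<close>

definition pushforward ::
  "('a, 'e::euclidean_space) chart set \<Rightarrow> ('b, 'f::euclidean_space) chart set \<Rightarrow>
   ('a \<Rightarrow> 'b) \<Rightarrow> 'a \<Rightarrow> 'e \<Rightarrow> 'f" where
  "pushforward A B F p u =
     frechet_derivative (cmap (chart_at B (F p)) \<circ> F \<circ> cinv (chart_at A p))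
       (at (cmap (chart_at A p) p)) u"

text \<open>The derivative \<open>u f\<close> of a function \<open>f\<close> along a tangent vector \<open>u\<close> at \<open>p\<close>:\<close>

definition vec_deriv ::
  "('a, 'e::euclidean_space) chart set \<Rightarrow> ('a \<Rightarrow> real) \<Rightarrow> 'a \<Rightarrow> 'e \<Rightarrow> real" where
  "vec_deriv A f p u =
     frechet_derivative (f \<circ> cinv (chart_at A p)) (at (cmap (chart_at A p) p)) u"

definition vf_in_chart ::
  "('a, 'e::euclidean_space) chart set \<Rightarrow> ('a, 'e) chart \<Rightarrow> ('a \<Rightarrow> 'e) \<Rightarrow> 'e \<Rightarrow> 'e" where
  "vf_in_chart A c X z = to_chart A c (cinv c z) (X (cinv c z))"

definition vector_field ::
  "('a, 'e::euclidean_space) chart set \<Rightarrow> ('a \<Rightarrow> 'e) \<Rightarrow> bool" where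
  "vector_field A X \<longleftrightarrow> (\<forall>c\<in>A. smooth_on (cmap c ` cdom c) (vf_in_chart A c X))"

text \<open>The smooth sections of a distribution (a family of subspaces of the tangent spaces):\<close>

definition sections ::
  "('a, 'e::euclidean_space) chart set \<Rightarrow> ('a \<Rightarrow> 'e set) \<Rightarrow> ('a \<Rightarrow> 'e) set" where
  "sections A D = {X. vector_field A X \<and> (\<forall>p. X p \<in> D p)}"

definition one_form ::
  "('a, 'e::euclidean_space) chart set \<Rightarrow> ('a \<Rightarrow> 'e \<Rightarrow> real) \<Rightarrow> bool" where
  "one_form A \<eta> \<longleftrightarrow> (\<forall>p. linear (\<eta> p)) \<and>
     (\<forall>c\<in>A. \<forall>u. smooth_on (cmap c ` cdom c) (\<lambda>z. \<eta> (cinv c z) (of_chart A c (cinv c z) u)))"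

definition tensor_field_11 ::
  "('a, 'e::euclidean_space) chart set \<Rightarrow> ('a \<Rightarrow> 'e \<Rightarrow> 'e) \<Rightarrow> bool" where
  "tensor_field_11 A \<phi> \<longleftrightarrow> (\<forall>p. linear (\<phi> p)) \<and>
     (\<forall>c\<in>A. \<forall>u. smooth_on (cmap c ` cdom c)
        (\<lambda>z. to_chart A c (cinv c z) (\<phi> (cinv c z) (of_chart A c (cinv c z) u))))"

definition riemannian_metric ::
  "('a, 'e::euclidean_space) chart set \<Rightarrow> ('a \<Rightarrow> 'e \<Rightarrow> 'e \<Rightarrow> real) \<Rightarrow> bool" where
  "riemannian_metric A g \<longleftrightarrow>
     (\<forall>p. bilinear (g p) \<and> (\<forall>u v. g p u v = g p v u) \<and> (\<forall>u. u \<noteq> 0 \<longrightarrow> g p u u > 0)) \<and>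
     (\<forall>c\<in>A. \<forall>u v. smooth_on (cmap c ` cdom c)
        (\<lambda>z. g (cinv c z) (of_chart A c (cinv c z) u) (of_chart A c (cinv c z) v)))"

text \<open>In local coordinates \<open>[X, Y] = DY(X) - DX(Y)\<close>; at \<open>p\<close> this is evaluated in
  \<open>chart_at A p\<close>.\<close>

definition lie_bracket ::
  "('a, 'e::euclidean_space) chart set \<Rightarrow> ('a \<Rightarrow> 'e) \<Rightarrow> ('a \<Rightarrow> 'e) \<Rightarrow> 'a \<Rightarrow> 'e" where
  "lie_bracket A X Y p = (let c = chart_at A p in
     frechet_derivative (vf_in_chart A c Y) (at (cmap c p)) (X p) -
     frechet_derivative (vf_in_chart A c X) (at (cmap c p)) (Y p))"

text \<open>Exterior derivatives, with the convention in which \<open>d\<eta>\<close> carries the factor \<open>1/2\<close> and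
  \<open>d\<Phi>\<close> the factor \<open>1/3\<close>; this is the one that goes with the expression
  \<open>[\<phi>,\<phi>] + 2 d\<eta> \<otimes> \<xi>\<close>.\<close>

definition d_one_form ::
  "('a, 'e::euclidean_space) chart set \<Rightarrow> ('a \<Rightarrow> 'e \<Rightarrow> real) \<Rightarrow>
   ('a \<Rightarrow> 'e) \<Rightarrow> ('a \<Rightarrow> 'e) \<Rightarrow> 'a \<Rightarrow> real" where
  "d_one_form A \<eta> X Y p = 1/2 *
     (vec_deriv A (\<lambda>q. \<eta> q (Y q)) p (X p) - vec_deriv A (\<lambda>q. \<eta> q (X q)) p (Y p)
      - \<eta> p (lie_bracket A X Y p))"

definition d_two_form ::
  "('a, 'e::euclidean_space) chart set \<Rightarrow> ('a \<Rightarrow> 'e \<Rightarrow> 'e \<Rightarrow> real) \<Rightarrow>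
   ('a \<Rightarrow> 'e) \<Rightarrow> ('a \<Rightarrow> 'e) \<Rightarrow> ('a \<Rightarrow> 'e) \<Rightarrow> 'a \<Rightarrow> real" where
  "d_two_form A \<omega> X Y Z p = 1/3 *
     (vec_deriv A (\<lambda>q. \<omega> q (Y q) (Z q)) p (X p)
      + vec_deriv A (\<lambda>q. \<omega> q (Z q) (X q)) p (Y p)
      + vec_deriv A (\<lambda>q. \<omega> q (X q) (Y q)) p (Z p)
      - \<omega> p (lie_bracket A X Y p) (Z p)
      - \<omega> p (lie_bracket A Y Z p) (X p)
      - \<omega> p (lie_bracket A Z X p) (Y p))"

definition nijenhuis ::
  "('a, 'e::euclidean_space) chart set \<Rightarrow> ('a \<Rightarrow> 'e \<Rightarrow> 'e) \<Rightarrow>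
   ('a \<Rightarrow> 'e) \<Rightarrow> ('a \<Rightarrow> 'e) \<Rightarrow> 'a \<Rightarrow> 'e" where
  "nijenhuis A \<phi> X Y p =
     \<phi> p (\<phi> p (lie_bracket A X Y p))
     + lie_bracket A (\<lambda>q. \<phi> q (X q)) (\<lambda>q. \<phi> q (Y q)) p
     - \<phi> p (lie_bracket A (\<lambda>q. \<phi> q (X q)) Y p)
     - \<phi> p (lie_bracket A X (\<lambda>q. \<phi> q (Y q)) p)"


section \<open>The Levi-Civita connection\<close>

definition affine_connection ::
  "('a, 'e::euclidean_space) chart set \<Rightarrow>
   (('a \<Rightarrow> 'e) \<Rightarrow> ('a \<Rightarrow> 'e) \<Rightarrow> ('a \<Rightarrow> 'e)) \<Rightarrow> bool" where
  "affine_connection A nabla \<longleftrightarrow>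
     (\<forall>X Y. vector_field A X \<longrightarrow> vector_field A Y \<longrightarrow> vector_field A (nabla X Y)) \<and>
     (\<forall>X X' Y. vector_field A X \<longrightarrow> vector_field A X' \<longrightarrow> vector_field A Y \<longrightarrow>
        nabla (\<lambda>p. X p + X' p) Y = (\<lambda>p. nabla X Y p + nabla X' Y p)) \<and>
     (\<forall>X Y Y'. vector_field A X \<longrightarrow> vector_field A Y \<longrightarrow> vector_field A Y' \<longrightarrow>
        nabla X (\<lambda>p. Y p + Y' p) = (\<lambda>p. nabla X Y p + nabla X Y' p)) \<and>
     (\<forall>f X Y. smooth_fun A f \<longrightarrow> vector_field A X \<longrightarrow> vector_field A Y \<longrightarrow>
        nabla (\<lambda>p. f p *\<^sub>R X p) Y = (\<lambda>p. f p *\<^sub>R nabla X Y p) \<and>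
        nabla X (\<lambda>p. f p *\<^sub>R Y p) =
          (\<lambda>p. vec_deriv A f p (X p) *\<^sub>R Y p + f p *\<^sub>R nabla X Y p))"

definition levi_civita_connection ::
  "('a, 'e::euclidean_space) chart set \<Rightarrow> ('a \<Rightarrow> 'e \<Rightarrow> 'e \<Rightarrow> real) \<Rightarrow>
   (('a \<Rightarrow> 'e) \<Rightarrow> ('a \<Rightarrow> 'e) \<Rightarrow> ('a \<Rightarrow> 'e)) \<Rightarrow> bool" where
  "levi_civita_connection A g nabla \<longleftrightarrow> affine_connection A nabla \<and>
     (\<forall>X Y. vector_field A X \<longrightarrow> vector_field A Y \<longrightarrow>
        (\<forall>p. nabla X Y p - nabla Y X p = lie_bracket A X Y p)) \<and>
     (\<forall>X Y Z. vector_field A X \<longrightarrow> vector_field A Y \<longrightarrow> vector_field A Z \<longrightarrow>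
        (\<forall>p. vec_deriv A (\<lambda>q. g q (Y q) (Z q)) p (X p) =
             g p (nabla X Y p) (Z p) + g p (Y p) (nabla X Z p)))"


section \<open>Cosymplectic manifolds\<close>

definition almost_contact_metric ::
  "('a, 'e::euclidean_space) chart set \<Rightarrow> ('a \<Rightarrow> 'e \<Rightarrow> 'e) \<Rightarrow> ('a \<Rightarrow> 'e) \<Rightarrow>
   ('a \<Rightarrow> 'e \<Rightarrow> real) \<Rightarrow> ('a \<Rightarrow> 'e \<Rightarrow> 'e \<Rightarrow> real) \<Rightarrow> bool" where
  "almost_contact_metric A \<phi> \<xi> \<eta> g \<longleftrightarrow>
     tensor_field_11 A \<phi> \<and> vector_field A \<xi> \<and> one_form A \<eta> \<and> riemannian_metric A g \<and>
     (\<forall>p. \<forall>u v. \<phi> p (\<phi> p u) = - u + \<eta> p u *\<^sub>R \<xi> p \<and>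
        \<phi> p (\<xi> p) = 0 \<and> \<eta> p (\<phi> p u) = 0 \<and> \<eta> p (\<xi> p) = 1 \<and>
        g p (\<phi> p u) (\<phi> p v) = g p u v - \<eta> p u * \<eta> p v \<and>
        \<eta> p u = g p u (\<xi> p))"

definition normal_structure ::
  "('a, 'e::euclidean_space) chart set \<Rightarrow> ('a \<Rightarrow> 'e \<Rightarrow> 'e) \<Rightarrow> ('a \<Rightarrow> 'e) \<Rightarrow>
   ('a \<Rightarrow> 'e \<Rightarrow> real) \<Rightarrow> bool" where
  "normal_structure A \<phi> \<xi> \<eta> \<longleftrightarrow>
     (\<forall>X Y p. vector_field A X \<longrightarrow> vector_field A Y \<longrightarrow>
        nijenhuis A \<phi> X Y p + (2 * d_one_form A \<eta> X Y p) *\<^sub>R \<xi> p = 0)"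

definition cosymplectic ::
  "('a, 'e::euclidean_space) chart set \<Rightarrow> ('a \<Rightarrow> 'e \<Rightarrow> 'e) \<Rightarrow> ('a \<Rightarrow> 'e) \<Rightarrow>
   ('a \<Rightarrow> 'e \<Rightarrow> real) \<Rightarrow> ('a \<Rightarrow> 'e \<Rightarrow> 'e \<Rightarrow> real) \<Rightarrow> bool" where
  "cosymplectic A \<phi> \<xi> \<eta> g \<longleftrightarrow>
     almost_contact_metric A \<phi> \<xi> \<eta> g \<and> normal_structure A \<phi> \<xi> \<eta> \<and>
     (\<forall>X Y p. vector_field A X \<longrightarrow> vector_field A Y \<longrightarrow> d_one_form A \<eta> X Y p = 0) \<and>
     (\<forall>X Y Z p. vector_field A X \<longrightarrow> vector_field A Y \<longrightarrow> vector_field A Z \<longrightarrow>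
        d_two_form A (\<lambda>q u v. g q u (\<phi> q v)) X Y Z p = 0)"


section \<open>Riemannian submersions and O'Neill's tensors\<close>

definition vertical ::
  "('a, 'e::euclidean_space) chart set \<Rightarrow> ('b, 'f::euclidean_space) chart set \<Rightarrow>
   ('a \<Rightarrow> 'b) \<Rightarrow> 'a \<Rightarrow> 'e set" where
  "vertical A B F p = {u. pushforward A B F p u = 0}"

definition orth_complement ::
  "('a \<Rightarrow> 'e::euclidean_space \<Rightarrow> 'e \<Rightarrow> real) \<Rightarrow> ('a \<Rightarrow> 'e set) \<Rightarrow> 'a \<Rightarrow> 'e set" where
  "orth_complement g D p = {u. \<forall>v\<in>D p. g p u v = 0}"

definition horizontal ::
  "('a, 'e::euclidean_space) chart set \<Rightarrow> ('b, 'f::euclidean_space) chart set \<Rightarrow>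
   ('a \<Rightarrow> 'e \<Rightarrow> 'e \<Rightarrow> real) \<Rightarrow> ('a \<Rightarrow> 'b) \<Rightarrow> 'a \<Rightarrow> 'e set" where
  "horizontal A B g F = orth_complement g (vertical A B F)"

definition orth_proj ::
  "('a \<Rightarrow> 'e::euclidean_space \<Rightarrow> 'e \<Rightarrow> real) \<Rightarrow> ('a \<Rightarrow> 'e set) \<Rightarrow> 'a \<Rightarrow> 'e \<Rightarrow> 'e" where
  "orth_proj g D p u = (THE w. w \<in> D p \<and> u - w \<in> orth_complement g D p)"

definition riemannian_submersion ::
  "('a::topological_space, 'e::euclidean_space) chart set \<Rightarrow> ('a \<Rightarrow> 'e \<Rightarrow> 'e \<Rightarrow> real) \<Rightarrow>
   ('b::topological_space, 'f::euclidean_space) chart set \<Rightarrow> ('b \<Rightarrow> 'f \<Rightarrow> 'f \<Rightarrow> real) \<Rightarrow>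
   ('a \<Rightarrow> 'b) \<Rightarrow> bool" where
  "riemannian_submersion A g B h F \<longleftrightarrow> smooth_map A B F \<and> surj F \<and>
     (\<forall>p. surj (pushforward A B F p)) \<and>
     (\<forall>p. \<forall>u\<in>horizontal A B g F p.
        sqrt (h (F p) (pushforward A B F p u) (pushforward A B F p u)) = sqrt (g p u u))"

definition anti_invariant ::
  "('a, 'e::euclidean_space) chart set \<Rightarrow> ('a \<Rightarrow> 'e \<Rightarrow> 'e) \<Rightarrow> ('a \<Rightarrow> 'e \<Rightarrow> 'e \<Rightarrow> real) \<Rightarrow>
   ('b, 'f::euclidean_space) chart set \<Rightarrow> ('a \<Rightarrow> 'b) \<Rightarrow> bool" where
  "anti_invariant A \<phi> g B F \<longleftrightarrow>
     (\<forall>p. \<phi> p ` vertical A B F p \<subseteq> horizontal A B g F p)"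

definition vert_part ::
  "('a, 'e::euclidean_space) chart set \<Rightarrow> ('b, 'f::euclidean_space) chart set \<Rightarrow>
   ('a \<Rightarrow> 'e \<Rightarrow> 'e \<Rightarrow> real) \<Rightarrow> ('a \<Rightarrow> 'b) \<Rightarrow> ('a \<Rightarrow> 'e) \<Rightarrow> 'a \<Rightarrow> 'e" where
  "vert_part A B g F X = (\<lambda>p. orth_proj g (vertical A B F) p (X p))"

definition horiz_part ::
  "('a, 'e::euclidean_space) chart set \<Rightarrow> ('b, 'f::euclidean_space) chart set \<Rightarrow>
   ('a \<Rightarrow> 'e \<Rightarrow> 'e \<Rightarrow> real) \<Rightarrow> ('a \<Rightarrow> 'b) \<Rightarrow> ('a \<Rightarrow> 'e) \<Rightarrow> 'a \<Rightarrow> 'e" where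
  "horiz_part A B g F X = (\<lambda>p. orth_proj g (horizontal A B g F) p (X p))"

definition oneill_T ::
  "('a, 'e::euclidean_space) chart set \<Rightarrow> ('b, 'f::euclidean_space) chart set \<Rightarrow>
   ('a \<Rightarrow> 'e \<Rightarrow> 'e \<Rightarrow> real) \<Rightarrow> ('a \<Rightarrow> 'b) \<Rightarrow>
   (('a \<Rightarrow> 'e) \<Rightarrow> ('a \<Rightarrow> 'e) \<Rightarrow> ('a \<Rightarrow> 'e)) \<Rightarrow>
   ('a \<Rightarrow> 'e) \<Rightarrow> ('a \<Rightarrow> 'e) \<Rightarrow> 'a \<Rightarrow> 'e" where
  "oneill_T A B g F nabla E G =
     (let \<V> = vert_part A B g F; \<H> = horiz_part A B g F in
      (\<lambda>p. \<H> (nabla (\<V> E) (\<V> G)) p + \<V> (nabla (\<V> E) (\<H> G)) p))"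

definition oneill_A ::
  "('a, 'e::euclidean_space) chart set \<Rightarrow> ('b, 'f::euclidean_space) chart set \<Rightarrow>
   ('a \<Rightarrow> 'e \<Rightarrow> 'e \<Rightarrow> real) \<Rightarrow> ('a \<Rightarrow> 'b) \<Rightarrow>
   (('a \<Rightarrow> 'e) \<Rightarrow> ('a \<Rightarrow> 'e) \<Rightarrow> ('a \<Rightarrow> 'e)) \<Rightarrow>
   ('a \<Rightarrow> 'e) \<Rightarrow> ('a \<Rightarrow> 'e) \<Rightarrow> 'a \<Rightarrow> 'e" where
  "oneill_A A B g F nabla E G =
     (let \<V> = vert_part A B g F; \<H> = horiz_part A B g F in
      (\<lambda>p. \<V> (nabla (\<H> E) (\<H> G)) p + \<H> (nabla (\<H> E) (\<V> G)) p))"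


section \<open>Local Riemannian products\<close>

text \<open>A splitting \<open>'e = P \<oplus> Q\<close> into linear subspaces is given by the projection \<open>\<pi>\<close> onto
  \<open>P = range \<pi>\<close> along \<open>Q\<close>; the projection onto \<open>Q\<close> is \<open>\<lambda>x. x - \<pi> x\<close>. A Riemannian patch is
  a relatively open subset \<open>S\<close> of a linear subspace \<open>range \<pi>\<close> with a Riemannian metric \<open>h\<close> on it,
  all tangent spaces of \<open>S\<close> being \<open>range \<pi>\<close>.\<close>

definition riemannian_patch ::
  "('e::euclidean_space \<Rightarrow> 'e) \<Rightarrow> 'e set \<Rightarrow> ('e \<Rightarrow> 'e \<Rightarrow> 'e \<Rightarrow> real) \<Rightarrow> bool" where
  "riemannian_patch \<pi> S h \<longleftrightarrow> openin (top_of_set (range \<pi>)) S \<and>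
     (\<forall>x\<in>S. bilinear (\<lambda>u v. h x (\<pi> u) (\<pi> v)) \<and>
        (\<forall>u\<in>range \<pi>. \<forall>v\<in>range \<pi>. h x u v = h x v u) \<and>
        (\<forall>u\<in>range \<pi>. u \<noteq> 0 \<longrightarrow> h x u u > 0)) \<and>
     (\<forall>u\<in>range \<pi>. \<forall>v\<in>range \<pi>. smooth_on (\<pi> -` S) (\<lambda>x. h (\<pi> x) u v))"

text \<open>Every point has an open neighbourhood \<open>U\<close> with a diffeomorphism \<open>\<psi>\<close> onto a product
  \<open>S1 \<times> S2\<close> of Riemannian manifolds that is an isometry for the product metric and carries
  \<open>D1\<close>, \<open>D2\<close> to the two canonical foliations. Since \<open>U\<close> may be shrunk, the factors are taken to
  be Riemannian patches, and \<open>S1 \<times> S2\<close> is realized as \<open>{a + b | a \<in> S1, b \<in> S2}\<close> inside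
  \<open>'e = P \<oplus> Q\<close>. A diffeomorphism onto an open subset of \<open>'e\<close> is the same as an admissible
  chart \<open>(U, \<psi>)\<close>, and its differential is \<open>to_chart A (U, \<psi>)\<close>.\<close>

definition locally_product ::
  "('a::topological_space, 'e::euclidean_space) chart set \<Rightarrow> ('a \<Rightarrow> 'e \<Rightarrow> 'e \<Rightarrow> real) \<Rightarrow>
   ('a \<Rightarrow> 'e set) \<Rightarrow> ('a \<Rightarrow> 'e set) \<Rightarrow> bool" where
  "locally_product A g D1 D2 \<longleftrightarrow>
     (\<forall>p. \<exists>U \<psi> \<pi>1 \<pi>2 S1 S2 h1 h2.
        p \<in> U \<and> admissible_chart A (U, \<psi>) \<and>
        linear \<pi>1 \<and> \<pi>1 \<circ> \<pi>1 = \<pi>1 \<and> \<pi>2 = (\<lambda>x. x - \<pi>1 x) \<and>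
        riemannian_patch \<pi>1 S1 h1 \<and> riemannian_patch \<pi>2 S2 h2 \<and>
        \<psi> ` U = {a + b | a b. a \<in> S1 \<and> b \<in> S2} \<and>
        (\<forall>q\<in>U. \<forall>u v. g q u v =
           h1 (\<pi>1 (\<psi> q)) (\<pi>1 (to_chart A (U, \<psi>) q u)) (\<pi>1 (to_chart A (U, \<psi>) q v)) +
           h2 (\<pi>2 (\<psi> q)) (\<pi>2 (to_chart A (U, \<psi>) q u)) (\<pi>2 (to_chart A (U, \<psi>) q v))) \<and>
        (\<forall>q\<in>U. to_chart A (U, \<psi>) q ` D1 q = range \<pi>1 \<and>
               to_chart A (U, \<psi>) q ` D2 q = range \<pi>2))"

end

theory Submission
  imports Defs
begin

text \<open>The cosymplectic identities give \<open>\<nabla>\<phi> = 0\<close> and \<open>\<nabla>\<xi> = 0\<close>, and \<open>\<xi>\<close> is vertical because \<open>M\<close> has odd dimension.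
  Hence \<open>\<nabla>\<close> commutes with \<open>\<phi>\<close>, which exchanges the two distributions up to \<open>\<xi>\<close>, and the conditions on
  \<open>A\<close> and \<open>T\<close> say exactly that both distributions are parallel. On a local product they are parallel by
  the Koszul formula. Conversely, if they are parallel, then \<open>\<phi>\<close> and the first Bianchi identity force
  the whole curvature of \<open>M\<close> to vanish. On a flat \<open>M\<close> a parallel frame and the potentials of its dual
  forms solve a linear total differential system, so no nonlinear Frobenius theorem is needed; these
  potentials are coordinates in which the metric and the vertical projection are constant.\<close>

section \<open>Calculus of smooth maps\<close>

text \<open>The connection is an operator on global vector fields, so cut-off extensions have to
  produce its Christoffel symbol \<open>\<Gamma>\<close> before anything can be computed in a chart.
  That \<open>\<xi>\<close> is vertical rests on parity: its multiples form the kernel of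
  \<open>\<phi>\<close>, so otherwise \<open>\<phi>\<close> would be injective on the vertical
  spaces and give both distributions the same dimension. The conditions on \<open>A\<close> and
  \<open>T\<close> see only derivatives of horizontal fields along horizontal ones and of vertical
  fields along vertical ones; differentiating the orthogonality of the two distributions supplies
  the mixed derivatives. In the flat case the unknown of the linear system is a pair of a function
  \<open>f\<close> and a field \<open>E\<close> with \<open>df = G(E, .)\<close> and
  \<open>dE = - \<Gamma> E\<close>. Integrability is symmetry of \<open>\<Gamma>\<close> in the
  first component and vanishing curvature in the second, so frame and potentials arise together. The
  system is solved by integration along rays from a centre. This integral equation by itself encodes
  only radial derivatives, so the failure in the other directions, the defect, is followed through
  the iteration.\<close>

abbreviation fd :: "('e::real_normed_vector \<Rightarrow> 'f::real_normed_vector) \<Rightarrow> 'e \<Rightarrow> 'e \<Rightarrow> 'f" where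
  "fd f x v \<equiv> frechet_derivative f (at x) v"

lemma has_derivative_cong_open:
  assumes "open S" "x \<in> S" "\<And>y. y \<in> S \<Longrightarrow> f y = g y"
  shows "(f has_derivative f') (at x) \<longleftrightarrow> (g has_derivative f') (at x)"
  using has_derivative_transform_within_open[of f f' x UNIV S g]
    has_derivative_transform_within_open[of g f' x UNIV S f] assms by auto

lemma frechet_derivative_cong_open:
  assumes "open S" "x \<in> S" "\<And>y. y \<in> S \<Longrightarrow> f y = g y"
  shows "frechet_derivative f (at x) = frechet_derivative g (at x)"
  by (simp add: frechet_derivative_def has_derivative_cong_open[OF assms])

lemma fd_eqI: "(f has_derivative f') (at x) \<Longrightarrow> fd f x v = f' v"
  by (metis frechet_derivative_at)

text \<open>Derivatives are taken in the ambient space, so agreement on \<open>S\<close> determines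
  them only because \<open>S\<close> is open.\<close>

lemma C_k_on_cong:
  assumes "open S" "\<And>x. x \<in> S \<Longrightarrow> f x = g x"
  shows "C_k_on k S f \<longleftrightarrow> C_k_on k S g"
  using assms(2)
proof (induction k arbitrary: f g)
  case 0
  show ?case unfolding C_k_on.simps by (rule continuous_on_cong[OF refl 0])
next
  case (Suc k)
  have 1: "f differentiable (at x) \<longleftrightarrow> g differentiable (at x)" if "x \<in> S" for x
  proof -
    have "(f has_derivative D) (at x) \<longleftrightarrow> (g has_derivative D) (at x)" for D
      by (rule has_derivative_cong_open[OF assms(1) that Suc.prems])
    then show ?thesis by (simp only: differentiable_def)
  qed
  have "C_k_on k S (\<lambda>x. fd f x v) = C_k_on k S (\<lambda>x. fd g x v)" for v
    by (rule Suc.IH) (simp only: frechet_derivative_cong_open[OF assms(1) _ Suc.prems])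
  with 1 show ?case by simp
qed

text \<open>Frees the recursion from the choice hidden in \<open>frechet_derivative\<close>: any
  explicit family of derivatives may be exhibited.\<close>

lemma C_k_on_SucI:
  assumes "open S" "\<And>x. x \<in> S \<Longrightarrow> (f has_derivative f' x) (at x)"
    and "\<And>v. C_k_on k S (\<lambda>x. f' x v)"
  shows "C_k_on (Suc k) S f"
proof -
  have "C_k_on k S (\<lambda>x. fd f x v) = C_k_on k S (\<lambda>x. f' x v)" for v
    using fd_eqI assms(2) by (intro C_k_on_cong assms(1)) blast
  then show ?thesis using assms by (auto simp: differentiable_def)
qed

lemma C_k_on_imp_continuous_on: "C_k_on k S f \<Longrightarrow> continuous_on S f"
  by (cases k) (auto intro!: continuous_at_imp_continuous_on differentiable_imp_continuous_within)

lemma C_k_on_Suc_has_derivative: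
  "C_k_on (Suc k) S f \<Longrightarrow> x \<in> S \<Longrightarrow> (f has_derivative fd f x) (at x)"
  by (auto simp: frechet_derivative_works[symmetric])

lemma C_k_on_SucD: "C_k_on (Suc k) S f \<Longrightarrow> C_k_on k S f"
proof (induction k arbitrary: f)
  case 0
  then show ?case using C_k_on_imp_continuous_on[of "Suc 0"] by auto
next
  case (Suc k)
  then have "C_k_on k S (\<lambda>x. fd f x v)" for v by (metis C_k_on.simps(2))
  then show ?case using Suc.prems by (simp only: C_k_on.simps) blast
qed

lemma C_k_on_subset: "C_k_on k S f \<Longrightarrow> T \<subseteq> S \<Longrightarrow> C_k_on k T f"
  by (induction k arbitrary: f) (auto intro: continuous_on_subset)

lemma C_k_on_local:
  assumes "\<And>x. x \<in> S \<Longrightarrow> \<exists>T. open T \<and> x \<in> T \<and> C_k_on k T f"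
  shows "C_k_on k S f"
  using assms
proof (induction k arbitrary: f)
  case 0
  have "isCont f x" if "x \<in> S" for x
    using 0[OF that] by (auto simp: continuous_on_eq_continuous_at)
  then show ?case by (simp add: continuous_at_imp_continuous_on)
next
  case (Suc k)
  have "C_k_on k S (\<lambda>x. fd f x v)" for v
    using Suc.prems by (intro Suc.IH) (metis C_k_on.simps(2))
  moreover have "f differentiable at x" if "x \<in> S" for x
    using Suc.prems[OF that] by auto
  ultimately show ?case by auto
qed

lemma C_k_on_const: "C_k_on k S (\<lambda>x. c)"
  by (induction k arbitrary: c) auto

lemma C_k_on_bounded_linear:
  assumes "bounded_linear h" "open S" "C_k_on k S f"
  shows "C_k_on k S (\<lambda>x. h (f x))"
  using assms(3)
proof (induction k arbitrary: f)
  case 0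
  then show ?case using bounded_linear.continuous_on[OF assms(1)] by auto
next
  case (Suc k)
  then have d: "(f has_derivative fd f x) (at x)" if "x \<in> S" for x
    using that Suc.prems C_k_on_Suc_has_derivative by blast
  show ?case
    by (rule C_k_on_SucI[OF assms(2), where f' = "\<lambda>x v. h (fd f x v)"])
      (use Suc bounded_linear.has_derivative[OF assms(1) d] in auto)
qed

lemma C_k_on_ident: "open S \<Longrightarrow> C_k_on k S (\<lambda>x. x)"
proof (cases k)
  case (Suc n)
  assume "open S"
  then show ?thesis
    unfolding Suc by (rule C_k_on_SucI[OF _ has_derivative_ident C_k_on_const])
qed auto

lemma C_k_on_add:
  assumes "open S" "C_k_on k S f" "C_k_on k S g"
  shows "C_k_on k S (\<lambda>x. f x + g x)"
  using assms(2,3)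
proof (induction k arbitrary: f g)
  case 0
  then show ?case by (auto intro: continuous_intros)
next
  case (Suc k)
  then have d: "(f has_derivative fd f x) (at x)" "(g has_derivative fd g x) (at x)" if "x \<in> S" for x
    using that Suc.prems C_k_on_Suc_has_derivative by blast+
  show ?case
    by (rule C_k_on_SucI[OF assms(1), where f' = "\<lambda>x v. fd f x v + fd g x v"])
      (use Suc d has_derivative_add in auto)
qed

lemma C_k_on_sum:
  assumes "open S" "\<And>i. i \<in> I \<Longrightarrow> C_k_on k S (f i)"
  shows "C_k_on k S (\<lambda>x. \<Sum>i\<in>I. f i x)"
  using assms(2)
proof (induction I rule: infinite_finite_induct)
  case (insert a I)
  then show ?case using C_k_on_add[OF assms(1), of k "f a" "\<lambda>x. \<Sum>i\<in>I. f i x"] by simp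
qed (auto intro: C_k_on_const)

text \<open>The product rule pairs one factor with the derivative of the other. Hence the induction
  varies both arguments and lowers the order of the undifferentiated one by
  \<open>C_k_on_SucD\<close>.\<close>

lemma C_k_on_bilinear:
  assumes p: "bounded_bilinear p" and "open S" "C_k_on k S f" "C_k_on k S g"
  shows "C_k_on k S (\<lambda>x. p (f x) (g x))"
  using assms(3,4)
proof (induction k arbitrary: f g)
  case 0
  then show ?case using bounded_bilinear.continuous_on[OF p] by auto
next
  case (Suc k)
  then have d: "(f has_derivative fd f x) (at x)" "(g has_derivative fd g x) (at x)" if "x \<in> S" for x
    using that Suc.prems C_k_on_Suc_has_derivative by blast+
  show ?case
  proof (rule C_k_on_SucI[OF assms(2), where f' = "\<lambda>x v. p (f x) (fd g x v) + p (fd f x v) (g x)"])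
    fix v
    have "C_k_on k S f" "C_k_on k S g" by (rule C_k_on_SucD[OF Suc.prems(1)], rule C_k_on_SucD[OF Suc.prems(2)])
    then show "C_k_on k S (\<lambda>x. p (f x) (fd g x v) + p (fd f x v) (g x))"
      using Suc.prems by (intro C_k_on_add assms(2) Suc.IH) auto
  qed (use bounded_bilinear.FDERIV[OF p d] in simp)
qed

text \<open>Expanding over the basis turns a varying linear map applied to a moving vector into a
  finite sum of products. This is why smoothness of a family of linear maps can be stated throughout
  for fixed argument vectors.\<close>

lemma linear_expansion:
  fixes f :: "'e::euclidean_space \<Rightarrow> 'f::real_vector"
  assumes "linear f" shows "f x = (\<Sum>b\<in>Basis. (x \<bullet> b) *\<^sub>R f b)"
proof -
  have "f x = f (\<Sum>b\<in>Basis. (x \<bullet> b) *\<^sub>R b)" by (simp add: euclidean_representation)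
  also have "\<dots> = (\<Sum>b\<in>Basis. (x \<bullet> b) *\<^sub>R f b)"
    by (simp only: linear_sum[OF assms] linear_scale[OF assms])
  finally show ?thesis .
qed

text \<open>\<open>C_k_on\<close> controls the derivative of \<open>g\<close> only on fixed vectors,
  whereas the chain rule applies it to the moving vector \<open>fd f x v\<close>. Expanding that
  vector over a basis bridges the gap, which is why the intermediate space is Euclidean.\<close>

lemma C_k_on_compose:
  fixes f :: "'e::real_normed_vector \<Rightarrow> 'm::euclidean_space"
  assumes "open S" "open T" "C_k_on k S f" "C_k_on k T g" "f ` S \<subseteq> T"
  shows "C_k_on k S (\<lambda>x. g (f x))"
  using assms(3,4)
proof (induction k arbitrary: g)
  case 0
  then show ?case using continuous_on_compose2 assms(5) by auto
next
  case (Suc k)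
  then have d: "(f has_derivative fd f x) (at x)" if "x \<in> S" for x
    using that Suc.prems C_k_on_Suc_has_derivative by blast
  have d2: "(g has_derivative fd g x) (at x)" if "x \<in> T" for x
    using that Suc.prems C_k_on_Suc_has_derivative by blast
  show ?case
  proof (rule C_k_on_SucI[OF assms(1), where f' = "\<lambda>x v. \<Sum>b\<in>Basis. (fd f x v \<bullet> b) *\<^sub>R fd g (f x) b"])
    fix x assume x: "x \<in> S"
    then have fx: "f x \<in> T" using assms(5) by auto
    have lin: "linear (fd g (f x))" using d2[OF fx] has_derivative_linear by blast
    have "fd g (f x) (fd f x v) = (\<Sum>b\<in>Basis. (fd f x v \<bullet> b) *\<^sub>R fd g (f x) b)" for v
      by (rule linear_expansion[OF lin])
    then have "(\<lambda>v. \<Sum>b\<in>Basis. (fd f x v \<bullet> b) *\<^sub>R fd g (f x) b) = fd g (f x) \<circ> fd f x"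
      by (simp add: fun_eq_iff)
    with diff_chain_at[OF d[OF x] d2[OF fx]]
    show "((\<lambda>x. g (f x)) has_derivative (\<lambda>v. \<Sum>b\<in>Basis. (fd f x v \<bullet> b) *\<^sub>R fd g (f x) b)) (at x)"
      by (simp add: o_def)
  next
    fix v
    have "C_k_on k S (\<lambda>x. fd f x v)" using Suc.prems by auto
    moreover have "C_k_on k S (\<lambda>x. fd g (f x) b)" for b
      by (rule Suc.IH) (rule C_k_on_SucD[OF Suc.prems(1)], use Suc.prems(2) in simp)
    ultimately show "C_k_on k S (\<lambda>x. \<Sum>b\<in>Basis. (fd f x v \<bullet> b) *\<^sub>R fd g (f x) b)"
      by (intro C_k_on_sum[OF assms(1) C_k_on_bilinear[OF bounded_bilinear_scaleR assms(1)
          C_k_on_bounded_linear[OF bounded_linear_inner_left assms(1)]]])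
  qed
qed

lemma C_k_on_inverse:
  fixes f :: "'e::real_normed_vector \<Rightarrow> real"
  assumes "open S" "C_k_on k S f" "\<And>x. x \<in> S \<Longrightarrow> f x \<noteq> 0"
  shows "C_k_on k S (\<lambda>x. inverse (f x))"
  using assms(2)
proof (induction k)
  case 0
  then show ?case using assms by (auto intro!: continuous_intros)
next
  case (Suc k)
  then have d: "(f has_derivative fd f x) (at x)" if "x \<in> S" for x
    using that Suc.prems C_k_on_Suc_has_derivative by blast
  have i: "C_k_on k S (\<lambda>x. inverse (f x))" by (rule Suc.IH[OF C_k_on_SucD[OF Suc.prems]])
  show ?case
  proof (rule C_k_on_SucI[OF assms(1), where f' = "\<lambda>x v. - (inverse (f x) * fd f x v * inverse (f x))"])
    fix v
    have "C_k_on k S (\<lambda>x. inverse (f x) * fd f x v * inverse (f x))"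
      using i Suc.prems by (intro C_k_on_bilinear[OF bounded_bilinear_mult] assms(1)) auto
    then show "C_k_on k S (\<lambda>x. - (inverse (f x) * fd f x v * inverse (f x)))"
      by (intro C_k_on_bounded_linear[OF bounded_linear_minus[OF bounded_linear_ident]] assms(1))
  qed (rule Deriv.has_derivative_inverse[OF assms(3) d])
qed

lemma smooth_on_const [intro!, simp]: "smooth_on S (\<lambda>x. c)"
  by (simp add: smooth_on_def C_k_on_const)

lemma smooth_on_ident: "open S \<Longrightarrow> smooth_on S (\<lambda>x. x)"
  by (simp add: smooth_on_def C_k_on_ident)

lemma smooth_on_bounded_linear:
  "bounded_linear h \<Longrightarrow> open S \<Longrightarrow> smooth_on S f \<Longrightarrow> smooth_on S (\<lambda>x. h (f x))"
  by (simp add: smooth_on_def C_k_on_bounded_linear[of h S _ f])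

lemma smooth_on_add:
  "open S \<Longrightarrow> smooth_on S f \<Longrightarrow> smooth_on S g \<Longrightarrow> smooth_on S (\<lambda>x. f x + g x)"
  by (simp add: smooth_on_def C_k_on_add[of S _ f g])

lemma smooth_on_minus: "open S \<Longrightarrow> smooth_on S f \<Longrightarrow> smooth_on S (\<lambda>x. - f x)"
  by (intro smooth_on_bounded_linear[OF bounded_linear_minus[OF bounded_linear_ident]])

lemma smooth_on_diff:
  "open S \<Longrightarrow> smooth_on S f \<Longrightarrow> smooth_on S g \<Longrightarrow> smooth_on S (\<lambda>x. f x - g x)"
  using smooth_on_add[OF _ _ smooth_on_minus, of S f g] by simp

lemma smooth_on_sum:
  "open S \<Longrightarrow> (\<And>i. i \<in> I \<Longrightarrow> smooth_on S (f i)) \<Longrightarrow> smooth_on S (\<lambda>x. \<Sum>i\<in>I. f i x)"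
  by (simp add: smooth_on_def C_k_on_sum[of S I _ f])

lemma smooth_on_bilinear:
  "bounded_bilinear p \<Longrightarrow> open S \<Longrightarrow> smooth_on S f \<Longrightarrow> smooth_on S g \<Longrightarrow>
    smooth_on S (\<lambda>x. p (f x) (g x))"
  by (simp add: smooth_on_def C_k_on_bilinear[of p S _ f g])

lemmas smooth_on_scaleR = smooth_on_bilinear[OF bounded_bilinear_scaleR]
lemmas smooth_on_mult = smooth_on_bilinear[OF bounded_bilinear_mult]
lemmas smooth_on_inner = smooth_on_bilinear[OF bounded_bilinear_inner]

lemma smooth_on_compose:
  fixes f :: "'e::real_normed_vector \<Rightarrow> 'm::euclidean_space"
  shows "open S \<Longrightarrow> open T \<Longrightarrow> smooth_on S f \<Longrightarrow> smooth_on T g \<Longrightarrow> f ` S \<subseteq> T \<Longrightarrow>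
    smooth_on S (\<lambda>x. g (f x))"
  by (simp add: smooth_on_def C_k_on_compose[of S T _ f g])

lemma smooth_on_inverse:
  fixes f :: "'e::real_normed_vector \<Rightarrow> real"
  shows "open S \<Longrightarrow> smooth_on S f \<Longrightarrow> (\<And>x. x \<in> S \<Longrightarrow> f x \<noteq> 0) \<Longrightarrow>
    smooth_on S (\<lambda>x. inverse (f x))"
  by (simp add: smooth_on_def C_k_on_inverse[of S _ f])

lemma smooth_on_subset: "smooth_on S f \<Longrightarrow> T \<subseteq> S \<Longrightarrow> smooth_on T f"
  by (simp add: smooth_on_def C_k_on_subset[of _ S f T])

lemma smooth_on_cong:
  "open S \<Longrightarrow> (\<And>x. x \<in> S \<Longrightarrow> f x = g x) \<Longrightarrow> smooth_on S f \<longleftrightarrow> smooth_on S g"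
  by (simp add: smooth_on_def C_k_on_cong[of S f g])

lemma smooth_on_local:
  assumes "\<And>x. x \<in> S \<Longrightarrow> \<exists>T. open T \<and> x \<in> T \<and> smooth_on T f"
  shows "smooth_on S f"
  unfolding smooth_on_def
proof (intro allI C_k_on_local)
  fix k x assume "x \<in> S"
  then obtain T where "open T" "x \<in> T" "smooth_on T f" using assms by blast
  then show "\<exists>T. open T \<and> x \<in> T \<and> C_k_on k T f" by (auto simp: smooth_on_def)
qed

lemma smooth_on_has_derivative:
  "smooth_on S f \<Longrightarrow> x \<in> S \<Longrightarrow> (f has_derivative fd f x) (at x)"
  unfolding smooth_on_def by (rule C_k_on_Suc_has_derivative) (erule spec)

lemma smooth_on_fd: "smooth_on S f \<Longrightarrow> smooth_on S (\<lambda>x. fd f x v)"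
  unfolding smooth_on_def
proof
  fix k assume "\<forall>k. C_k_on k S f"
  then have "C_k_on (Suc k) S f" ..
  then show "C_k_on k S (\<lambda>x. fd f x v)" by simp
qed

lemma smooth_on_imp_continuous_on: "smooth_on S f \<Longrightarrow> continuous_on S f"
  unfolding smooth_on_def by (rule C_k_on_imp_continuous_on) (erule spec)

text \<open>Made for solutions of differential equations, whose derivative is an expression in
  \<open>f\<close> itself: each order of differentiability of \<open>f\<close> passes to the
  derivative and so gives one more order for \<open>f\<close>.\<close>

lemma smooth_on_bootstrap:
  assumes "open S" "\<And>x. x \<in> S \<Longrightarrow> (f has_derivative f' x) (at x)"
    and "\<And>k v. C_k_on k S f \<Longrightarrow> C_k_on k S (\<lambda>x. f' x v)"
  shows "smooth_on S f"
proof -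
  have "C_k_on k S f" for k
  proof (induction k)
    case 0
    have "\<forall>x\<in>S. isCont f x" using assms(2) has_derivative_continuous by blast
    then show ?case by (simp add: continuous_at_imp_continuous_on)
  next
    case (Suc k)
    then show ?case by (intro C_k_on_SucI[OF assms(1,2)] assms(3))
  qed
  then show ?thesis by (simp add: smooth_on_def)
qed

section \<open>Linear and bilinear maps depending on a parameter\<close>

lemma C_k_on_linear_apply:
  fixes A :: "'e::real_normed_vector \<Rightarrow> 'm::euclidean_space \<Rightarrow> 'f::real_normed_vector"
  assumes "open S" "\<And>x. x \<in> S \<Longrightarrow> linear (A x)" "\<And>u. C_k_on k S (\<lambda>x. A x u)" "C_k_on k S u"
  shows "C_k_on k S (\<lambda>x. A x (u x))"
proof -
  have "C_k_on k S (\<lambda>x. \<Sum>b\<in>Basis. (u x \<bullet> b) *\<^sub>R A x b)"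
    by (intro C_k_on_sum[OF assms(1) C_k_on_bilinear[OF bounded_bilinear_scaleR assms(1)
          C_k_on_bounded_linear[OF bounded_linear_inner_left assms(1,4)] assms(3)]])
  moreover have "C_k_on k S (\<lambda>x. A x (u x)) \<longleftrightarrow> C_k_on k S (\<lambda>x. \<Sum>b\<in>Basis. (u x \<bullet> b) *\<^sub>R A x b)"
    by (rule C_k_on_cong[OF assms(1)]) (rule linear_expansion[OF assms(2)])
  ultimately show ?thesis by blast
qed

lemma smooth_on_linear_apply:
  fixes A :: "'e::real_normed_vector \<Rightarrow> 'm::euclidean_space \<Rightarrow> 'f::real_normed_vector"
  assumes "open S" "\<And>x. x \<in> S \<Longrightarrow> linear (A x)" "\<And>u. smooth_on S (\<lambda>x. A x u)" "smooth_on S u"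
  shows "smooth_on S (\<lambda>x. A x (u x))"
  using assms by (simp add: smooth_on_def C_k_on_linear_apply[of S A _ u])

lemma smooth_on_bilinear_apply:
  fixes B :: "'e::real_normed_vector \<Rightarrow> 'm::euclidean_space \<Rightarrow> 'n::euclidean_space \<Rightarrow> 'f::real_normed_vector"
  assumes "open S" "\<And>x. x \<in> S \<Longrightarrow> bilinear (B x)" "\<And>u v. smooth_on S (\<lambda>x. B x u v)"
    "smooth_on S u" "smooth_on S v"
  shows "smooth_on S (\<lambda>x. B x (u x) (v x))"
proof -
  have lin: "linear (\<lambda>u. B x u w)" "linear (\<lambda>w. B x u w)" if "x \<in> S" for x u w
    using assms(2)[OF that] by (auto simp: bilinear_def)
  have "smooth_on S (\<lambda>x. B x (u x) w)" for w
    by (rule smooth_on_linear_apply[where A = "\<lambda>x u. B x u w", OF assms(1) lin(1) assms(3,4)])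
  from smooth_on_linear_apply[where A = "\<lambda>x w. B x (u x) w", OF assms(1) lin(2) this assms(5)]
  show ?thesis .
qed

lemma linear_fd_param:
  fixes A :: "'e::real_normed_vector \<Rightarrow> 'm::euclidean_space \<Rightarrow> 'f::real_normed_vector"
  assumes "open S" "x \<in> S" "\<And>y. y \<in> S \<Longrightarrow> linear (A y)"
    "\<And>u. (\<lambda>y. A y u) differentiable (at x)"
  shows "linear (\<lambda>u. fd (\<lambda>y. A y u) x w)"
proof -
  have d: "((\<lambda>y. A y u) has_derivative fd (\<lambda>y. A y u) x) (at x)" for u
    using assms(4) frechet_derivative_works by blast
  show ?thesis
  proof (rule linearI)
    fix u v
    have "((\<lambda>y. A y (u + v)) has_derivative (\<lambda>w. fd (\<lambda>y. A y u) x w + fd (\<lambda>y. A y v) x w)) (at x)"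
      by (rule has_derivative_transform_within_open[OF has_derivative_add[OF d[of u] d[of v]] assms(1,2)])
        (simp add: assms(3) linear_add)
    then show "fd (\<lambda>y. A y (u + v)) x w = fd (\<lambda>y. A y u) x w + fd (\<lambda>y. A y v) x w"
      by (rule fd_eqI)
  next
    fix r u
    have "((\<lambda>y. A y (r *\<^sub>R u)) has_derivative (\<lambda>w. r *\<^sub>R fd (\<lambda>y. A y u) x w)) (at x)"
      by (rule has_derivative_transform_within_open[OF has_derivative_scaleR_right[OF d[of u]] assms(1,2)])
        (simp add: assms(3) linear_scale)
    then show "fd (\<lambda>y. A y (r *\<^sub>R u)) x w = r *\<^sub>R fd (\<lambda>y. A y u) x w"
      by (rule fd_eqI)
  qed
qed

lemma has_derivative_linear_apply:
  fixes A :: "'e::real_normed_vector \<Rightarrow> 'm::euclidean_space \<Rightarrow> 'f::real_normed_vector"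
  assumes "open S" "x \<in> S" "\<And>y. y \<in> S \<Longrightarrow> linear (A y)"
    "\<And>u. (\<lambda>y. A y u) differentiable (at x)" "(u has_derivative u') (at x)"
  shows "((\<lambda>y. A y (u y)) has_derivative (\<lambda>w. fd (\<lambda>y. A y (u x)) x w + A x (u' w))) (at x)"
proof -
  have d: "((\<lambda>y. A y u) has_derivative fd (\<lambda>y. A y u) x) (at x)" for u
    using assms(4) frechet_derivative_works by blast
  have "((\<lambda>y. \<Sum>b\<in>Basis. (u y \<bullet> b) *\<^sub>R A y b) has_derivative
      (\<lambda>w. \<Sum>b\<in>Basis. (u x \<bullet> b) *\<^sub>R fd (\<lambda>y. A y b) x w + (u' w \<bullet> b) *\<^sub>R A x b)) (at x)"
    using d assms(5) by (intro has_derivative_sum has_derivative_scaleR has_derivative_inner_left)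
  moreover have "(\<Sum>b\<in>Basis. (u x \<bullet> b) *\<^sub>R fd (\<lambda>y. A y b) x w + (u' w \<bullet> b) *\<^sub>R A x b) =
      fd (\<lambda>y. A y (u x)) x w + A x (u' w)" for w
    using linear_expansion[OF assms(3)[OF assms(2)], of "u' w"]
      linear_expansion[OF linear_fd_param[OF assms(1-4), of w], of "u x"]
    by (simp add: sum.distrib)
  ultimately have "((\<lambda>y. \<Sum>b\<in>Basis. (u y \<bullet> b) *\<^sub>R A y b) has_derivative
      (\<lambda>w. fd (\<lambda>y. A y (u x)) x w + A x (u' w))) (at x)" by simp
  then show ?thesis
    by (rule has_derivative_transform_within_open[OF _ assms(1,2)])
      (rule linear_expansion[OF assms(3), symmetric])
qed

lemma fd_linear_apply:
  fixes A :: "'e::real_normed_vector \<Rightarrow> 'm::euclidean_space \<Rightarrow> 'f::real_normed_vector"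
  assumes "open S" "x \<in> S" "\<And>y. y \<in> S \<Longrightarrow> linear (A y)"
    "\<And>u. smooth_on S (\<lambda>y. A y u)" "smooth_on S u"
  shows "fd (\<lambda>y. A y (u y)) x w = fd (\<lambda>y. A y (u x)) x w + A x (fd u x w)"
proof (rule fd_eqI, rule has_derivative_linear_apply[OF assms(1-3)])
  show "(\<lambda>y. A y u) differentiable at x" for u
    using smooth_on_has_derivative[OF assms(4,2)] differentiable_def by blast
qed (use smooth_on_has_derivative[OF assms(5,2)] in auto)

lemma fd_bilinear_apply:
  fixes B :: "'e::real_normed_vector \<Rightarrow> 'm::euclidean_space \<Rightarrow> 'n::euclidean_space \<Rightarrow> 'f::real_normed_vector"
  assumes "open S" "x \<in> S" "\<And>x. x \<in> S \<Longrightarrow> bilinear (B x)" "\<And>u v. smooth_on S (\<lambda>x. B x u v)"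
    "smooth_on S u" "smooth_on S v"
  shows "fd (\<lambda>y. B y (u y) (v y)) x w =
    fd (\<lambda>y. B y (u x) (v x)) x w + B x (fd u x w) (v x) + B x (u x) (fd v x w)"
proof -
  have lin: "linear (\<lambda>u. B x u w)" "linear (\<lambda>w. B x u w)" if "x \<in> S" for x u w
    using assms(3)[OF that] by (auto simp: bilinear_def)
  have s: "smooth_on S (\<lambda>x. B x (u x) w)" for w
    by (rule smooth_on_linear_apply[where A = "\<lambda>x u. B x u w", OF assms(1) lin(1) assms(4,5)])
  have "fd (\<lambda>y. B y (u y) (v y)) x w = fd (\<lambda>y. B y (u y) (v x)) x w + B x (u x) (fd v x w)"
    by (rule fd_linear_apply[where A="\<lambda>y. B y (u y)", OF assms(1,2) lin(2) s assms(6)])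
  also have "fd (\<lambda>y. B y (u y) (v x)) x w = fd (\<lambda>y. B y (u x) (v x)) x w + B x (fd u x w) (v x)"
    by (rule fd_linear_apply[where A="\<lambda>y u. B y u (v x)", OF assms(1,2) lin(1) assms(4,5)])
  finally show ?thesis .
qed

lemma fd_add: "smooth_on S f \<Longrightarrow> smooth_on S g \<Longrightarrow> x \<in> S \<Longrightarrow>
    fd (\<lambda>x. f x + g x) x v = fd f x v + fd g x v"
  by (rule fd_eqI, rule has_derivative_add) (rule smooth_on_has_derivative; assumption)+

lemma fd_diff: "smooth_on S f \<Longrightarrow> smooth_on S g \<Longrightarrow> x \<in> S \<Longrightarrow>
    fd (\<lambda>x. f x - g x) x v = fd f x v - fd g x v"
  by (rule fd_eqI, rule has_derivative_diff) (rule smooth_on_has_derivative; assumption)+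

lemma fd_minus: "smooth_on S f \<Longrightarrow> x \<in> S \<Longrightarrow> fd (\<lambda>x. - f x) x v = - fd f x v"
  by (rule fd_eqI, rule has_derivative_minus) (rule smooth_on_has_derivative; assumption)+

lemma linear_fd: "smooth_on S f \<Longrightarrow> x \<in> S \<Longrightarrow> linear (fd f x)"
  using smooth_on_has_derivative has_derivative_linear by blast

lemma fd_chain:
  assumes "smooth_on S f" "smooth_on T g" "x \<in> S" "f x \<in> T"
  shows "fd (\<lambda>x. g (f x)) x v = fd g (f x) (fd f x v)"
  using diff_chain_at[OF smooth_on_has_derivative[OF assms(1,3)] smooth_on_has_derivative[OF assms(2,4)]]
  by (simp add: fd_eqI o_def)

section \<open>Symmetry of second derivatives\<close>

lemma DERIV_along_line:
  fixes g :: "'e::real_normed_vector \<Rightarrow> real"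
  assumes "smooth_on S g" "x + \<sigma> *\<^sub>R u \<in> S"
  shows "((\<lambda>\<sigma>. g (x + \<sigma> *\<^sub>R u)) has_real_derivative fd g (x + \<sigma> *\<^sub>R u) u) (at \<sigma>)"
proof -
  have 1: "((\<lambda>\<sigma>. x + \<sigma> *\<^sub>R u) has_derivative (\<lambda>h. h *\<^sub>R u)) (at \<sigma>)"
    by (auto intro!: derivative_eq_intros)
  have 2: "linear (fd g (x + \<sigma> *\<^sub>R u))" by (rule linear_fd[OF assms])
  have "((\<lambda>\<sigma>. g (x + \<sigma> *\<^sub>R u)) has_derivative (\<lambda>h. fd g (x + \<sigma> *\<^sub>R u) (h *\<^sub>R u))) (at \<sigma>)"
    using diff_chain_at[OF 1 smooth_on_has_derivative[OF assms]] by (simp add: o_def)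
  moreover have "(\<lambda>h. fd g (x + \<sigma> *\<^sub>R u) (h *\<^sub>R u)) = (*) (fd g (x + \<sigma> *\<^sub>R u) u)"
    by (auto simp: linear_scale[OF 2] mult.commute)
  ultimately show ?thesis by (simp add: has_field_derivative_def)
qed

text \<open>The mean value theorem is used twice, first in direction \<open>u\<close> and then in
  direction \<open>v\<close>. The second difference is symmetric in \<open>u\<close> and
  \<open>v\<close>, so evaluating it in both orders compares the two mixed derivatives at nearby
  points.\<close>

lemma second_difference:
  fixes g :: "'e::real_normed_vector \<Rightarrow> real"
  assumes g: "smooth_on S g" and "0 < s"
    and S: "\<And>\<sigma> \<tau>. 0 \<le> \<sigma> \<Longrightarrow> \<sigma> \<le> s \<Longrightarrow> 0 \<le> \<tau> \<Longrightarrow> \<tau> \<le> s \<Longrightarrow> z + \<sigma> *\<^sub>R u + \<tau> *\<^sub>R v \<in> S"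
  obtains \<sigma> \<tau> where "0 \<le> \<sigma>" "\<sigma> \<le> s" "0 \<le> \<tau>" "\<tau> \<le> s"
    "g (z + s *\<^sub>R u + s *\<^sub>R v) - g (z + s *\<^sub>R u) - g (z + s *\<^sub>R v) + g z =
      s * s * fd (\<lambda>x. fd g x u) (z + \<sigma> *\<^sub>R u + \<tau> *\<^sub>R v) v"
proof -
  let ?h = "\<lambda>\<sigma>. g ((z + s *\<^sub>R v) + \<sigma> *\<^sub>R u) - g (z + \<sigma> *\<^sub>R u)"
  have 1: "z + s *\<^sub>R v + \<sigma> *\<^sub>R u \<in> S" "z + \<sigma> *\<^sub>R u \<in> S" if "0 \<le> \<sigma>" "\<sigma> \<le> s" for \<sigma>
    using S[OF that, of s] S[OF that, of 0] \<open>0 < s\<close> by (simp_all add: algebra_simps)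
  have "(?h has_real_derivative
      (fd g (z + s *\<^sub>R v + \<sigma> *\<^sub>R u) u - fd g (z + \<sigma> *\<^sub>R u) u)) (at \<sigma>)" if "0 \<le> \<sigma>" "\<sigma> \<le> s" for \<sigma>
    by (rule DERIV_diff; rule DERIV_along_line[OF g]; rule 1[OF that])
  from MVT2[OF \<open>0 < s\<close> this] obtain \<sigma> where \<sigma>: "0 < \<sigma>" "\<sigma> < s"
    "?h s - ?h 0 = (s - 0) * (fd g (z + s *\<^sub>R v + \<sigma> *\<^sub>R u) u - fd g (z + \<sigma> *\<^sub>R u) u)" by blast
  let ?k = "\<lambda>\<tau>. fd g ((z + \<sigma> *\<^sub>R u) + \<tau> *\<^sub>R v) u"
  have "(?k has_real_derivative fd (\<lambda>x. fd g x u) ((z + \<sigma> *\<^sub>R u) + \<tau> *\<^sub>R v) v) (at \<tau>)"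
    if "0 \<le> \<tau>" "\<tau> \<le> s" for \<tau>
    by (rule DERIV_along_line[OF smooth_on_fd[OF g]], rule S) (use \<sigma> that in auto)
  from MVT2[OF \<open>0 < s\<close> this] obtain \<tau> where \<tau>: "0 < \<tau>" "\<tau> < s"
    "?k s - ?k 0 = (s - 0) * fd (\<lambda>x. fd g x u) ((z + \<sigma> *\<^sub>R u) + \<tau> *\<^sub>R v) v" by blast
  have "z + s *\<^sub>R v + \<sigma> *\<^sub>R u = z + \<sigma> *\<^sub>R u + s *\<^sub>R v" by simp
  note eq = this
  have "?h s - ?h 0 = s * (s * fd (\<lambda>x. fd g x u) (z + \<sigma> *\<^sub>R u + \<tau> *\<^sub>R v) v)"
    using \<sigma>(3) \<tau>(3) unfolding eq by simp
  moreover have "z + s *\<^sub>R v + s *\<^sub>R u = z + s *\<^sub>R u + s *\<^sub>R v" by simp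
  ultimately show thesis
    using \<sigma> \<tau> that[of \<sigma> \<tau>] by (simp add: algebra_simps)
qed

lemma fd_fd_symmetric_real:
  fixes g :: "'e::real_normed_vector \<Rightarrow> real"
  assumes "open S" "smooth_on S g" "z \<in> S"
  shows "fd (\<lambda>x. fd g x u) z v = fd (\<lambda>x. fd g x v) z u"
proof (rule ccontr)
  let ?A = "\<lambda>x. fd (\<lambda>x. fd g x u) x v" and ?B = "\<lambda>x. fd (\<lambda>x. fd g x v) x u"
  assume neq: "?A z \<noteq> ?B z"
  have "isCont (\<lambda>x. ?A x) z" "isCont (\<lambda>x. ?B x) z"
    using smooth_on_imp_continuous_on[OF smooth_on_fd[OF smooth_on_fd[OF assms(2)]]]
      assms(1,3) continuous_on_eq_continuous_at by metis+
  \<comment> \<open>Half of the gap: if both mixed derivatives stay within \<open>e\<close> of their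
    values at \<open>z\<close>, they cannot take a common value nearby.\<close>
  moreover define e where "e = \<bar>?A z - ?B z\<bar> / 2"
  moreover have "e > 0" using neq by (simp add: e_def)
  ultimately obtain d1 d2 where d: "d1 > 0" "d2 > 0"
    "\<And>y. dist y z < d1 \<Longrightarrow> dist (?A y) (?A z) < e" "\<And>y. dist y z < d2 \<Longrightarrow> dist (?B y) (?B z) < e"
    unfolding continuous_at_eps_delta by (metis (no_types, lifting))
  obtain d3 where d3: "d3 > 0" "ball z d3 \<subseteq> S" using assms(1,3) openE by blast
  define d where "d = min d1 (min d2 d3)"
  \<comment> \<open>With this side length the whole parallelogram lies within distance
    \<open>d\<close> of \<open>z\<close>; the summand 1 keeps the denominator positive when
    \<open>u\<close> and \<open>v\<close> vanish.\<close>
  define s where "s = d / (norm u + norm v + 1)"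
  have "d > 0" using d d3 by (simp add: d_def)
  then have s: "s > 0" by (simp add: s_def add_nonneg_pos)
  have near: "dist (z + \<sigma> *\<^sub>R a + \<tau> *\<^sub>R b) z < d" if "0 \<le> \<sigma>" "\<sigma> \<le> s" "0 \<le> \<tau>" "\<tau> \<le> s"
    and ab: "norm a + norm b = norm u + norm v" for \<sigma> \<tau> a b
  proof -
    have "dist (z + \<sigma> *\<^sub>R a + \<tau> *\<^sub>R b) z = norm (\<sigma> *\<^sub>R a + \<tau> *\<^sub>R b)" by (simp add: dist_norm add.assoc)
    also have "\<dots> \<le> s * norm a + s * norm b"
      using that by (intro order_trans[OF norm_triangle_ineq] add_mono) (auto intro: mult_right_mono)
    also have "\<dots> = s * (norm u + norm v)" using ab by (simp flip: distrib_left)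
    also have "\<dots> < s * (norm u + norm v + 1)" using s by simp
    also have "\<dots> = d"
      using add_nonneg_pos[of "norm u + norm v" 1] by (simp add: s_def)
    finally show ?thesis .
  qed
  have inS: "z + \<sigma> *\<^sub>R a + \<tau> *\<^sub>R b \<in> S" if "0 \<le> \<sigma>" "\<sigma> \<le> s" "0 \<le> \<tau>" "\<tau> \<le> s"
    "norm a + norm b = norm u + norm v" for \<sigma> \<tau> a b
    using near[OF that] d3(2) by (force simp: d_def dist_commute)
  obtain \<sigma> \<tau> where 1: "0 \<le> \<sigma>" "\<sigma> \<le> s" "0 \<le> \<tau>" "\<tau> \<le> s"
    "g (z + s *\<^sub>R u + s *\<^sub>R v) - g (z + s *\<^sub>R u) - g (z + s *\<^sub>R v) + g z =
      s * s * fd (\<lambda>x. fd g x u) (z + \<sigma> *\<^sub>R u + \<tau> *\<^sub>R v) v"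
    by (rule second_difference[OF assms(2) s, of z u v]) (use inS in auto)
  obtain \<sigma>' \<tau>' where 2: "0 \<le> \<sigma>'" "\<sigma>' \<le> s" "0 \<le> \<tau>'" "\<tau>' \<le> s"
    "g (z + s *\<^sub>R v + s *\<^sub>R u) - g (z + s *\<^sub>R v) - g (z + s *\<^sub>R u) + g z =
      s * s * fd (\<lambda>x. fd g x v) (z + \<sigma>' *\<^sub>R v + \<tau>' *\<^sub>R u) u"
    by (rule second_difference[OF assms(2) s, of z v u]) (use inS add.commute in auto)
  have "g (z + s *\<^sub>R v + s *\<^sub>R u) = g (z + s *\<^sub>R u + s *\<^sub>R v)" by (simp add: algebra_simps)
  then have "s * s * ?A (z + \<sigma> *\<^sub>R u + \<tau> *\<^sub>R v) = s * s * ?B (z + \<sigma>' *\<^sub>R v + \<tau>' *\<^sub>R u)"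
    using 1(5) 2(5) by linarith
  then have "?A (z + \<sigma> *\<^sub>R u + \<tau> *\<^sub>R v) = ?B (z + \<sigma>' *\<^sub>R v + \<tau>' *\<^sub>R u)" using s by simp
  moreover have "dist (?A z) (?A (z + \<sigma> *\<^sub>R u + \<tau> *\<^sub>R v)) < e"
    using near[OF 1(1-4), of u v] unfolding dist_commute[of "?A z"] by (intro d) (simp add: d_def)
  moreover have "dist (?B z) (?B (z + \<sigma>' *\<^sub>R v + \<tau>' *\<^sub>R u)) < e"
    using near[OF 2(1-4), of v u] unfolding dist_commute[of "?B z"] by (intro d) (simp add: d_def)
  ultimately have "dist (?A z) (?B z) < e + e"
    using dist_triangle_less_add[of "?A z" "?A (z + \<sigma> *\<^sub>R u + \<tau> *\<^sub>R v)" e "?B z" e] by simp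
  then show False by (simp add: e_def dist_real_def)
qed

lemma fd_fd_symmetric:
  fixes f :: "'e::real_normed_vector \<Rightarrow> 'f::euclidean_space"
  assumes "open S" "smooth_on S f" "z \<in> S"
  shows "fd (\<lambda>x. fd f x u) z v = fd (\<lambda>x. fd f x v) z u"
proof (rule euclidean_eqI)
  fix b :: 'f assume "b \<in> Basis"
  have s: "smooth_on S (\<lambda>x. f x \<bullet> b)"
    by (rule smooth_on_bounded_linear[OF bounded_linear_inner_left assms(1,2)])
  have c: "fd (\<lambda>x. h x \<bullet> b) x w = fd h x w \<bullet> b" if "smooth_on S h" "x \<in> S" for h :: "'e \<Rightarrow> 'f" and x w
    by (rule fd_eqI, rule has_derivative_inner_left, rule smooth_on_has_derivative[OF that])
  have cc: "fd (\<lambda>x. fd (\<lambda>x. f x \<bullet> b) x u) z v = fd (\<lambda>x. fd f x u) z v \<bullet> b" for u v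
  proof -
    have "fd (\<lambda>x. fd (\<lambda>x. f x \<bullet> b) x u) z v = fd (\<lambda>x. fd f x u \<bullet> b) z v"
      using frechet_derivative_cong_open[OF assms(1,3), of "\<lambda>x. fd (\<lambda>x. f x \<bullet> b) x u" "\<lambda>x. fd f x u \<bullet> b"]
        c[OF assms(2)] by simp
    then show ?thesis using c[OF smooth_on_fd[OF assms(2)] assms(3)] by simp
  qed
  show "fd (\<lambda>x. fd f x u) z v \<bullet> b = fd (\<lambda>x. fd f x v) z u \<bullet> b"
    using fd_fd_symmetric_real[OF assms(1) s assms(3), of u v] by (simp add: cc)
qed

subsection \<open>Bump functions\<close>

text \<open>For \<open>n = 0\<close> this is the standard function \<open>exp (-1/t)\<close>. The
  powers of \<open>1/t\<close> are included because the family is closed under differentiation up to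
  linear combinations, so one induction treats all members.\<close>

definition flat_fun :: "nat \<Rightarrow> real \<Rightarrow> real" where
  "flat_fun n t = (if t > 0 then exp (- inverse t) * inverse t ^ n else 0)"

text \<open>A single term of the exponential series at \<open>1/t\<close>, the one of index
  \<open>n + 2\<close>, bounds \<open>exp (1/t)\<close> from below. The two extra powers leave a
  quadratic bound, which makes the derivative at 0 vanish.\<close>

lemma flat_fun_bound: "\<bar>flat_fun n t\<bar> \<le> fact (n + 2) * t\<^sup>2"
proof (cases "t > 0")
  case True
  define y where "y = inverse t"
  have y: "y > 0" using True by (simp add: y_def)
  have "(\<Sum>k\<in>{n+2}. y ^ k /\<^sub>R fact k) \<le> (\<Sum>k. y ^ k /\<^sub>R fact k)"
    using y by (intro sum_le_suminf summable_exp_generic) auto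
  then have "y ^ (n + 2) / fact (n + 2) \<le> exp y" by (simp add: exp_def divide_inverse mult.commute)
  then have "y ^ n * y\<^sup>2 \<le> fact (n + 2) * exp y"
    by (simp add: pos_divide_le_eq mult.commute power_add power2_eq_square)
  then have "y ^ n \<le> fact (n + 2) * exp y * t\<^sup>2"
    using True by (simp add: y_def field_simps)
  then have "exp (- y) * y ^ n \<le> exp (- y) * (fact (n + 2) * exp y * t\<^sup>2)" by simp
  also have "\<dots> = fact (n + 2) * t\<^sup>2" by (simp add: exp_minus field_simps)
  finally show ?thesis using True y by (simp add: flat_fun_def y_def)
qed (simp add: flat_fun_def)

lemma flat_fun_DERIV:
  "(flat_fun n has_real_derivative (flat_fun (n + 2) t - n * flat_fun (n + 1) t)) (at t)"
proof -
  consider "t > 0" | "t < 0" | "t = 0" by linarith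
  then show ?thesis
  proof cases
    case 1
    have e: "exp (- inverse t) * inverse t ^ n = flat_fun n t" if "t \<in> {0<..}" for t
      using that by (simp add: flat_fun_def)
    have "((\<lambda>t. exp (- inverse t) * inverse t ^ n) has_real_derivative
        (flat_fun (n + 2) t - n * flat_fun (n + 1) t)) (at t)"
      using 1 by (auto intro!: derivative_eq_intros simp: flat_fun_def power2_eq_square)
        (cases n; simp add: field_simps)
    then show ?thesis
      by (rule has_field_derivative_transform_within_open[where S = "{0<..}"]) (use 1 e in auto)
  next
    case 2
    have "((\<lambda>t. 0) has_real_derivative (flat_fun (n + 2) t - n * flat_fun (n + 1) t)) (at t)"
      using 2 by (simp add: flat_fun_def)
    then show ?thesis
      by (rule has_field_derivative_transform_within_open[where S = "{..<0}"]) (use 2 in \<open>auto simp: flat_fun_def\<close>)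
  next
    case 3
    have "((\<lambda>h. flat_fun n h / h) \<longlongrightarrow> 0) (at 0)"
    proof (rule tendsto_0_le)
      show "((\<lambda>h::real. h) \<longlongrightarrow> 0) (at 0)" by (simp add: tendsto_ident_at)
      show "\<forall>\<^sub>F h in at 0. norm (flat_fun n h / h) \<le> norm h * fact (n + 2)"
      proof (rule eventuallyI)
        fix h :: real
        have "\<bar>flat_fun n h\<bar> \<le> \<bar>h\<bar> * fact (n + 2) * \<bar>h\<bar>"
          using flat_fun_bound[of n h] by (simp only: power2_eq_square mult.assoc mult.left_commute abs_mult_self_eq)
        then show "norm (flat_fun n h / h) \<le> norm h * fact (n + 2)"
          by (cases "h = 0") (simp_all add: abs_divide divide_le_eq del: fact_Suc)
      qed
    qed
    then show ?thesis using 3 by (simp add: DERIV_def flat_fun_def)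
  qed
qed

lemma smooth_on_flat_fun: "smooth_on UNIV (flat_fun n)"
proof -
  have "C_k_on k UNIV (flat_fun n)" for k n
  proof (induction k arbitrary: n)
    case 0
    then show ?case using flat_fun_DERIV DERIV_isCont
      by (metis C_k_on.simps(1) continuous_at_imp_continuous_on)
  next
    case (Suc k)
    show ?case
    proof (rule C_k_on_SucI)
      show "(flat_fun n has_derivative (\<lambda>v. (flat_fun (n + 2) t + (- real n) * flat_fun (n + 1) t) * v)) (at t)" for t
        using flat_fun_DERIV[of n t] by (simp add: has_field_derivative_def)
      show "C_k_on k UNIV (\<lambda>t. (flat_fun (n + 2) t + (- real n) * flat_fun (n + 1) t) * v)" for v
        by (intro C_k_on_bounded_linear[OF bounded_linear_mult_left] C_k_on_add Suc.IH
            C_k_on_bounded_linear[OF bounded_linear_mult_right] open_UNIV)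
    qed simp
  qed
  then show ?thesis by (simp add: smooth_on_def)
qed

lemma bump_function:
  fixes a :: "'e::euclidean_space"
  assumes "0 < r" "r < R"
  obtains \<beta> :: "'e \<Rightarrow> real" where "smooth_on UNIV \<beta>" "\<And>x. x \<in> ball a r \<Longrightarrow> \<beta> x = 1"
    "\<And>x. x \<notin> ball a R \<Longrightarrow> \<beta> x = 0"
proof -
  define N where "N x = (x - a) \<bullet> (x - a)" for x
  \<comment> \<open>\<open>p\<close> is positive exactly inside radius \<open>R\<close> and
    \<open>q\<close> exactly outside the closed ball of radius \<open>r\<close>. As
    \<open>r < R\<close>, they never vanish together, and \<open>p / (p + q)\<close> is the required
    function.\<close>
  define p q where "p x = flat_fun 0 (R\<^sup>2 - N x)" and "q x = flat_fun 0 (N x - r\<^sup>2)" for x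
  have N: "smooth_on UNIV N"
    unfolding N_def by (intro smooth_on_inner smooth_on_diff smooth_on_ident smooth_on_const open_UNIV)
  have p: "smooth_on UNIV p"
    unfolding p_def
    by (rule smooth_on_compose[OF open_UNIV open_UNIV smooth_on_diff[OF open_UNIV smooth_on_const N] smooth_on_flat_fun]) simp
  have q: "smooth_on UNIV q"
    unfolding q_def
    by (rule smooth_on_compose[OF open_UNIV open_UNIV smooth_on_diff[OF open_UNIV N smooth_on_const] smooth_on_flat_fun]) simp
  have "r\<^sup>2 < R\<^sup>2" using assms by (simp add: power_strict_mono)
  then have pos: "p x + q x > 0" for x
    by (auto simp: p_def q_def flat_fun_def add_pos_pos)
  have Nd: "N x = (dist a x)\<^sup>2" for x
    unfolding N_def dist_norm power2_norm_eq_inner by (simp add: inner_diff inner_commute)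
  show thesis
  proof
    show "smooth_on UNIV (\<lambda>x. p x * inverse (p x + q x))"
      by (intro smooth_on_mult p smooth_on_inverse smooth_on_add q open_UNIV) (use pos in \<open>metis less_irrefl\<close>)
    show "p x * inverse (p x + q x) = 1" if "x \<in> ball a r" for x
    proof -
      have "N x < r\<^sup>2" using that by (simp add: Nd power_strict_mono)
      then have "q x = 0" by (simp add: q_def flat_fun_def)
      then show ?thesis using pos[of x] by simp
    qed
    show "p x * inverse (p x + q x) = 0" if "x \<notin> ball a R" for x
    proof -
      have "R\<^sup>2 \<le> N x" using that assms by (simp add: Nd power_mono)
      then show ?thesis by (simp add: p_def flat_fun_def)
    qed
  qed
qed

subsection \<open>Smooth dependence of solutions of linear equations\<close>

text \<open>An injective linear map in finite dimension has a lower bound \<open>B\<close>, and a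
  perturbation of operator norm below \<open>B / 2\<close> costs at most half of it.\<close>

lemma linear_eventually_bounded_below:
  fixes A :: "'e::metric_space \<Rightarrow> 'm::euclidean_space \<Rightarrow> 'f::euclidean_space"
  assumes "open S" "z0 \<in> S" "\<And>z. z \<in> S \<Longrightarrow> linear (A z)" "inj (A z0)" "\<And>u. continuous_on S (\<lambda>z. A z u)"
  obtains c where "c > 0" "\<forall>\<^sub>F z in at z0. \<forall>u. c * norm u \<le> norm (A z u)"
proof -
  obtain B where B: "B > 0" "\<And>u. B * norm u \<le> norm (A z0 u)"
    using linear_inj_bounded_below_pos[OF assms(3)[OF assms(2)] assms(4)] by blast
  \<comment> \<open>A bound for the operator norm of \<open>A z - A z0\<close> that needs only the
    continuity of finitely many vectors.\<close>
  define D where "D z = (\<Sum>b\<in>Basis. norm (A z b - A z0 b))" for z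
  have "isCont (\<lambda>z. A z b) z0" for b
    using assms(5)[of b] assms(1,2) by (simp add: continuous_on_eq_continuous_at)
  then have "((\<lambda>z. A z b) \<longlongrightarrow> A z0 b) (at z0)" for b by (simp add: isCont_def)
  then have "(D \<longlongrightarrow> (\<Sum>b\<in>Basis. norm (A z0 b - A z0 b))) (at z0)"
    unfolding D_def by (intro tendsto_intros)
  then have "(D \<longlongrightarrow> 0) (at z0)" by simp
  then have "\<forall>\<^sub>F z in at z0. D z < B / 2" using B by (intro order_tendstoD) auto
  moreover have "\<forall>\<^sub>F z in at z0. z \<in> S"
    using assms(1,2) by (metis eventually_at_in_open')
  ultimately have "\<forall>\<^sub>F z in at z0. \<forall>u. B / 2 * norm u \<le> norm (A z u)"
  proof eventually_elim
    case (elim z)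
    show ?case
    proof
      fix u
      have "A z u - A z0 u = (\<Sum>b\<in>Basis. (u \<bullet> b) *\<^sub>R (A z b - A z0 b))"
        using linear_expansion[OF assms(3)[OF elim(2)], of u] linear_expansion[OF assms(3)[OF assms(2)], of u]
        by (simp add: sum_subtractf scaleR_diff_right)
      then have "norm (A z u - A z0 u) \<le> (\<Sum>b\<in>Basis. \<bar>u \<bullet> b\<bar> * norm (A z b - A z0 b))"
        by (auto intro!: sum_norm_le)
      also have "\<dots> \<le> norm u * D z"
        unfolding D_def sum_distrib_left by (intro sum_mono mult_right_mono Basis_le_norm) auto
      also have "\<dots> \<le> norm u * (B / 2)" using elim(1) by (intro mult_left_mono) auto
      finally have "norm (A z0 u) - norm (A z u) \<le> norm u * (B / 2)"
        by (metis norm_minus_commute norm_triangle_ineq2 order_trans)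
      then show "B / 2 * norm u \<le> norm (A z u)" using B(2)[of u] by (simp add: field_simps)
    qed
  qed
  then show thesis using that[of "B / 2"] B(1) by simp
qed

text \<open>Subtracting the equations at \<open>z\<close> and \<open>z0\<close> bounds
  \<open>A z (y z - y z0)\<close> by quantities tending to 0, and the locally uniform lower bound of
  \<open>A z\<close> passes this on to \<open>y z - y z0\<close>.\<close>

lemma linear_solve_continuous:
  fixes A :: "'e::real_normed_vector \<Rightarrow> 'm::euclidean_space \<Rightarrow> 'f::euclidean_space"
  assumes "open S" "\<And>z. z \<in> S \<Longrightarrow> linear (A z)" "\<And>z. z \<in> S \<Longrightarrow> inj (A z)"
    "\<And>u. continuous_on S (\<lambda>z. A z u)" "continuous_on S b" "\<And>z. z \<in> S \<Longrightarrow> A z (y z) = b z"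
  shows "continuous_on S y"
proof (rule continuous_at_imp_continuous_on, rule ballI)
  fix z0 assume z0: "z0 \<in> S"
  obtain c where c: "c > 0" "\<forall>\<^sub>F z in at z0. \<forall>u. c * norm u \<le> norm (A z u)"
    using linear_eventually_bounded_below[of S z0 A] assms(1-4) z0 by blast
  have cont: "isCont (\<lambda>z. A z u) z0" "isCont b z0" for u
    using assms(1,4,5) z0 by (simp_all add: continuous_on_eq_continuous_at)
  then have "((\<lambda>z. norm (b z - b z0) + norm (A z (y z0) - A z0 (y z0))) \<longlongrightarrow>
      norm (b z0 - b z0) + norm (A z0 (y z0) - A z0 (y z0))) (at z0)"
    unfolding isCont_def by (intro tendsto_intros)
  then have lim: "((\<lambda>z. norm (b z - b z0) + norm (A z (y z0) - A z0 (y z0))) \<longlongrightarrow> 0) (at z0)" by simp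
  have "((\<lambda>z. y z - y z0) \<longlongrightarrow> 0) (at z0)"
  proof (rule tendsto_0_le[OF lim])
    have "\<forall>\<^sub>F z in at z0. z \<in> S" using assms(1) z0 by (metis eventually_at_in_open')
    with c(2) show "\<forall>\<^sub>F z in at z0. norm (y z - y z0) \<le>
        norm (norm (b z - b z0) + norm (A z (y z0) - A z0 (y z0))) * (1 / c)"
    proof eventually_elim
      case (elim z)
      have "A z (y z - y z0) = (b z - b z0) - (A z (y z0) - A z0 (y z0))"
        using linear_diff[OF assms(2)[OF elim(2)]] assms(6)[OF elim(2)] assms(6)[OF z0] by simp
      then have "norm (A z (y z - y z0)) \<le> norm (b z - b z0) + norm (A z (y z0) - A z0 (y z0))"
        by (metis norm_triangle_ineq4)
      moreover have "c * norm (y z - y z0) \<le> norm (A z (y z - y z0))" using elim(1) by blast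
      ultimately show ?case using c(1) by (simp add: field_simps)
    qed
  qed
  then show "isCont y z0" by (simp add: isCont_def LIM_zero_iff)
qed

lemma has_derivative_zero_dominated:
  assumes "(k has_derivative (\<lambda>h. 0)) (at z0)" "k z0 = 0" "f z0 = 0"
    "\<forall>\<^sub>F z in at z0. norm (f z) \<le> C * norm (k z)"
  shows "(f has_derivative (\<lambda>h. 0)) (at z0)"
proof -
  have "((\<lambda>y. norm (k y) / norm (y - z0)) \<longlongrightarrow> 0) (at z0)"
    using assms(1,2) by (simp add: has_derivative_iff_norm)
  then have "((\<lambda>y. norm (f y) / norm (y - z0)) \<longlongrightarrow> 0) (at z0)"
  proof (rule tendsto_0_le)
    show "\<forall>\<^sub>F y in at z0. norm (norm (f y) / norm (y - z0)) \<le> norm (norm (k y) / norm (y - z0)) * C"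
      using assms(4) eventually_neq_at_within[of z0]
      by eventually_elim (simp add: field_simps divide_right_mono)
  qed
  then show ?thesis using assms(3) by (simp add: has_derivative_iff_norm)
qed

text \<open>Formal differentiation of \<open>A z (y z) = b z\<close> dictates \<open>L\<close>. The
  affine function \<open>\<rho>\<close> with derivative \<open>L\<close> then solves the equation up
  to an error with zero derivative at \<open>z0\<close>, and the lower bound of \<open>A z\<close>
  carries this over to \<open>y - \<rho>\<close>.\<close>

lemma linear_solve_has_derivative:
  fixes A :: "'e::real_normed_vector \<Rightarrow> 'm::euclidean_space \<Rightarrow> 'm"
  assumes "open S" "z0 \<in> S" "\<And>z. z \<in> S \<Longrightarrow> linear (A z)" "\<And>z. z \<in> S \<Longrightarrow> inj (A z)"
    "\<And>u. smooth_on S (\<lambda>z. A z u)" "(b has_derivative b') (at z0)"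
    "\<And>z. z \<in> S \<Longrightarrow> A z (y z) = b z"
  obtains L where "(y has_derivative L) (at z0)" "\<And>w. A z0 (L w) = b' w - fd (\<lambda>z. A z (y z0)) z0 w"
proof -
  have linA: "linear (A z0)" and injA: "inj (A z0)" using assms(2-4) by blast+
  obtain g where g: "linear g" "\<forall>x. A z0 (g x) = x"
    using linear_injective_isomorphism[OF linA injA] by blast
  define L where "L w = g (b' w - fd (\<lambda>z. A z (y z0)) z0 w)" for w
  have AL: "A z0 (L w) = b' w - fd (\<lambda>z. A z (y z0)) z0 w" for w
    using g(2) by (simp add: L_def)
  have dA: "((\<lambda>z. A z u) has_derivative fd (\<lambda>z. A z u) z0) (at z0)" for u
    by (rule smooth_on_has_derivative[OF assms(5,2)])
  have "bounded_linear (\<lambda>w. b' w - fd (\<lambda>z. A z (y z0)) z0 w)"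
    using has_derivative_bounded_linear[OF assms(6)] has_derivative_bounded_linear[OF dA]
    by (rule bounded_linear_sub)
  then have bL: "bounded_linear L"
    unfolding L_def using bounded_linear_compose[OF linear_conv_bounded_linear[THEN iffD1, OF g(1)]] by blast
  define \<rho> where "\<rho> z = y z0 + L (z - z0)" for z
  have d\<rho>: "(\<rho> has_derivative L) (at z0)"
    unfolding \<rho>_def
    by (rule has_derivative_eq_rhs[OF has_derivative_add[OF has_derivative_const
          bounded_linear.has_derivative[OF bL has_derivative_diff[OF has_derivative_ident has_derivative_const]]]])
      simp
  have L0: "L 0 = 0" using bL by (simp add: linear_simps(3))
  then have \<rho>0: "\<rho> z0 = y z0" by (simp add: \<rho>_def)
  have "((\<lambda>z. A z (\<rho> z)) has_derivative (\<lambda>w. fd (\<lambda>z. A z (\<rho> z0)) z0 w + A z0 (L w))) (at z0)"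
    by (rule has_derivative_linear_apply[OF assms(1-3) _ d\<rho>], assumption) (rule differentiableI[OF dA])
  then have "((\<lambda>z. b z - A z (\<rho> z)) has_derivative (\<lambda>w. b' w - (fd (\<lambda>z. A z (\<rho> z0)) z0 w + A z0 (L w)))) (at z0)"
    by (rule has_derivative_diff[OF assms(6)])
  then have k: "((\<lambda>z. b z - A z (\<rho> z)) has_derivative (\<lambda>w. 0)) (at z0)" by (simp add: \<rho>0 AL)
  obtain c where c: "c > 0" "\<forall>\<^sub>F z in at z0. \<forall>u. c * norm u \<le> norm (A z u)"
    using linear_eventually_bounded_below[of S z0 A] assms(1-4) injA smooth_on_imp_continuous_on[OF assms(5)]
    by blast
  have "((\<lambda>z. y z - \<rho> z) has_derivative (\<lambda>h. 0)) (at z0)"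
  proof (rule has_derivative_zero_dominated[OF k])
    have "\<forall>\<^sub>F z in at z0. z \<in> S" using assms(1,2) by (metis eventually_at_in_open')
    with c(2) show "\<forall>\<^sub>F z in at z0. norm (y z - \<rho> z) \<le> (1 / c) * norm (b z - A z (\<rho> z))"
    proof eventually_elim
      case (elim z)
      have "A z (y z - \<rho> z) = b z - A z (\<rho> z)"
        using linear_diff[OF assms(3)[OF elim(2)]] assms(7)[OF elim(2)] by simp
      then show ?case using elim(1) c(1) by (metis (no_types, lifting) divide_inverse
            mult.commute mult_1 pos_le_divide_eq)
    qed
  qed (use \<rho>0 assms(7)[OF assms(2)] in auto)
  from has_derivative_add[OF this d\<rho>] have "(y has_derivative L) (at z0)" by simp
  then show thesis using AL that by blast
qed

text \<open>A directional derivative of \<open>y\<close> solves the same linear equation with a new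
  right-hand side built from \<open>b\<close>, \<open>A\<close> and \<open>y\<close>. Hence the
  induction is over all right-hand sides of class \<open>C_k_on k\<close>. The smoothness of the
  horizontal projection will rest on this.\<close>

theorem smooth_on_linear_solve:
  fixes A :: "'e::real_normed_vector \<Rightarrow> 'm::euclidean_space \<Rightarrow> 'm"
  assumes "open S" "\<And>z. z \<in> S \<Longrightarrow> linear (A z)" "\<And>z. z \<in> S \<Longrightarrow> inj (A z)"
    "\<And>u. smooth_on S (\<lambda>z. A z u)" "smooth_on S b" "\<And>z. z \<in> S \<Longrightarrow> A z (y z) = b z"
  shows "smooth_on S y"
proof -
  have *: "C_k_on k S y" if "C_k_on k S b" "\<And>z. z \<in> S \<Longrightarrow> A z (y z) = b z" for k b y
    using that
  proof (induction k arbitrary: b y)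
    case 0
    have "continuous_on S (\<lambda>z. A z u)" for u by (rule smooth_on_imp_continuous_on[OF assms(4)])
    then show ?case using linear_solve_continuous[OF assms(1-3) _ _ 0(2)] 0(1) by simp
  next
    case (Suc k)
    have "C_k_on k S b" by (rule C_k_on_SucD[OF Suc.prems(1)])
    then have y: "C_k_on k S y" by (rule Suc.IH) (rule Suc.prems(2))
    have "\<exists>L. (y has_derivative L) (at z) \<and> (\<forall>w. A z (L w) = fd b z w - fd (\<lambda>x. A x (y z)) z w)"
      if "z \<in> S" for z
    proof -
      have "(b has_derivative fd b z) (at z)"
        by (rule C_k_on_Suc_has_derivative[OF Suc.prems(1) that])
      from linear_solve_has_derivative[OF assms(1) that assms(2-4) this Suc.prems(2)]
      show ?thesis by blast
    qed
    then obtain L where L: "\<And>z. z \<in> S \<Longrightarrow> (y has_derivative L z) (at z)"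
      "\<And>z w. z \<in> S \<Longrightarrow> A z (L z w) = fd b z w - fd (\<lambda>x. A x (y z)) z w" by metis
    show ?case
    proof (rule C_k_on_SucI[OF assms(1) L(1)])
      fix v
      have "C_k_on k S (\<lambda>z. fd (\<lambda>x. A x (y z)) z v)"
      proof (rule C_k_on_linear_apply[where A = "\<lambda>z u. fd (\<lambda>x. A x u) z v", OF assms(1) _ _ y])
        show "linear (\<lambda>u. fd (\<lambda>x. A x u) z v)" if "z \<in> S" for z
          by (rule linear_fd_param[OF assms(1) that assms(2)], assumption)
            (rule differentiableI[OF smooth_on_has_derivative[OF assms(4) that]])
        show "C_k_on k S (\<lambda>z. fd (\<lambda>x. A x u) z v)" for u
          using smooth_on_fd[OF assms(4)] by (simp add: smooth_on_def)
      qed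
      then have "C_k_on k S (\<lambda>z. - fd (\<lambda>x. A x (y z)) z v)"
        by (rule C_k_on_bounded_linear[OF bounded_linear_minus[OF bounded_linear_ident] assms(1)])
      moreover have "C_k_on k S (\<lambda>z. fd b z v)" using Suc.prems(1) by simp
      ultimately have "C_k_on k S (\<lambda>z. fd b z v + - fd (\<lambda>x. A x (y z)) z v)"
        by (intro C_k_on_add[OF assms(1)])
      then show "C_k_on k S (\<lambda>z. L z v)"
        by (rule Suc.IH) (simp add: L(2))
    qed
  qed
  have "C_k_on k S y" for k
    by (rule *[OF _ assms(6)]) (use assms(5) in \<open>simp_all add: smooth_on_def\<close>)
  then show ?thesis by (simp add: smooth_on_def)
qed

subsection \<open>Linear total differential systems\<close>

lemma continuous_on_linear_apply:
  fixes A :: "'t::topological_space \<Rightarrow> 'm::euclidean_space \<Rightarrow> 'f::real_normed_vector"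
  assumes "\<And>x. x \<in> T \<Longrightarrow> linear (A x)" "\<And>u. continuous_on T (\<lambda>x. A x u)" "continuous_on T u"
  shows "continuous_on T (\<lambda>x. A x (u x))"
proof -
  have "continuous_on T (\<lambda>x. \<Sum>b\<in>Basis. (u x \<bullet> b) *\<^sub>R A x b)"
    by (intro continuous_intros assms)
  moreover have "continuous_on T (\<lambda>x. A x (u x)) = continuous_on T (\<lambda>x. \<Sum>b\<in>Basis. (u x \<bullet> b) *\<^sub>R A x b)"
    by (rule continuous_on_cong[OF refl]) (rule linear_expansion[OF assms(1)])
  ultimately show ?thesis by blast
qed

lemma continuous_on_bilinear_apply:
  fixes B :: "'t::topological_space \<Rightarrow> 'm::euclidean_space \<Rightarrow> 'n::euclidean_space \<Rightarrow> 'f::real_normed_vector"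
  assumes "\<And>x. x \<in> T \<Longrightarrow> bilinear (B x)" "\<And>u v. continuous_on T (\<lambda>x. B x u v)"
    "continuous_on T u" "continuous_on T v"
  shows "continuous_on T (\<lambda>x. B x (u x) (v x))"
proof -
  have lin: "linear (\<lambda>u. B x u w)" "linear (\<lambda>w. B x u w)" if "x \<in> T" for x u w
    using assms(1)[OF that] by (auto simp: bilinear_def)
  have s: "continuous_on T (\<lambda>x. B x (u x) w)" for w
    by (rule continuous_on_linear_apply[where A = "\<lambda>x u. B x u w", OF lin(1) assms(2,3)])
  from continuous_on_linear_apply[where A = "\<lambda>x w. B x (u x) w", OF lin(2) s assms(4)]
  show ?thesis .
qed

lemma bilinear_fd_param:
  fixes B :: "'e::real_normed_vector \<Rightarrow> 'm::euclidean_space \<Rightarrow> 'n::euclidean_space \<Rightarrow> 'f::real_normed_vector"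
  assumes "open S" "x \<in> S" "\<And>x. x \<in> S \<Longrightarrow> bilinear (B x)" "\<And>u v. smooth_on S (\<lambda>x. B x u v)"
  shows "bilinear (\<lambda>u v. fd (\<lambda>y. B y u v) x w)"
proof -
  have d: "(\<lambda>y. B y u v) differentiable (at x)" for u v
    using smooth_on_has_derivative[OF assms(4,2)] differentiable_def by blast
  have lin: "linear (\<lambda>u. B x u w)" "linear (\<lambda>w. B x u w)" if "x \<in> S" for x u w
    using assms(3)[OF that] by (auto simp: bilinear_def)
  show ?thesis unfolding bilinear_def
    using linear_fd_param[OF assms(1,2), where A = "\<lambda>x u. B x u v" for v]
      linear_fd_param[OF assms(1,2), where A = "\<lambda>x v. B x u v" for u] lin d by blast
qed

text \<open>The system is \<open>du = \<omega>(u)\<close>. The assumption \<open>integrable\<close>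
  is what equality of the mixed second derivatives of a solution amounts to, with the solution's
  value replaced by an arbitrary \<open>a\<close>. The smallness of \<open>K * r\<close> makes both
  the iteration and its defect contract.\<close>

locale linear_total_system =
  fixes S :: "'e::euclidean_space set" and z0 :: 'e
    and \<omega> :: "'e \<Rightarrow> 'e \<Rightarrow> 'w::euclidean_space \<Rightarrow> 'w" and K r :: real
  assumes S: "S = ball z0 r" and r: "r > 0" "K * r \<le> 1/8"
    and bil: "\<And>z. z \<in> S \<Longrightarrow> bilinear (\<omega> z)"
    and smooth: "\<And>v a. smooth_on S (\<lambda>z. \<omega> z v a)"
    and bound: "\<And>z v a. z \<in> S \<Longrightarrow> norm (\<omega> z v a) \<le> K * norm v * norm a"
    and K: "K \<ge> 0"
    and integrable: "\<And>z v w a. z \<in> S \<Longrightarrow>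
      fd (\<lambda>z. \<omega> z v a) z w + \<omega> z v (\<omega> z w a) = fd (\<lambda>z. \<omega> z w a) z v + \<omega> z w (\<omega> z v a)"
begin

lemma open_S: "open S" and convex_S: "convex S" and z0_S: "z0 \<in> S"
  using S r by auto

definition ray :: "real \<Rightarrow> 'e \<Rightarrow> 'e" where "ray t z = z0 + t *\<^sub>R (z - z0)"

lemma ray_in_S: "z \<in> S \<Longrightarrow> t \<in> {0..1} \<Longrightarrow> ray t z \<in> S"
proof -
  assume *: "z \<in> S" "t \<in> {0..1}"
  have "dist z0 (ray t z) = t * dist z0 z" using *(2) by (simp add: ray_def dist_norm norm_minus_commute)
  also have "\<dots> \<le> dist z0 z" using *(2) by (intro mult_left_le_one_le) auto
  finally show ?thesis using * S by simp
qed

lemma smooth_ray: "smooth_on S (ray t)" and fd_ray: "fd (ray t) z w = t *\<^sub>R w"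
proof -
  have "((\<lambda>z. z0 + t *\<^sub>R (z - z0)) has_derivative (\<lambda>w. t *\<^sub>R w)) (at z)" for z
    by (auto intro!: derivative_eq_intros)
  from fd_eqI[OF this] show "fd (ray t) z w = t *\<^sub>R w" by (simp add: ray_def[abs_def])
  show "smooth_on S (ray t)" unfolding ray_def[abs_def]
    by (intro smooth_on_add smooth_on_const smooth_on_bounded_linear[OF bounded_linear_scaleR_right]
        smooth_on_diff smooth_on_ident open_S)
qed

lemma continuous_ray: "continuous_on (S \<times> {0..1}) (\<lambda>(z, t). ray t z)"
  unfolding ray_def split_beta by (intro continuous_intros)

lemma bil': "z \<in> S \<Longrightarrow> linear (\<lambda>v. \<omega> z v a)" "z \<in> S \<Longrightarrow> linear (\<omega> z v)"
  using bil by (auto simp: bilinear_def)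

lemma bilinear_D: "z \<in> S \<Longrightarrow> bilinear (\<lambda>u a. fd (\<lambda>z. \<omega> z u a) z w)"
  by (rule bilinear_fd_param[OF open_S _ bil smooth])

abbreviation D where "D z w u a \<equiv> fd (\<lambda>z. \<omega> z u a) z w"

text \<open>A solution is recovered from its value at \<open>z0\<close> by integrating its
  differential along the segment to \<open>z\<close>, so solutions with value \<open>a\<close> at
  \<open>z0\<close> are fixed points.\<close>

definition step :: "'w \<Rightarrow> ('e \<Rightarrow> 'w) \<Rightarrow> 'e \<Rightarrow> 'w" where
  "step a P z = a + integral {0..1} (\<lambda>t. \<omega> (ray t z) (z - z0) (P (ray t z)))"

definition C1 :: "('e \<Rightarrow> 'w) \<Rightarrow> ('e \<Rightarrow> 'e \<Rightarrow> 'w) \<Rightarrow> bool" where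
  "C1 P P' \<longleftrightarrow> (\<forall>z\<in>S. (P has_derivative P' z) (at z)) \<and> (\<forall>v. continuous_on S (\<lambda>z. P' z v))"

definition defect :: "('e \<Rightarrow> 'w) \<Rightarrow> ('e \<Rightarrow> 'e \<Rightarrow> 'w) \<Rightarrow> 'e \<Rightarrow> 'e \<Rightarrow> 'w" where
  "defect P P' z v = P' z v - \<omega> z v (P z)"

text \<open>What remains of the derivative of \<open>step a P\<close> once
  \<open>\<omega> z v (P z)\<close> is split off. Being linear in the defect of \<open>P\<close>, it
  shrinks with it.\<close>

definition defect_int :: "('e \<Rightarrow> 'w) \<Rightarrow> ('e \<Rightarrow> 'e \<Rightarrow> 'w) \<Rightarrow> 'e \<Rightarrow> 'e \<Rightarrow> 'w" where
  "defect_int P P' z v = integral {0..1} (\<lambda>t. t *\<^sub>R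
     (\<omega> (ray t z) (z - z0) (defect P P' (ray t z) v) - \<omega> (ray t z) v (defect P P' (ray t z) (z - z0))))"

lemma C1_continuous: "C1 P P' \<Longrightarrow> continuous_on S P"
  unfolding C1_def by (metis continuous_at_imp_continuous_on has_derivative_continuous)

lemma continuous_on_ray_compose:
  "continuous_on S f \<Longrightarrow> continuous_on (S \<times> {0..1}) (\<lambda>x. f (ray (snd x) (fst x)))"
  by (rule continuous_on_compose2[of S f _ "\<lambda>x. ray (snd x) (fst x)"])
    (use continuous_ray ray_in_S in \<open>auto simp: split_beta\<close>)

lemma continuous_\<omega>_ray:
  assumes "continuous_on (S \<times> {0..1}) v" "continuous_on (S \<times> {0..1}) a"
  shows "continuous_on (S \<times> {0..1::real}) (\<lambda>x. \<omega> (ray (snd x) (fst x)) (v x) (a x))"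
  by (rule continuous_on_bilinear_apply[where B = "\<lambda>x. \<omega> (ray (snd x) (fst x))", OF _ _ assms])
    (use bil ray_in_S continuous_on_ray_compose[OF smooth_on_imp_continuous_on[OF smooth]] in auto)

lemma continuous_D_ray:
  assumes "continuous_on (S \<times> {0..1}) v" "continuous_on (S \<times> {0..1}) a"
  shows "continuous_on (S \<times> {0..1::real}) (\<lambda>x. D (ray (snd x) (fst x)) w (v x) (a x))"
  by (rule continuous_on_bilinear_apply[where B = "\<lambda>x u a. D (ray (snd x) (fst x)) w u a", OF _ _ assms])
    (use bilinear_D ray_in_S continuous_on_ray_compose[OF smooth_on_imp_continuous_on[OF smooth_on_fd[OF smooth]]] in auto)

lemma continuous_on_slice:
  assumes "continuous_on (S \<times> {0..1::real}) (\<lambda>x. f (fst x) (snd x))" "z \<in> S"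
  shows "continuous_on {0..1} (f z)"
proof -
  have "continuous_on {0..1::real} (\<lambda>t. (z, t))"
    by (intro continuous_on_Pair continuous_on_const continuous_on_id)
  moreover have "(\<lambda>t. (z, t)) ` {0..1} \<subseteq> S \<times> {0..1}" using assms(2) by auto
  ultimately show ?thesis using continuous_on_compose2[OF assms(1)] by fastforce
qed

lemma continuous_fst_diff: "continuous_on (S \<times> {0..1::real}) (\<lambda>x. fst x - z0)"
  by (intro continuous_intros)

lemma continuous_defect: "C1 P P' \<Longrightarrow> continuous_on S (\<lambda>z. defect P P' z v)"
proof -
  assume C: "C1 P P'"
  have "continuous_on S (\<lambda>z. \<omega> z v (P z))"
    by (rule continuous_on_linear_apply[where A = "\<lambda>z. \<omega> z v", OF bil'(2) smooth_on_imp_continuous_on[OF smooth] C1_continuous[OF C]])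
  then show ?thesis unfolding defect_def using C unfolding C1_def by (intro continuous_on_diff) auto
qed

lemma C1_linear: "C1 P P' \<Longrightarrow> z \<in> S \<Longrightarrow> linear (P' z)"
  unfolding C1_def using has_derivative_linear by blast

lemma linear_defect: "C1 P P' \<Longrightarrow> z \<in> S \<Longrightarrow> linear (defect P P' z)"
  unfolding defect_def[abs_def] by (intro linear_compose_sub C1_linear bil')

text \<open>Differentiation under the integral gives the integrand \<open>f'\<close>. By
  integrability, \<open>f'\<close> minus the defect integrand \<open>k\<close> is the
  \<open>t\<close>-derivative of \<open>t *\<^sub>R \<omega> (ray t z) v (P (ray t z))\<close>,
  whose boundary values at 0 and 1 contribute exactly \<open>\<omega> z v (P z)\<close>.\<close>

lemma step_has_derivative:
  assumes C: "C1 P P'" and z: "z \<in> S"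
  shows "(step a P has_derivative (\<lambda>v. \<omega> z v (P z) + defect_int P P' z v)) (at z)"
proof -
  define f where "f z t = \<omega> (ray t z) (z - z0) (P (ray t z))" for z t
  define f' where "f' z t w = t *\<^sub>R D (ray t z) w (z - z0) (P (ray t z)) + \<omega> (ray t z) w (P (ray t z))
    + t *\<^sub>R \<omega> (ray t z) (z - z0) (P' (ray t z) w)" for z t w
  have cP: "continuous_on (S \<times> {0..1}) (\<lambda>x. P (ray (snd x) (fst x)))"
    "continuous_on (S \<times> {0..1}) (\<lambda>x. P' (ray (snd x) (fst x)) w)" for w
    by (rule continuous_on_ray_compose[OF C1_continuous[OF C]], rule continuous_on_ray_compose)
      (use C in \<open>simp add: C1_def\<close>)
  have df: "((\<lambda>z. f z t) has_derivative f' z t) (at z)" if "z \<in> S" "t \<in> {0..1}" for z t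
  proof -
    have dP: "((\<lambda>z. P (ray t z)) has_derivative (\<lambda>w. P' (ray t z) (t *\<^sub>R w))) (at z)"
      using diff_chain_at[OF smooth_on_has_derivative[OF smooth_ray that(1)], of P "P' (ray t z)" t] ray_in_S[OF that] C
      by (simp add: o_def fd_ray C1_def)
    have sr: "smooth_on S (\<lambda>z. \<omega> (ray t z) v p)" for v p
      by (rule smooth_on_compose[OF open_S open_S smooth_ray smooth]) (use ray_in_S that(2) in blast)
    have bl: "linear (\<lambda>x. \<omega> (ray t z) x p)" "linear (\<omega> (ray t z) x)" if "z \<in> S" for z x p
      using bil' ray_in_S \<open>t \<in> {0..1}\<close> that by blast+
    have sd: "smooth_on S (\<lambda>z. z - z0)" by (intro smooth_on_diff smooth_on_ident smooth_on_const open_S)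
    have s2: "smooth_on S (\<lambda>z. \<omega> (ray t z) (z - z0) p)" for p
      by (rule smooth_on_linear_apply[where A = "\<lambda>z x. \<omega> (ray t z) x p", OF open_S bl(1) sr sd])
    have "fd (\<lambda>z. z - z0) z w = w" for w
      by (rule fd_eqI) (auto intro!: derivative_eq_intros)
    then have "fd (\<lambda>z. \<omega> (ray t z) (z - z0) p) z w = D (ray t z) (t *\<^sub>R w) (z - z0) p + \<omega> (ray t z) w p" for p w
      using fd_linear_apply[where A = "\<lambda>z x. \<omega> (ray t z) x p", OF open_S that(1) bl(1) sr sd, of w]
        fd_chain[OF smooth_ray[of t] smooth that(1) ray_in_S[OF that], of "z - z0" p w]
      by (simp add: fd_ray)
    moreover have "D (ray t z) (t *\<^sub>R w) (z - z0) p = t *\<^sub>R D (ray t z) w (z - z0) p"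
      "P' (ray t z) (t *\<^sub>R w) = t *\<^sub>R P' (ray t z) w"
      "\<omega> (ray t z) (z - z0) (t *\<^sub>R a) = t *\<^sub>R \<omega> (ray t z) (z - z0) a" for p w a
      using linear_scale[OF linear_fd[OF smooth ray_in_S[OF that]]]
        linear_scale[OF C1_linear[OF C ray_in_S[OF that]]] linear_scale[OF bl(2)[OF that(1)]] by auto
    ultimately show ?thesis
      using has_derivative_linear_apply[where A = "\<lambda>z p. \<omega> (ray t z) (z - z0) p", OF open_S that(1) bl(2) _ dP]
        differentiableI[OF smooth_on_has_derivative[OF s2 that(1)]]
      by (simp add: f_def[abs_def] f'_def[abs_def])
  qed
  have bl: "bounded_linear (f' z t)" if "z \<in> S" "t \<in> {0..1}" for z t
    by (rule has_derivative_bounded_linear[OF df[OF that]])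
  have cf': "continuous_on (S \<times> {0..1}) (\<lambda>x. f' (fst x) (snd x) w)" for w
    unfolding f'_def
    by (intro continuous_on_add continuous_on_scaleR continuous_\<omega>_ray continuous_D_ray cP
        continuous_fst_diff continuous_on_snd continuous_on_id continuous_on_const)
  have cf: "continuous_on {0..1} (f z)" if "z \<in> S" for z
  proof -
    have "continuous_on (S \<times> {0..1}) (\<lambda>x. f (fst x) (snd x))"
      unfolding f_def by (intro continuous_\<omega>_ray cP continuous_fst_diff)
    from continuous_on_slice[OF this that] show ?thesis .
  qed
  \<comment> \<open>\<open>leibniz_rule\<close> wants the derivative as a continuous family of
    bounded operators; in finite dimension continuity on basis vectors is enough for that.\<close>
  define F where "F z t = Blinfun (f' z t)" for z t
  have F: "blinfun_apply (F z t) = f' z t" if "z \<in> S" "t \<in> {0..1}" for z t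
    unfolding F_def by (rule bounded_linear_Blinfun_apply[OF bl[OF that]])
  have cF: "continuous_on (S \<times> {0..1}) (\<lambda>x. F (fst x) (snd x))"
  proof (rule continuous_on_blinfun_componentwise)
    fix i :: 'e
    show "continuous_on (S \<times> {0..1}) (\<lambda>x. blinfun_apply (F (fst x) (snd x)) i)"
      using cf'[of i] by (rule continuous_on_eq) (auto simp: F)
  qed
  then have cFz: "continuous_on {0..1} (F z)"
    using z by (rule continuous_on_slice)
  have "((\<lambda>z. integral (cbox 0 1) (f z)) has_derivative integral (cbox 0 1) (F z)) (at z within S)"
  proof (rule leibniz_rule)
    show "((\<lambda>z. f z t) has_derivative F z t) (at z within S)" if "z \<in> S" "t \<in> cbox 0 1" for z t
      using df[of z t] that F by (auto intro: has_derivative_at_withinI)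
    show "f z integrable_on cbox 0 1" if "z \<in> S" for z
      using cf[OF that] by (auto intro: integrable_continuous_real)
  qed (use cF z convex_S in \<open>auto simp: split_beta\<close>)
  then have "((\<lambda>z. integral (cbox 0 1) (f z)) has_derivative integral (cbox 0 1) (F z)) (at z)"
    using at_within_open[OF z open_S] by simp
  from has_derivative_add[OF has_derivative_const[of a] this]
  have d: "(step a P has_derivative (\<lambda>v. integral {0..1} (F z) v)) (at z)"
    by (simp add: step_def[abs_def] f_def[abs_def])
  have "integral {0..1} (F z) v = \<omega> z v (P z) + defect_int P P' z v" for v
  proof -
    define k where "k t = t *\<^sub>R (\<omega> (ray t z) (z - z0) (defect P P' (ray t z) v) - \<omega> (ray t z) v (defect P P' (ray t z) (z - z0)))" for t
    define h' where "h' t = f' z t v - k t" for t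
    have h: "((\<lambda>t. t *\<^sub>R \<omega> (ray t z) v (P (ray t z))) has_vector_derivative h' t) (at t)" if "t \<in> {0..1}" for t
    proof -
      have rS: "ray t z \<in> S" by (rule ray_in_S[OF z that])
      have dr: "((\<lambda>t. ray t z) has_derivative (\<lambda>h. h *\<^sub>R (z - z0))) (at t)"
        unfolding ray_def by (auto intro!: derivative_eq_intros)
      have dPr: "(P has_derivative P' (ray t z)) (at (ray t z))" using C rS by (simp add: C1_def)
      have "((\<lambda>y. \<omega> y v (P y)) has_derivative (\<lambda>w. D (ray t z) w v (P (ray t z)) + \<omega> (ray t z) v (P' (ray t z) w))) (at (ray t z))"
        by (rule has_derivative_linear_apply[where A = "\<lambda>z. \<omega> z v", OF open_S rS bil'(2) _ dPr], assumption)
          (rule differentiableI[OF smooth_on_has_derivative[OF smooth rS]])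
      from diff_chain_at[OF dr this]
      have "((\<lambda>t. \<omega> (ray t z) v (P (ray t z))) has_derivative
          (\<lambda>h. D (ray t z) (h *\<^sub>R (z - z0)) v (P (ray t z)) + \<omega> (ray t z) v (P' (ray t z) (h *\<^sub>R (z - z0))))) (at t)"
        by (simp add: o_def)
      from has_derivative_scaleR[OF has_derivative_ident this]
      have "((\<lambda>t. t *\<^sub>R \<omega> (ray t z) v (P (ray t z))) has_derivative
          (\<lambda>h. h *\<^sub>R (t *\<^sub>R (D (ray t z) (z - z0) v (P (ray t z)) + \<omega> (ray t z) v (P' (ray t z) (z - z0)))
             + \<omega> (ray t z) v (P (ray t z))))) (at t)"
        by (rule has_derivative_eq_rhs)
          (rule ext, simp only: linear_scale[OF linear_fd[OF smooth rS]] linear_scale[OF C1_linear[OF C rS]]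
            linear_scale[OF bil'(2)[OF rS]], simp add: scaleR_add_right mult.commute)
      moreover have "t *\<^sub>R (D (ray t z) (z - z0) v (P (ray t z)) + \<omega> (ray t z) v (P' (ray t z) (z - z0)))
             + \<omega> (ray t z) v (P (ray t z)) = h' t"
      proof -
        \<comment> \<open>Integrability at the ray point exchanges the direction \<open>v\<close>
          with the radial direction \<open>z - z0\<close>.\<close>
        have e: "D (ray t z) v (z - z0) (P (ray t z)) = D (ray t z) (z - z0) v (P (ray t z))
            + \<omega> (ray t z) v (\<omega> (ray t z) (z - z0) (P (ray t z)))
            - \<omega> (ray t z) (z - z0) (\<omega> (ray t z) v (P (ray t z)))"
          using integrable[OF rS, of v "P (ray t z)" "z - z0"] by (simp add: algebra_simps)
        show ?thesis
          unfolding h'_def f'_def k_def defect_def e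
          by (simp add: linear_diff[OF bil'(2)[OF rS]] algebra_simps)
      qed
      ultimately show ?thesis by (simp add: has_vector_derivative_def)
    qed
    have "(h' has_integral (1 *\<^sub>R \<omega> (ray 1 z) v (P (ray 1 z)) - 0 *\<^sub>R \<omega> (ray 0 z) v (P (ray 0 z)))) {0..1}"
      by (rule fundamental_theorem_of_calculus) (use h in \<open>auto intro: has_vector_derivative_at_within\<close>)
    moreover have "ray 1 z = z" by (simp add: ray_def)
    ultimately have 1: "(h' has_integral \<omega> z v (P z)) {0..1}" by simp
    have iF: "F z integrable_on {0..1}" by (rule integrable_continuous_real[OF cFz])
    have "integral {0..1} (F z) v = integral {0..1} (\<lambda>t. F z t v)" by (rule blinfun_apply_integral[OF iF])
    also have "\<dots> = integral {0..1} (\<lambda>t. f' z t v)"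
      by (rule integral_cong) (simp add: F z)
    also have "\<dots> = \<omega> z v (P z) + defect_int P P' z v"
    proof -
      have "(\<lambda>t. f' z t v) integrable_on {0..1}"
        by (rule integrable_continuous_real[OF continuous_on_slice[OF cf' z]])
      from has_integral_diff[OF integrable_integral[OF this] 1]
      have "(k has_integral (integral {0..1} (\<lambda>t. f' z t v) - \<omega> z v (P z))) {0..1}"
        by (simp add: h'_def)
      then have "defect_int P P' z v = integral {0..1} (\<lambda>t. f' z t v) - \<omega> z v (P z)"
        unfolding defect_int_def k_def by (rule integral_unique)
      then show ?thesis by simp
    qed
    finally show ?thesis .
  qed
  with d show ?thesis by simp
qed

lemma step_C1: "C1 P P' \<Longrightarrow> C1 (step a P) (\<lambda>z v. \<omega> z v (P z) + defect_int P P' z v)"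
proof -
  assume C: "C1 P P'"
  have 1: "continuous_on S (\<lambda>z. \<omega> z v (P z))" for v
    by (rule continuous_on_linear_apply[where A = "\<lambda>z. \<omega> z v", OF bil'(2) smooth_on_imp_continuous_on[OF smooth] C1_continuous[OF C]])
  have lz: "continuous_on (S \<times> {0..1}) (\<lambda>x. defect P P' (ray (snd x) (fst x)) (fst x - z0))"
    by (rule continuous_on_linear_apply[where A = "\<lambda>x. defect P P' (ray (snd x) (fst x))"])
      (use linear_defect[OF C] ray_in_S in \<open>auto intro!: continuous_on_ray_compose[OF continuous_defect[OF C]] continuous_intros\<close>)
  have "continuous_on (S \<times> {0..1}) (\<lambda>x. snd x *\<^sub>R
     (\<omega> (ray (snd x) (fst x)) (fst x - z0) (defect P P' (ray (snd x) (fst x)) v)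
      - \<omega> (ray (snd x) (fst x)) v (defect P P' (ray (snd x) (fst x)) (fst x - z0))))" for v
    by (intro continuous_on_scaleR continuous_on_diff continuous_on_snd continuous_on_id continuous_\<omega>_ray
        continuous_fst_diff continuous_on_ray_compose[OF continuous_defect[OF C]] lz continuous_on_const)
  then have "continuous_on S (\<lambda>z. defect_int P P' z v)" for v
    unfolding defect_int_def
    using integral_continuous_on_param[of S 0 1 "\<lambda>z t. t *\<^sub>R
     (\<omega> (ray t z) (z - z0) (defect P P' (ray t z) v) - \<omega> (ray t z) v (defect P P' (ray t z) (z - z0)))"]
    by (simp add: split_beta)
  with 1 show ?thesis unfolding C1_def using step_has_derivative[OF C] by (auto intro!: continuous_on_add)
qed

lemma norm_\<omega>_ray_le:
  assumes "z \<in> S" "t \<in> {0..1}" "norm a \<le> c"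
  shows "norm (\<omega> (ray t z) (z - z0) a) \<le> c / 8"
proof -
  have "norm (z - z0) \<le> r" using assms(1) S by (simp add: dist_norm norm_minus_commute)
  have c0: "c \<ge> 0" using assms(3) norm_ge_zero order_trans by blast
  have "norm (\<omega> (ray t z) (z - z0) a) \<le> K * norm (z - z0) * norm a"
    by (rule bound[OF ray_in_S[OF assms(1,2)]])
  also have "\<dots> \<le> K * r * c"
    using \<open>norm (z - z0) \<le> r\<close> assms(3) K r by (intro mult_mono) auto
  also have "\<dots> \<le> 1/8 * c" using r(2) c0 by (rule mult_right_mono)
  finally show ?thesis by simp
qed

text \<open>The integrand has two terms, and in each the factor \<open>K * norm (z - z0)\<close> is
  at most 1/8. Together they reduce the defect to a quarter.\<close>

lemma defect_int_bound:
  assumes C: "C1 P P'" and e: "\<And>z v. z \<in> S \<Longrightarrow> norm (defect P P' z v) \<le> e * norm v" and z: "z \<in> S"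
  shows "norm (defect_int P P' z v) \<le> e / 4 * norm v"
proof -
  have nz: "norm (z - z0) \<le> r" using z S by (simp add: dist_norm norm_minus_commute)
  have e0: "0 \<le> e * norm v" for v :: 'e using e[OF z0_S, of v] norm_ge_zero order_trans by blast
  let ?g = "\<lambda>t. t *\<^sub>R (\<omega> (ray t z) (z - z0) (defect P P' (ray t z) v) - \<omega> (ray t z) v (defect P P' (ray t z) (z - z0)))"
  have "norm (integral {0..1} ?g) \<le> e / 4 * norm v * (1 - 0)"
  proof (rule integral_bound)
    have rc: "continuous_on {0..1} (\<lambda>t. ray t z)" unfolding ray_def by (intro continuous_intros)
    have rS: "(\<lambda>t. ray t z) ` {0..1} \<subseteq> S" using ray_in_S z by auto
    have cd: "continuous_on {0..1} (\<lambda>t. defect P P' (ray t z) v)" for v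
      by (rule continuous_on_compose2[OF continuous_defect[OF C] rc rS])
    have "continuous_on {0..1} (\<lambda>t. \<omega> (ray t z) u (defect P P' (ray t z) v))" for u v
      by (rule continuous_on_linear_apply[where A = "\<lambda>t. \<omega> (ray t z) u", OF _ _ cd])
        (use bil' ray_in_S[OF z] continuous_on_compose2[OF smooth_on_imp_continuous_on[OF smooth] rc rS] in auto)
    then show "continuous_on {0..1} ?g" by (intro continuous_intros)
  next
    fix t :: real assume t: "t \<in> {0..1}"
    have rS: "ray t z \<in> S" by (rule ray_in_S[OF z t])
    have 1: "norm (\<omega> (ray t z) (z - z0) (defect P P' (ray t z) v)) \<le> (e * norm v) / 8"
      by (rule norm_\<omega>_ray_le[OF z t e[OF rS]])
    have "norm (\<omega> (ray t z) v (defect P P' (ray t z) (z - z0))) \<le> K * norm v * norm (defect P P' (ray t z) (z - z0))"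
      by (rule bound[OF rS])
    also have "\<dots> \<le> K * norm v * (e * norm (z - z0))"
      using e[OF rS] K by (intro mult_left_mono) auto
    also have "\<dots> = (K * norm (z - z0)) * (e * norm v)" by simp
    also have "\<dots> \<le> (1/8) * (e * norm v)"
      using nz K r(2) mult_left_mono[OF nz K] by (intro mult_right_mono[OF _ e0]) linarith
    finally have 2: "norm (\<omega> (ray t z) v (defect P P' (ray t z) (z - z0))) \<le> (e * norm v) / 8" by simp
    have "norm (?g t) \<le> 1 * norm (\<omega> (ray t z) (z - z0) (defect P P' (ray t z) v) - \<omega> (ray t z) v (defect P P' (ray t z) (z - z0)))"
      unfolding norm_scaleR using t by (intro mult_right_mono) auto
    also have "\<dots> \<le> (e * norm v) / 8 + (e * norm v) / 8"
      using 1 2 norm_triangle_ineq4 by (smt (verit))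
    finally show "norm (?g t) \<le> e / 4 * norm v" by simp
  qed simp
  then show ?thesis by (simp add: defect_int_def)
qed

section \<open>Picard iteration for the total system\<close>

primrec picard :: "'w \<Rightarrow> nat \<Rightarrow> 'e \<Rightarrow> 'w" where
  "picard a 0 = (\<lambda>z. a)"
| "picard a (Suc n) = step a (picard a n)"

lemma picard_C1: "\<exists>P'. C1 (picard a n) P'"
proof (induction n)
  case 0
  have "C1 (picard a 0) (\<lambda>z v. 0)" by (simp add: C1_def)
  then show ?case by blast
qed (use step_C1 in auto)

text \<open>The iteration contracts by 1/8; the weaker rate 1/2 is recorded since it matches the
  decay of the defect.\<close>

lemma picard_diff: "z \<in> S \<Longrightarrow> norm (picard a (Suc n) z - picard a n z) \<le> norm a / 2 ^ Suc n"
proof (induction n arbitrary: z)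
  case 0
  have "norm (integral {0..1} (\<lambda>t. \<omega> (ray t z) (z - z0) a)) \<le> norm a / 8 * (1 - 0)"
  proof (rule integral_bound)
    have rc: "continuous_on {0..1} (\<lambda>t. ray t z)" unfolding ray_def by (intro continuous_intros)
    show "continuous_on {0..1} (\<lambda>t. \<omega> (ray t z) (z - z0) a)"
      by (rule continuous_on_compose2[OF smooth_on_imp_continuous_on[OF smooth] rc]) (use ray_in_S 0 in auto)
  qed (use norm_\<omega>_ray_le[OF 0] in auto)
  moreover have "norm a / 8 * (1 - 0) \<le> norm a / 2 ^ Suc 0" by simp
  ultimately have "norm (integral {0..1} (\<lambda>t. \<omega> (ray t z) (z - z0) a)) \<le> norm a / 2 ^ Suc 0" by (rule order_trans)
  then show ?case by (simp add: step_def)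
next
  case (Suc n)
  let ?f = "\<lambda>m t. \<omega> (ray t z) (z - z0) (picard a m (ray t z))"
  have rc: "continuous_on {0..1} (\<lambda>t. ray t z)" unfolding ray_def by (intro continuous_intros)
  have rS: "(\<lambda>t. ray t z) ` {0..1} \<subseteq> S" using ray_in_S Suc.prems by auto
  have c: "continuous_on {0..1} (?f m)" for m
  proof (rule continuous_on_linear_apply[where A = "\<lambda>t. \<omega> (ray t z) (z - z0)"])
    obtain P' where "C1 (picard a m) P'" using picard_C1 by blast
    then show "continuous_on {0..1} (\<lambda>t. picard a m (ray t z))"
      using C1_continuous continuous_on_compose2[OF _ rc rS] by blast
  qed (use bil' ray_in_S[OF Suc.prems] continuous_on_compose2[OF smooth_on_imp_continuous_on[OF smooth] rc rS] in auto)
  have "picard a (Suc (Suc n)) z - picard a (Suc n) z = integral {0..1} (?f (Suc n)) - integral {0..1} (?f n)"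
    by (simp only: picard.simps step_def) simp
  also have "\<dots> = integral {0..1} (\<lambda>t. ?f (Suc n) t - ?f n t)"
    by (rule integral_diff[symmetric]; rule integrable_continuous_real[OF c])
  also have "norm \<dots> \<le> (norm a / 2 ^ Suc n) / 8 * (1 - 0)"
  proof (rule integral_bound)
    fix t :: real assume t: "t \<in> {0..1}"
    have "?f (Suc n) t - ?f n t = \<omega> (ray t z) (z - z0) (picard a (Suc n) (ray t z) - picard a n (ray t z))"
      using linear_diff[OF bil'(2)[OF ray_in_S[OF Suc.prems t]]] by simp
    then show "norm (?f (Suc n) t - ?f n t) \<le> (norm a / 2 ^ Suc n) / 8"
      using norm_\<omega>_ray_le[OF Suc.prems t Suc.IH[OF ray_in_S[OF Suc.prems t]]] by simp
  qed (simp, rule continuous_on_diff[OF c c])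
  also have "\<dots> \<le> norm a / 2 ^ Suc (Suc n)" by (simp add: field_simps)
  finally show ?case .
qed

text \<open>The new defect is \<open>defect_int\<close> of the old one minus \<open>\<omega>\<close>
  applied to the increment of the iteration. With the constant \<open>2 * K * norm a\<close> these
  contribute \<open>K * norm a / 2 ^ Suc n\<close> each, which adds up to precisely the next
  bound.\<close>

lemma picard_defect:
  "\<exists>P'. C1 (picard a n) P' \<and> (\<forall>z\<in>S. \<forall>v. norm (defect (picard a n) P' z v) \<le> 2 * K * norm a / 2 ^ n * norm v)"
proof (induction n)
  case 0
  have "C1 (picard a 0) (\<lambda>z v. 0)" by (simp add: C1_def)
  moreover have "norm (defect (picard a 0) (\<lambda>z v. 0) z v) \<le> 2 * K * norm a / 2 ^ 0 * norm v" if "z \<in> S" for z v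
  proof -
    have "norm (\<omega> z v a) \<le> K * norm v * norm a" by (rule bound[OF that])
    moreover have "0 \<le> K * norm v * norm a" using K by simp
    ultimately show ?thesis by (simp add: defect_def algebra_simps)
  qed
  ultimately show ?case by blast
next
  case (Suc n)
  let ?P = "picard a n"
  obtain P' where C: "C1 ?P P'" and
    e: "\<And>z v. z \<in> S \<Longrightarrow> norm (defect ?P P' z v) \<le> 2 * K * norm a / 2 ^ n * norm v" using Suc by blast
  let ?Q' = "\<lambda>z v. \<omega> z v (?P z) + defect_int ?P P' z v"
  have "norm (defect (picard a (Suc n)) ?Q' z v) \<le> 2 * K * norm a / 2 ^ Suc n * norm v" if z: "z \<in> S" for z v
  proof -
    have "defect (picard a (Suc n)) ?Q' z v = defect_int ?P P' z v - \<omega> z v (picard a (Suc n) z - ?P z)"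
      by (simp add: defect_def linear_diff[OF bil'(2)[OF z]])
    then have "norm (defect (picard a (Suc n)) ?Q' z v) \<le>
        norm (defect_int ?P P' z v) + norm (\<omega> z v (picard a (Suc n) z - ?P z))"
      using norm_triangle_ineq4 by simp
    also have "norm (defect_int ?P P' z v) \<le> (2 * K * norm a / 2 ^ n) / 4 * norm v"
      by (rule defect_int_bound[OF C e z])
    also have "norm (\<omega> z v (picard a (Suc n) z - ?P z)) \<le> K * norm v * norm (picard a (Suc n) z - ?P z)"
      by (rule bound[OF z])
    also have "\<dots> \<le> K * norm v * (norm a / 2 ^ Suc n)"
      by (rule mult_left_mono[OF picard_diff[OF z]]) (use K in simp)
    finally show ?thesis by (simp add: field_simps)
  qed
  moreover have "C1 (picard a (Suc n)) ?Q'" using step_C1[OF C] by simp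
  ultimately show ?case by blast
qed

lemma picard_Cauchy: "z \<in> S \<Longrightarrow> norm (picard a (n + k) z - picard a n z) \<le> norm a / 2 ^ n - norm a / 2 ^ (n + k)"
proof (induction k)
  case (Suc k)
  have "norm (picard a (n + Suc k) z - picard a n z) \<le>
      norm (picard a (Suc (n + k)) z - picard a (n + k) z) + norm (picard a (n + k) z - picard a n z)"
    by (metis (no_types, lifting) add_Suc_right diff_add_cancel add_diff_eq norm_triangle_ineq)
  also have "\<dots> \<le> norm a / 2 ^ Suc (n + k) + (norm a / 2 ^ n - norm a / 2 ^ (n + k))"
    by (intro add_mono picard_diff Suc)
  also have "\<dots> = norm a / 2 ^ n - norm a / 2 ^ (n + Suc k)" by (simp add: field_simps)
  finally show ?case .
qed simp

text \<open>The iterates converge uniformly and their defects tend to 0 uniformly, so their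
  derivatives converge uniformly to \<open>\<omega> z v (u z)\<close> and the limit may be
  differentiated term by term in every direction.\<close>

theorem solution_exists: "\<exists>u. u z0 = a \<and> (\<forall>z\<in>S. (u has_derivative (\<lambda>v. \<omega> z v (u z))) (at z))"
proof -
  define u where "u z = lim (\<lambda>n. picard a n z)" for z
  have half: "(\<lambda>n. c / 2 ^ n) \<longlonglongrightarrow> 0" for c :: real
    using tendsto_mult[OF tendsto_const[of c] LIMSEQ_power_zero[of "1/2::real"]] by (simp add: power_divide)
  have u: "(\<lambda>n. picard a n z) \<longlonglongrightarrow> u z" if "z \<in> S" for z
  proof -
    have "Cauchy (\<lambda>n. picard a n z)"
    proof (rule metric_CauchyI)
      fix e :: real assume "e > 0"
      then have "\<forall>\<^sub>F n in sequentially. norm a / 2 ^ n < e / 2"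
        by (intro order_tendstoD[OF half]) simp
      then obtain M where M: "norm a / 2 ^ M < e / 2" by (auto simp: eventually_sequentially)
      have "dist (picard a n z) (picard a M z) < e / 2" if "n \<ge> M" for n
      proof -
        have "norm (picard a (M + (n - M)) z - picard a M z) \<le> norm a / 2 ^ M - norm a / 2 ^ (M + (n - M))"
          by (rule picard_Cauchy) fact
        also have "\<dots> \<le> norm a / 2 ^ M" by simp
        finally have "norm (picard a n z - picard a M z) \<le> norm a / 2 ^ M" using that by simp
        then show ?thesis using M unfolding dist_norm by linarith
      qed
      then show "\<exists>M. \<forall>m\<ge>M. \<forall>n\<ge>M. dist (picard a m z) (picard a n z) < e"
        by (metis dist_triangle_half_l)
    qed
    then show ?thesis unfolding u_def by (simp add: Cauchy_convergent_iff convergent_LIMSEQ_iff)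
  qed
  have un: "norm (u z - picard a n z) \<le> norm a / 2 ^ n" if "z \<in> S" for z n
  proof (rule Lim_norm_ubound)
    show "(\<lambda>k. picard a (n + k) z - picard a n z) \<longlonglongrightarrow> u z - picard a n z"
      using LIMSEQ_ignore_initial_segment[OF u[OF that], of n] by (intro tendsto_diff) (simp_all add: add.commute)
    have "norm (picard a (n + k) z - picard a n z) \<le> norm a / 2 ^ n" for k
      using picard_Cauchy[OF that, of a n k] by (smt (verit) divide_nonneg_nonneg norm_ge_zero zero_le_power)
    then show "\<forall>\<^sub>F k in sequentially. norm (picard a (n + k) z - picard a n z) \<le> norm a / 2 ^ n" by simp
  qed simp
  obtain P' where P': "\<And>n. C1 (picard a n) (P' n)"
    "\<And>n z v. z \<in> S \<Longrightarrow> norm (defect (picard a n) (P' n) z v) \<le> 2 * K * norm a / 2 ^ n * norm v"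
    using picard_defect[of a] by metis
  have "\<exists>g. \<forall>z\<in>S. (\<lambda>n. picard a n z) \<longlonglongrightarrow> g z \<and> (g has_derivative (\<lambda>v. \<omega> z v (u z))) (at z within S)"
  proof (rule has_derivative_sequence[where f = "picard a" and f' = P' and l = "u z0", OF convex_S _ _ z0_S u[OF z0_S]])
    show "(picard a n has_derivative P' n z) (at z within S)" if "z \<in> S" for n z
      using P'(1) that unfolding C1_def by (blast intro: has_derivative_at_withinI)
    \<comment> \<open>The factor 3 below collects 2 from the defect of the iterate and 1 from its
      distance to the limit.\<close>
    fix e :: real assume "e > 0"
    then have "\<forall>\<^sub>F n in sequentially. 3 * K * norm a / 2 ^ n < e" by (intro order_tendstoD[OF half])
    then show "\<forall>\<^sub>F n in sequentially. \<forall>z\<in>S. \<forall>h. norm (P' n z h - \<omega> z h (u z)) \<le> e * norm h"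
    proof eventually_elim
      case (elim n)
      show ?case
      proof (intro ballI allI)
        fix z h assume z: "z \<in> S"
        have "P' n z h - \<omega> z h (u z) = defect (picard a n) (P' n) z h - \<omega> z h (u z - picard a n z)"
          by (simp add: defect_def linear_diff[OF bil'(2)[OF z]])
        then have "norm (P' n z h - \<omega> z h (u z)) \<le> norm (defect (picard a n) (P' n) z h) + norm (\<omega> z h (u z - picard a n z))"
          using norm_triangle_ineq4 by simp
        also have "\<dots> \<le> 2 * K * norm a / 2 ^ n * norm h + K * norm h * (norm a / 2 ^ n)"
          using K by (intro add_mono P'(2)[OF z] order_trans[OF bound[OF z]] mult_left_mono un[OF z]) auto
        also have "\<dots> = (3 * K * norm a / 2 ^ n) * norm h" by (simp add: field_simps)
        also have "\<dots> \<le> e * norm h" using elim by (intro mult_right_mono) auto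
        finally show "norm (P' n z h - \<omega> z h (u z)) \<le> e * norm h" .
      qed
    qed
  qed
  then obtain g where g: "\<And>z. z \<in> S \<Longrightarrow> (\<lambda>n. picard a n z) \<longlonglongrightarrow> g z"
    "\<And>z. z \<in> S \<Longrightarrow> (g has_derivative (\<lambda>v. \<omega> z v (u z))) (at z within S)" by blast
  have ug: "u z = g z" if "z \<in> S" for z using LIMSEQ_unique[OF u[OF that] g(1)[OF that]] .
  have "picard a n z0 = a" for n by (cases n) (simp_all add: step_def ray_def linear_0[OF bil'(1)[OF z0_S]])
  then have "g z0 = a" using g(1)[OF z0_S] by (simp add: LIMSEQ_const_iff)
  moreover have "(g has_derivative (\<lambda>v. \<omega> z v (g z))) (at z)" if "z \<in> S" for z
    using g(2)[OF that] at_within_open[OF that open_S] ug[OF that] by simp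
  ultimately show ?thesis by blast
qed

end

text \<open>Bounds for \<open>\<omega>\<close> are available on a compact ball, and shrinking the
  radius then achieves the smallness required by \<open>linear_total_system\<close>. Smoothness
  follows by bootstrapping, since the equation expresses the derivative through the
  solution.\<close>

theorem linear_total_system_solvable:
  fixes \<omega> :: "'e::euclidean_space \<Rightarrow> 'e \<Rightarrow> 'w::euclidean_space \<Rightarrow> 'w"
  assumes S: "open S" "z0 \<in> S" and bil: "\<And>z. z \<in> S \<Longrightarrow> bilinear (\<omega> z)"
    and smooth: "\<And>v a. smooth_on S (\<lambda>z. \<omega> z v a)"
    and integrable: "\<And>z v w a. z \<in> S \<Longrightarrow>
      fd (\<lambda>z. \<omega> z v a) z w + \<omega> z v (\<omega> z w a) = fd (\<lambda>z. \<omega> z w a) z v + \<omega> z w (\<omega> z v a)"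
  obtains r u where "r > 0" "ball z0 r \<subseteq> S" "\<And>a. u a z0 = a"
    "\<And>a z. z \<in> ball z0 r \<Longrightarrow> (u a has_derivative (\<lambda>v. \<omega> z v (u a z))) (at z)"
    "\<And>a. smooth_on (ball z0 r) (u a)"
proof -
  obtain R where R: "R > 0" "cball z0 R \<subseteq> S" using S open_contains_cball by blast
  have "\<exists>m. \<forall>z\<in>cball z0 R. norm (\<omega> z i j) \<le> m" for i j
  proof -
    have "compact ((\<lambda>z. \<omega> z i j) ` cball z0 R)"
      by (intro compact_continuous_image continuous_on_subset[OF smooth_on_imp_continuous_on[OF smooth] R(2)]) simp
    from compact_imp_bounded[OF this] show ?thesis by (simp add: bounded_iff)
  qed
  then obtain m where m: "\<And>i j z. z \<in> cball z0 R \<Longrightarrow> norm (\<omega> z i j) \<le> m i j" by metis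
  \<comment> \<open>By bilinearity, bounds on pairs of basis vectors add up to a bound for all
    arguments.\<close>
  define K where "K = (\<Sum>i\<in>Basis. \<Sum>j\<in>Basis. \<bar>m i j\<bar>)"
  have K: "K \<ge> 0" unfolding K_def by (intro sum_nonneg) auto
  have bound: "norm (\<omega> z v a) \<le> K * norm v * norm a" if "z \<in> cball z0 R" for z v a
  proof -
    have zS: "z \<in> S" using that R by blast
    have lin: "linear (\<lambda>v. \<omega> z v a)" "linear (\<omega> z v)" for v a using bil[OF zS] by (auto simp: bilinear_def)
    have "\<omega> z v a = (\<Sum>i\<in>Basis. (v \<bullet> i) *\<^sub>R \<omega> z i a)" by (rule linear_expansion[OF lin(1)])
    also have "\<dots> = (\<Sum>i\<in>Basis. (v \<bullet> i) *\<^sub>R (\<Sum>j\<in>Basis. (a \<bullet> j) *\<^sub>R \<omega> z i j))"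
      by (rule sum.cong[OF refl]) (simp only: linear_expansion[OF lin(2), of _ a])
    finally have e: "\<omega> z v a = (\<Sum>i\<in>Basis. (v \<bullet> i) *\<^sub>R (\<Sum>j\<in>Basis. (a \<bullet> j) *\<^sub>R \<omega> z i j))" .
    have "norm (\<Sum>j\<in>Basis. (a \<bullet> j) *\<^sub>R \<omega> z i j) \<le> (\<Sum>j\<in>Basis. \<bar>a \<bullet> j\<bar> * norm (\<omega> z i j))" for i
      by (rule sum_norm_le) simp
    then have "norm (\<omega> z v a) \<le> (\<Sum>i\<in>Basis. \<bar>v \<bullet> i\<bar> * (\<Sum>j\<in>Basis. \<bar>a \<bullet> j\<bar> * norm (\<omega> z i j)))"
      unfolding e by (intro sum_norm_le) (simp add: mult_left_mono)
    also have "\<dots> \<le> (\<Sum>i\<in>Basis. norm v * (\<Sum>j\<in>Basis. norm a * \<bar>m i j\<bar>))"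
    proof (rule sum_mono, rule mult_mono)
      fix i
      have "norm (\<omega> z i j) \<le> \<bar>m i j\<bar>" for j using m[OF that, of i j] by simp
      then show "(\<Sum>j\<in>Basis. \<bar>a \<bullet> j\<bar> * norm (\<omega> z i j)) \<le> (\<Sum>j\<in>Basis. norm a * \<bar>m i j\<bar>)"
        by (intro sum_mono mult_mono Basis_le_norm) auto
    qed (auto intro: Basis_le_norm sum_nonneg)
    also have "\<dots> = K * norm v * norm a"
      unfolding K_def sum_distrib_left sum_distrib_right by (intro sum.cong refl) (simp only: mult_ac)
    finally show ?thesis .
  qed
  \<comment> \<open>The second entry forces \<open>K * r \<le> 1/8\<close>; adding 1 to
    \<open>K\<close> covers the case \<open>K = 0\<close>.\<close>
  define r where "r = min R (1 / (8 * (K + 1)))"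
  have r: "r > 0" "r \<le> R" using R K by (auto simp: r_def)
  have "K * r \<le> K * (1 / (8 * (K + 1)))" using K by (intro mult_left_mono) (auto simp: r_def)
  also have "\<dots> \<le> 1/8" using K by (simp add: field_simps)
  finally have Kr: "K * r \<le> 1/8" .
  have sub: "ball z0 r \<subseteq> cball z0 R" using r(2) by auto
  interpret linear_total_system "ball z0 r" z0 \<omega> K r
  proof
    fix z assume "z \<in> ball z0 r"
    then have z: "z \<in> cball z0 R" "z \<in> S" using sub R by auto
    show "bilinear (\<omega> z)" by (rule bil[OF z(2)])
    show "norm (\<omega> z v a) \<le> K * norm v * norm a" for v a by (rule bound[OF z(1)])
    show "fd (\<lambda>z. \<omega> z v a) z w + \<omega> z v (\<omega> z w a) = fd (\<lambda>z. \<omega> z w a) z v + \<omega> z w (\<omega> z v a)" for v w a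
      by (rule integrable[OF z(2)])
  next
    show "smooth_on (ball z0 r) (\<lambda>z. \<omega> z v a)" for v a
      by (rule smooth_on_subset[OF smooth]) (use sub R in auto)
  qed (use r Kr K in auto)
  obtain u where u: "\<And>a. u a z0 = a"
    "\<And>a z. z \<in> ball z0 r \<Longrightarrow> (u a has_derivative (\<lambda>v. \<omega> z v (u a z))) (at z)"
    using solution_exists by metis
  have "smooth_on (ball z0 r) (u a)" for a
  proof (rule smooth_on_bootstrap[OF open_S u(2)], assumption)
    fix k v assume *: "C_k_on k (ball z0 r) (u a)"
    have "C_k_on k (ball z0 r) (\<lambda>z. \<omega> z v p)" for p
      using smooth by (simp add: smooth_on_def)
    from C_k_on_linear_apply[where A = "\<lambda>z. \<omega> z v", OF open_S bil'(2) this *]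
    show "C_k_on k (ball z0 r) (\<lambda>z. \<omega> z v (u a z))" .
  qed
  moreover have "ball z0 r \<subseteq> S" using sub R by blast
  ultimately show thesis using that[of r u] r(1) u by simp
qed

section \<open>Riemannian geometry in one chart\<close>

lemma smooth_on_linear_const: "linear h \<Longrightarrow> open S \<Longrightarrow> smooth_on S f \<Longrightarrow> smooth_on S (\<lambda>x. h (f x))"
  for h :: "'m::euclidean_space \<Rightarrow> 'f::real_normed_vector"
  using smooth_on_bounded_linear[of h S f] linear_conv_bounded_linear by blast

lemma fd_linear_const: "linear h \<Longrightarrow> smooth_on S f \<Longrightarrow> x \<in> S \<Longrightarrow> fd (\<lambda>x. h (f x)) x v = h (fd f x v)"
  for h :: "'m::euclidean_space \<Rightarrow> 'f::real_normed_vector"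
  by (rule fd_eqI[OF bounded_linear.has_derivative[OF _ smooth_on_has_derivative]])
    (auto simp: linear_conv_bounded_linear)

lemma fd_cong_open: "open S \<Longrightarrow> x \<in> S \<Longrightarrow> (\<And>y. y \<in> S \<Longrightarrow> f y = g y) \<Longrightarrow> fd f x v = fd g x v"
  using frechet_derivative_cong_open[of S x f g] by simp

text \<open>\<open>G\<close> is the metric in coordinates and \<open>\<Gamma>\<close> the
  Christoffel symbol as a bilinear map. \<open>sym\<Gamma>\<close> expresses that the torsion
  vanishes and \<open>compat\<close> that the metric is parallel.\<close>

locale metric_chart =
  fixes S :: "'e::euclidean_space set" and G :: "'e \<Rightarrow> 'e \<Rightarrow> 'e \<Rightarrow> real" and \<Gamma> :: "'e \<Rightarrow> 'e \<Rightarrow> 'e \<Rightarrow> 'e"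
  assumes open_S: "open S"
    and bilG: "\<And>z. z \<in> S \<Longrightarrow> bilinear (G z)"
    and symG: "\<And>z u v. z \<in> S \<Longrightarrow> G z u v = G z v u"
    and posG: "\<And>z u. z \<in> S \<Longrightarrow> u \<noteq> 0 \<Longrightarrow> G z u u > 0"
    and smG: "\<And>u v. smooth_on S (\<lambda>z. G z u v)"
    and bil\<Gamma>: "\<And>z. z \<in> S \<Longrightarrow> bilinear (\<Gamma> z)"
    and sym\<Gamma>: "\<And>z u v. z \<in> S \<Longrightarrow> \<Gamma> z u v = \<Gamma> z v u"
    and sm\<Gamma>: "\<And>u v. smooth_on S (\<lambda>z. \<Gamma> z u v)"
    and compat: "\<And>z u v w. z \<in> S \<Longrightarrow> fd (\<lambda>z. G z u v) z w = G z (\<Gamma> z w u) v + G z u (\<Gamma> z w v)"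
begin

lemma linG: "z \<in> S \<Longrightarrow> linear (\<lambda>u. G z u v)" "z \<in> S \<Longrightarrow> linear (G z u)"
  using bilG by (auto simp: bilinear_def)

lemma lin\<Gamma>: "z \<in> S \<Longrightarrow> linear (\<lambda>u. \<Gamma> z u v)" "z \<in> S \<Longrightarrow> linear (\<Gamma> z u)"
  using bil\<Gamma> by (auto simp: bilinear_def)

lemmas Gsimps = linear_add[OF linG(1)] linear_add[OF linG(2)] linear_diff[OF linG(1)] linear_diff[OF linG(2)]
  linear_neg[OF linG(1)] linear_neg[OF linG(2)] linear_scale[OF linG(1)] linear_scale[OF linG(2)]
  linear_0[OF linG(1)] linear_0[OF linG(2)]

lemmas \<Gamma>simps = linear_add[OF lin\<Gamma>(1)] linear_add[OF lin\<Gamma>(2)] linear_diff[OF lin\<Gamma>(1)] linear_diff[OF lin\<Gamma>(2)]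
  linear_neg[OF lin\<Gamma>(1)] linear_neg[OF lin\<Gamma>(2)] linear_scale[OF lin\<Gamma>(1)] linear_scale[OF lin\<Gamma>(2)]
  linear_0[OF lin\<Gamma>(1)] linear_0[OF lin\<Gamma>(2)]

lemma fd_G: "z \<in> S \<Longrightarrow> smooth_on S u \<Longrightarrow> smooth_on S v \<Longrightarrow>
    fd (\<lambda>z. G z (u z) (v z)) z w =
    G z (fd u z w + \<Gamma> z w (u z)) (v z) + G z (u z) (fd v z w + \<Gamma> z w (v z))"
  using fd_bilinear_apply[where B = G, OF open_S _ bilG smG] compat by (simp add: Gsimps)

lemma smooth_G: "smooth_on S u \<Longrightarrow> smooth_on S v \<Longrightarrow> smooth_on S (\<lambda>z. G z (u z) (v z))"
  by (rule smooth_on_bilinear_apply[where B = G, OF open_S bilG smG])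

lemma smooth_\<Gamma>: "smooth_on S u \<Longrightarrow> smooth_on S v \<Longrightarrow> smooth_on S (\<lambda>z. \<Gamma> z (u z) (v z))"
  by (rule smooth_on_bilinear_apply[where B = \<Gamma>, OF open_S bil\<Gamma> sm\<Gamma>])

lemma fd_\<Gamma>: "z \<in> S \<Longrightarrow> smooth_on S v \<Longrightarrow>
    fd (\<lambda>z. \<Gamma> z u (v z)) z w = fd (\<lambda>y. \<Gamma> y u (v z)) z w + \<Gamma> z u (fd v z w)"
  by (rule fd_linear_apply[where A = "\<lambda>z. \<Gamma> z u", OF open_S _ lin\<Gamma>(2) sm\<Gamma>])

text \<open>The curvature \<open>R(u, v)w\<close> evaluated on fields with constant components,
  whose brackets vanish.\<close>

definition curv :: "'e \<Rightarrow> 'e \<Rightarrow> 'e \<Rightarrow> 'e \<Rightarrow> 'e" where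
  "curv z u v w = fd (\<lambda>z. \<Gamma> z v w) z u - fd (\<lambda>z. \<Gamma> z u w) z v + \<Gamma> z u (\<Gamma> z v w) - \<Gamma> z v (\<Gamma> z u w)"

lemma curv_skew12: "curv z u v w = - curv z v u w"
  by (simp add: curv_def)

lemma curv_Bianchi:
  assumes z: "z \<in> S"
  shows "curv z u v w + curv z v w u + curv z w u v = 0"
proof -
  have D: "fd (\<lambda>z. \<Gamma> z u v) z w = fd (\<lambda>z. \<Gamma> z v u) z w" for u v w
    by (rule fd_cong_open[OF open_S z]) (rule sym\<Gamma>)
  show ?thesis
    unfolding curv_def by (simp add: D[of w v u] D[of w u v] D[of u v w]
        sym\<Gamma>[OF z, of w v] sym\<Gamma>[OF z, of w u] sym\<Gamma>[OF z, of u v])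
qed

lemma curv_linear:
  assumes "z \<in> S"
  shows "linear (\<lambda>u. curv z u v w)" "linear (\<lambda>v. curv z u v w)" "linear (curv z u v)"
proof -
  have 1: "linear (\<lambda>u. fd (\<lambda>z. \<Gamma> z v w) z u)" for v w by (rule linear_fd[OF sm\<Gamma> assms])
  have b: "bilinear (\<lambda>u v. fd (\<lambda>y. \<Gamma> y u v) z w)" for w
    by (rule bilinear_fd_param[OF open_S assms bil\<Gamma> sm\<Gamma>])
  then have 2: "linear (\<lambda>u. fd (\<lambda>z. \<Gamma> z u w) z v)" "linear (\<lambda>w. fd (\<lambda>z. \<Gamma> z u w) z v)" for u v w
    by (auto simp: bilinear_def)
  have 3: "linear (\<lambda>u. \<Gamma> z v (\<Gamma> z u w))" "linear (\<lambda>w. \<Gamma> z v (\<Gamma> z u w))" for u v w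
    using linear_compose[OF lin\<Gamma>(1)[OF assms] lin\<Gamma>(2)[OF assms]] linear_compose[OF lin\<Gamma>(2)[OF assms] lin\<Gamma>(2)[OF assms]]
    by (auto simp: o_def)
  show "linear (\<lambda>u. curv z u v w)" "linear (\<lambda>v. curv z u v w)" "linear (curv z u v)"
    unfolding curv_def[abs_def]
    by (intro linear_compose_add linear_compose_sub 1 2 3 lin\<Gamma>[OF assms])+
qed

text \<open>The second derivatives of the function \<open>G z a b\<close> commute. Expanding both
  orders by \<open>compat\<close>, the terms with two first-order factors cancel and the rest is
  \<open>G (R a) b + G a (R b)\<close>.\<close>

lemma curv_skew34:
  assumes z: "z \<in> S"
  shows "G z (curv z u v a) b = - G z a (curv z u v b)"
proof -
  have s: "smooth_on S (\<lambda>z. \<Gamma> z v a)" for v a by (rule sm\<Gamma>)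
  have c: "smooth_on S (\<lambda>z. a)" for a :: 'e by simp
  have "fd (\<lambda>z. fd (\<lambda>z. G z a b) z v) z u =
      G z (fd (\<lambda>z. \<Gamma> z v a) z u + \<Gamma> z u (\<Gamma> z v a)) b + G z (\<Gamma> z v a) (\<Gamma> z u b) +
      (G z (\<Gamma> z u a) (\<Gamma> z v b) + G z a (fd (\<lambda>z. \<Gamma> z v b) z u + \<Gamma> z u (\<Gamma> z v b)))" for u v
  proof -
    have "fd (\<lambda>z. fd (\<lambda>z. G z a b) z v) z u = fd (\<lambda>z. G z (\<Gamma> z v a) b + G z a (\<Gamma> z v b)) z u"
      by (rule fd_cong_open[OF open_S z]) (rule compat)
    also have "fd (\<lambda>z. G z (\<Gamma> z v a) b + G z a (\<Gamma> z v b)) z u =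
        fd (\<lambda>z. G z (\<Gamma> z v a) b) z u + fd (\<lambda>z. G z a (\<Gamma> z v b)) z u"
      by (rule fd_add[OF smooth_G[OF s c] smooth_G[OF c s] z])
    also have "fd (\<lambda>z. G z (\<Gamma> z v a) b) z u + fd (\<lambda>z. G z a (\<Gamma> z v b)) z u =
        G z (fd (\<lambda>z. \<Gamma> z v a) z u + \<Gamma> z u (\<Gamma> z v a)) b + G z (\<Gamma> z v a) (\<Gamma> z u b) +
        (G z (\<Gamma> z u a) (\<Gamma> z v b) + G z a (fd (\<lambda>z. \<Gamma> z v b) z u + \<Gamma> z u (\<Gamma> z v b)))"
      using fd_G[OF z s c] fd_G[OF z c s] by (simp add: Gsimps z)
    finally show ?thesis .
  qed
  then show ?thesis
    using fd_fd_symmetric[OF open_S smG z, of a b u v]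
    unfolding curv_def by (simp add: Gsimps z)
qed

text \<open>The last condition is \<open>\<nabla>K = 0\<close> solved for the partial derivative,
  and likewise for the vector fields in \<open>parallel_vec\<close>. In this form it can be
  substituted whenever a derivative appears.\<close>

definition parallel_endo :: "('e \<Rightarrow> 'e \<Rightarrow> 'e) \<Rightarrow> bool" where
  "parallel_endo K \<longleftrightarrow> (\<forall>z\<in>S. linear (K z)) \<and> (\<forall>u. smooth_on S (\<lambda>z. K z u)) \<and>
    (\<forall>z\<in>S. \<forall>u w. fd (\<lambda>z. K z u) z w = K z (\<Gamma> z w u) - \<Gamma> z w (K z u))"

definition parallel_vec :: "'e set \<Rightarrow> ('e \<Rightarrow> 'e) \<Rightarrow> bool" where
  "parallel_vec B p \<longleftrightarrow> smooth_on B p \<and> (\<forall>z\<in>B. \<forall>w. fd p z w = - \<Gamma> z w (p z))"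

text \<open>The Ricci identity for a parallel tensor: its first derivatives are expressed by
  \<open>\<Gamma>\<close>, and equality of the mixed second derivatives becomes a commutation
  relation with the curvature.\<close>

lemma curv_parallel_endo:
  assumes K: "parallel_endo K" and z: "z \<in> S"
  shows "curv z u v (K z w) = K z (curv z u v w)"
proof -
  have lK: "z \<in> S \<Longrightarrow> linear (K z)" and sK: "smooth_on S (\<lambda>z. K z u)"
    and dK: "z \<in> S \<Longrightarrow> fd (\<lambda>z. K z u) z w = K z (\<Gamma> z w u) - \<Gamma> z w (K z u)" for z u w
    using K by (auto simp: parallel_endo_def)
  have s1: "smooth_on S (\<lambda>z. K z (\<Gamma> z v w))" for v w
    by (rule smooth_on_linear_apply[where A = K, OF open_S lK sK sm\<Gamma>])
  have s2: "smooth_on S (\<lambda>z. \<Gamma> z v (K z w))" for v w by (rule smooth_\<Gamma>[OF smooth_on_const sK])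
  have "fd (\<lambda>z. fd (\<lambda>z. K z w) z v) z u =
      K z (\<Gamma> z u (\<Gamma> z v w)) - \<Gamma> z u (K z (\<Gamma> z v w)) + K z (fd (\<lambda>z. \<Gamma> z v w) z u) -
      (fd (\<lambda>y. \<Gamma> y v (K z w)) z u + \<Gamma> z v (K z (\<Gamma> z u w) - \<Gamma> z u (K z w)))" for u v
  proof -
    have "fd (\<lambda>z. fd (\<lambda>z. K z w) z v) z u = fd (\<lambda>z. K z (\<Gamma> z v w) - \<Gamma> z v (K z w)) z u"
      by (rule fd_cong_open[OF open_S z]) (rule dK)
    also have "fd (\<lambda>z. K z (\<Gamma> z v w) - \<Gamma> z v (K z w)) z u = fd (\<lambda>z. K z (\<Gamma> z v w)) z u - fd (\<lambda>z. \<Gamma> z v (K z w)) z u"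
      by (rule fd_diff[OF s1 s2 z])
    also have "fd (\<lambda>z. K z (\<Gamma> z v w)) z u =
        K z (\<Gamma> z u (\<Gamma> z v w)) - \<Gamma> z u (K z (\<Gamma> z v w)) + K z (fd (\<lambda>z. \<Gamma> z v w) z u)"
      using fd_linear_apply[where A = K, OF open_S z lK sK sm\<Gamma>, of v w u] by (simp add: dK[OF z])
    also have "fd (\<lambda>z. \<Gamma> z v (K z w)) z u =
        fd (\<lambda>y. \<Gamma> y v (K z w)) z u + \<Gamma> z v (K z (\<Gamma> z u w) - \<Gamma> z u (K z w))"
      using fd_\<Gamma>[OF z sK, of v w u] by (simp add: dK[OF z])
    finally show ?thesis .
  qed
  note A = this
  have "K z (\<Gamma> z u (\<Gamma> z v w)) - \<Gamma> z u (K z (\<Gamma> z v w)) + K z (fd (\<lambda>z. \<Gamma> z v w) z u) -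
      (fd (\<lambda>y. \<Gamma> y v (K z w)) z u + \<Gamma> z v (K z (\<Gamma> z u w) - \<Gamma> z u (K z w))) =
    K z (\<Gamma> z v (\<Gamma> z u w)) - \<Gamma> z v (K z (\<Gamma> z u w)) + K z (fd (\<lambda>z. \<Gamma> z u w) z v) -
      (fd (\<lambda>y. \<Gamma> y u (K z w)) z v + \<Gamma> z u (K z (\<Gamma> z v w) - \<Gamma> z v (K z w)))"
    using fd_fd_symmetric[OF open_S sK z, of w v u] unfolding A .
  then show ?thesis
    unfolding curv_def by (simp add: linear_add[OF lK[OF z]] linear_diff[OF lK[OF z]] \<Gamma>simps z algebra_simps)
qed

lemma curv_parallel_vec:
  assumes p: "parallel_vec S p" and z: "z \<in> S"
  shows "curv z u v (p z) = 0"
proof -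
  have sp: "smooth_on S p" and dp: "z \<in> S \<Longrightarrow> fd p z w = - \<Gamma> z w (p z)" for z w
    using p by (auto simp: parallel_vec_def)
  have "fd (\<lambda>z. fd p z v) z u = - (fd (\<lambda>y. \<Gamma> y v (p z)) z u - \<Gamma> z v (\<Gamma> z u (p z)))" for u v
  proof -
    have "fd (\<lambda>z. fd p z v) z u = fd (\<lambda>z. - \<Gamma> z v (p z)) z u"
      by (rule fd_cong_open[OF open_S z]) (rule dp)
    also have "fd (\<lambda>z. - \<Gamma> z v (p z)) z u = - fd (\<lambda>z. \<Gamma> z v (p z)) z u"
      by (rule fd_minus[OF smooth_\<Gamma>[OF smooth_on_const sp] z])
    also have "fd (\<lambda>z. \<Gamma> z v (p z)) z u = fd (\<lambda>y. \<Gamma> y v (p z)) z u - \<Gamma> z v (\<Gamma> z u (p z))"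
      using fd_\<Gamma>[OF z sp, of v u] by (simp add: dp[OF z] \<Gamma>simps z)
    finally show ?thesis .
  qed
  note A = this
  have "- (fd (\<lambda>y. \<Gamma> y v (p z)) z u - \<Gamma> z v (\<Gamma> z u (p z))) = - (fd (\<lambda>y. \<Gamma> y u (p z)) z v - \<Gamma> z u (\<Gamma> z v (p z)))"
    using fd_fd_symmetric[OF open_S sp z, of u v] unfolding A by simp
  then show ?thesis unfolding curv_def by (simp add: algebra_simps)
qed

end

text \<open>The curvature vanishes because \<open>R(X, V) = 0\<close> for \<open>X\<close> horizontal and \<open>V\<close> vertical (pair symmetry),
  and the first Bianchi identity reduces the remaining components to this case after applying \<open>f\<close>,
  which exchanges the two distributions up to \<open>x\<close>.\<close>

lemma curvature_algebra_zero:
  fixes R :: "'e::euclidean_space \<Rightarrow> 'e \<Rightarrow> 'e \<Rightarrow> 'e" and g :: "'e \<Rightarrow> 'e \<Rightarrow> real"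
  assumes g: "bilinear g" "\<And>u. u \<noteq> 0 \<Longrightarrow> g u u > 0"
    and lin: "\<And>v w. linear (\<lambda>u. R u v w)" "\<And>u w. linear (\<lambda>v. R u v w)" "\<And>u v. linear (R u v)"
    and skew12: "\<And>u v w. R u v w = - R v u w"
    and Bianchi: "\<And>u v w. R u v w + R v w u + R w u v = 0"
    and skew34: "\<And>u v a b. g (R u v a) b = - g a (R u v b)"
    and P: "linear P" "\<And>u. P (P u) = P u" "\<And>u v. g (P u) v = g u (P v)" "\<And>u v w. R u v (P w) = P (R u v w)"
    and f: "linear f" "\<And>u. f (f u) = - u + e u *\<^sub>R x" "\<And>u v w. R u v (f w) = f (R u v w)"
    and x: "\<And>u v. R u v x = 0" "P x = x"
    and fP: "\<And>u. P u = u \<Longrightarrow> P (f u) = 0" "\<And>u. P u = 0 \<Longrightarrow> P (f u) = f u"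
    and sym: "\<And>u v. g u v = g v u"
  shows "R u v w = 0"
proof -
  have lg: "linear (\<lambda>u. g u v)" "linear (g u)" for u v using g(1) by (auto simp: bilinear_def)
  have orth: "g a b = 0" if "P a = a" "P b = 0" for a b
    using P(3)[of a b] that by (simp add: linear_0[OF lg(2)])
  \<comment> \<open>\<open>- f\<close> inverts \<open>f\<close> up to a multiple of
    \<open>x\<close>, which the curvature annihilates. As \<open>f\<close> sends vertical vectors to
    horizontal ones, vanishing on horizontal arguments extends to vertical ones.\<close>
  have Rf: "R u v w = - f (R u v (f w))" if "P w = w" for u v w
  proof -
    have "w = - f (f w) + e w *\<^sub>R x" using f(2)[of w] by simp
    then have "R u v w = R u v (- f (f w) + e w *\<^sub>R x)" by simp
    also have "\<dots> = - f (R u v (f w))"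
      by (simp add: linear_diff[OF lin(3)] linear_neg[OF lin(3)] linear_scale[OF lin(3)] x f(3))
    finally show ?thesis .
  qed
  have f0: "f 0 = 0" by (rule linear_0[OF f(1)])
  have vert: "R u v w = 0" if "P w = w" "\<And>w. P w = 0 \<Longrightarrow> R u v w = 0" for u v w
    using Rf[OF that(1)] that(2)[OF fP(1)[OF that(1)]] f0 by simp
  have mixedH: "R X V Z = 0" if X: "P X = 0" and V: "P V = V" and Z: "P Z = 0" for X V Z
  proof -
    \<comment> \<open>On horizontal vectors \<open>T\<close> is symmetric in the first two slots, by
      the Bianchi identity and because \<open>R Z X V\<close> is vertical, and skew in the last two.
      A form with both symmetries changes sign after a cycle of transpositions, hence is 0.\<close>
    define T where "T X Z Z' = g (R X V Z) Z'" for X Z Z'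
    have s: "T X Z Z' = T Z X Z'" if "P X = 0" "P Z = 0" "P Z' = 0" for X Z Z'
    proof -
      have "P (R Z X V) = R Z X V" using P(4)[of Z X V] V by simp
      then have "g (R Z X V) Z' = 0" using orth that by blast
      moreover have "g (R X V Z + R V Z X + R Z X V) Z' = 0" by (simp add: Bianchi linear_0[OF lg(1)])
      ultimately have "g (R X V Z) Z' + g (R V Z X) Z' = 0" by (simp add: linear_add[OF lg(1)])
      then show ?thesis using skew12[of V Z X] by (simp add: T_def linear_neg[OF lg(1)])
    qed
    have k: "T X Z Z' = - T X Z' Z" for X Z Z' unfolding T_def using skew34[of X V Z Z'] sym by simp
    have T0: "T X Z Z' = 0" if "P Z' = 0" for Z'
      using s[OF X Z that] k[of Z X Z'] s[OF Z that X] k[of Z' Z X] s[OF that X Z] k[of X Z' Z] by linarith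
    have "P (R X V Z) = 0" using P(4)[of X V Z] Z by (simp add: linear_0[OF lin(3)])
    then have "g (R X V Z) (R X V Z) = 0" using T0 unfolding T_def by blast
    then show ?thesis using g(2) by (metis less_irrefl)
  qed
  have mixed: "R X V w = 0" if X: "P X = 0" and V: "P V = V" for X V w
  proof -
    have "R X V (P w) = 0" by (rule vert[OF P(2)]) (rule mixedH[OF X V])
    moreover have "R X V (w - P w) = 0" by (rule mixedH[OF X V]) (simp add: linear_diff[OF P(1)] P(2))
    ultimately show ?thesis by (simp add: linear_diff[OF lin(3)])
  qed
  have mixed': "R V X w = 0" if X: "P X = 0" and V: "P V = V" for X V w
    using mixed[OF that] skew12[of V X w] by simp
  have hor: "R X Y w = 0" if X: "P X = 0" and Y: "P Y = 0" for X Y w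
  proof -
    have h: "R X Y Z = 0" if Z: "P Z = 0" for Z
    proof -
      \<comment> \<open>\<open>f Z\<close> is vertical, so the other two terms of the Bianchi
        identity are mixed and vanish. Consequently \<open>R X Y Z\<close> is a multiple of the
        vertical \<open>x\<close> while being horizontal.\<close>
      have "R X Y (f Z) = 0"
        using Bianchi[of X Y "f Z"] mixed[OF Y fP(2)[OF Z], of X] mixed'[OF X fP(2)[OF Z], of Y] by simp
      then have "f (R X Y Z) = 0" by (simp add: f(3))
      then have "R X Y Z = e (R X Y Z) *\<^sub>R x" using f(2)[of "R X Y Z"] f0 by simp
      then have "P (R X Y Z) = R X Y Z" by (metis linear_scale[OF P(1)] x(2))
      moreover have "P (R X Y Z) = 0" using P(4)[of X Y Z] Z by (simp add: linear_0[OF lin(3)])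
      ultimately show ?thesis by simp
    qed
    have "R X Y (P w) = 0" by (rule vert[OF P(2) h])
    moreover have "R X Y (w - P w) = 0" by (rule h) (simp add: linear_diff[OF P(1)] P(2))
    ultimately show ?thesis by (simp add: linear_diff[OF lin(3)])
  qed
  have ver: "R V W w = 0" if V: "P V = V" and W: "P W = W" for V W w
  proof -
    have h: "R V W Z = 0" if Z: "P Z = 0" for Z
      using Bianchi[of V W Z] mixed'[OF Z W, of V] mixed[OF Z V, of W] by simp
    have "R V W (P w) = 0" by (rule vert[OF P(2) h])
    moreover have "R V W (w - P w) = 0" by (rule h) (simp add: linear_diff[OF P(1)] P(2))
    ultimately show ?thesis by (simp add: linear_diff[OF lin(3)])
  qed
  have d: "P (a - P a) = 0" for a by (simp add: linear_diff[OF P(1)] P(2))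
  have "R (P u) v w = 0" using ver[OF P(2) P(2), of u v w] mixed'[OF d P(2), of u v w]
    by (simp add: linear_diff[OF lin(2)])
  moreover have "R (u - P u) v w = 0" using mixed[OF d P(2), of u v w] hor[OF d d, of u v w]
    by (simp add: linear_diff[OF lin(2)])
  ultimately show ?thesis by (simp add: linear_diff[OF lin(1)])
qed


subsection \<open>Cosymplectic structures\<close>

text \<open>Here \<open>B u v w\<close> stands for \<open>g((\<nabla>\<^bsub>u\<^esub>f)v, w)\<close> and \<open>n w\<close> for \<open>\<nabla>\<^bsub>w\<^esub>x\<close>. Eliminating with the cyclic identity from the
  normality condition gives \<open>B w (f u) v = e u * g (n v) w\<close>, and \<open>u = x\<close> then yields \<open>n = 0\<close>.\<close>

lemma cosymplectic_algebra:
  fixes g :: "'e::euclidean_space \<Rightarrow> 'e \<Rightarrow> real" and N :: "'e \<Rightarrow> 'e \<Rightarrow> 'e"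
  assumes g: "bilinear g" "\<And>u. u \<noteq> 0 \<Longrightarrow> g u u > 0" "\<And>u v. g u v = g v u"
    and f: "\<And>u v. g (f u) v = - g u (f v)" "f x = 0" and ex: "e x = 1"
    and skew: "\<And>w u v. g (N w u) v = - g u (N w v)"
    and Nf: "\<And>w u. N w (f u) + f (N w u) = g u (n w) *\<^sub>R x + e u *\<^sub>R n w"
    and e: "\<And>u. g u x = e u"
    and closed1: "\<And>u v. g (n u) v = g (n v) u"
    and closed2: "\<And>u v w. g v (N u w) + g w (N v u) + g u (N w v) = 0"
    and normal: "\<And>u v. N (f u) v - N (f v) u + f (N v u) - f (N u v) = 0"
  shows "n w = 0" "N w (f u) = 0"
proof -
  have lg: "linear (\<lambda>u. g u v)" "linear (g u)" for u v using g(1) by (auto simp: bilinear_def)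
  note gs = linear_add[OF lg(1)] linear_diff[OF lg(1)] linear_scale[OF lg(1)] linear_0[OF lg(1)]
    linear_add[OF lg(2)] linear_scale[OF lg(2)] linear_0[OF lg(2)]
  have cyc: "g (N u v) w + g (N v w) u + g (N w u) v = 0" for u v w
    using closed2[of v u w] skew[of u v w] skew[of v w u] skew[of w u v] by linarith
  have sk: "g (N w u) v = - g (N w v) u" for w u v using skew[of w u v] g(3) by simp
  have K: "g (N w (f u)) v = g (N w u) (f v) + (g u (n w) * e v + e u * g (n w) v)" for w u v
  proof -
    have "g (N w (f u) + f (N w u)) v = g (g u (n w) *\<^sub>R x + e u *\<^sub>R n w) v" by (simp only: Nf)
    then show ?thesis using f(1)[of "N w u" v] e g(3)[of x v] by (simp add: gs)
  qed
  have nor: "g (N (f u) v) w - g (N (f v) u) w - g (N v u) (f w) + g (N u v) (f w) = 0" for u v w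
  proof -
    have "g (N (f u) v - N (f v) u + f (N v u) - f (N u v)) w = 0" by (simp only: normal gs)
    then show ?thesis using f(1) by (simp add: gs)
  qed
  \<comment> \<open>After \<open>K\<close> has moved \<open>f\<close> to the other slot, the
    normality identity and two cyclic identities are linear relations among the same few
    numbers.\<close>
  have main: "g (N w (f u)) v = e u * g (n v) w" for w u v
  proof -
    have "g (N v (f u)) w = g (N v u) (f w) + (e w * g (n u) v + e u * g (n v) w)"
      using K[of v u w] g(3)[of u "n v"] closed1[of u v] by simp
    moreover have "g (N u (f v)) w = g (N u v) (f w) + (e w * g (n u) v + e v * g (n u) w)"
      using K[of u v w] g(3)[of v "n u"] by simp
    moreover have "g (N w (f u)) v = g (N w u) (f v) + (e v * g (n u) w + e u * g (n v) w)"
      using K[of w u v] g(3)[of u "n w"] closed1[of u w] closed1[of v w] by simp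
    ultimately show ?thesis
      using nor[of u v w] cyc[of "f u" v w] cyc[of "f v" u w]
        sk[of v w "f u"] sk[of u w "f v"] sk[of w "f v" u] by linarith
  qed
  \<comment> \<open>Linearity of \<open>N w\<close> is not among the assumptions, so its value at 0
    is read off from skew-symmetry.\<close>
  have Nx: "N w 0 = 0" for w
  proof -
    have "g (N w 0) (N w 0) = 0" using skew[of w 0 "N w 0"] by (simp add: gs)
    then show ?thesis using g(2) by (metis less_irrefl)
  qed
  have "g (n v) w = 0" for v w using main[of w x v] Nx by (simp add: f ex gs)
  then show n: "n w = 0" for w using g(2) by (metis less_irrefl)
  have "g (N w (f u)) (N w (f u)) = 0" using main n by (simp add: gs)
  then show "N w (f u) = 0" using g(2) by (metis less_irrefl)
qed

text \<open>The closedness and normality conditions on fields with constant components, for which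
  all brackets of such fields drop out. As \<open>\<eta>\<close> is closed, normality is reduced to
  the vanishing of the Nijenhuis tensor.\<close>

locale cosymplectic_chart = metric_chart +
  fixes \<phi> :: "'a \<Rightarrow> 'a \<Rightarrow> 'a" and \<xi> :: "'a \<Rightarrow> 'a" and \<eta> :: "'a \<Rightarrow> 'a \<Rightarrow> real"
  assumes lin\<phi>: "\<And>z. z \<in> S \<Longrightarrow> linear (\<phi> z)" and sm\<phi>: "\<And>u. smooth_on S (\<lambda>z. \<phi> z u)"
    and sm\<xi>: "smooth_on S \<xi>"
    and \<phi>\<phi>: "\<And>z u. z \<in> S \<Longrightarrow> \<phi> z (\<phi> z u) = - u + \<eta> z u *\<^sub>R \<xi> z"
    and \<phi>\<xi>: "\<And>z. z \<in> S \<Longrightarrow> \<phi> z (\<xi> z) = 0"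
    and \<eta>\<phi>: "\<And>z u. z \<in> S \<Longrightarrow> \<eta> z (\<phi> z u) = 0"
    and \<eta>\<xi>: "\<And>z. z \<in> S \<Longrightarrow> \<eta> z (\<xi> z) = 1"
    and G\<phi>: "\<And>z u v. z \<in> S \<Longrightarrow> G z (\<phi> z u) (\<phi> z v) = G z u v - \<eta> z u * \<eta> z v"
    and \<eta>: "\<And>z u. z \<in> S \<Longrightarrow> \<eta> z u = G z u (\<xi> z)"
    and d\<eta>: "\<And>z u v. z \<in> S \<Longrightarrow> fd (\<lambda>z. \<eta> z v) z u = fd (\<lambda>z. \<eta> z u) z v"
    and d\<Phi>: "\<And>z u v w. z \<in> S \<Longrightarrow> fd (\<lambda>z. G z v (\<phi> z w)) z u + fd (\<lambda>z. G z w (\<phi> z u)) z v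
       + fd (\<lambda>z. G z u (\<phi> z v)) z w = 0"
    and normal: "\<And>z u v. z \<in> S \<Longrightarrow> fd (\<lambda>z. \<phi> z v) z (\<phi> z u) - fd (\<lambda>z. \<phi> z u) z (\<phi> z v)
       + \<phi> z (fd (\<lambda>z. \<phi> z u) z v) - \<phi> z (fd (\<lambda>z. \<phi> z v) z u) = 0"
begin

lemma G_skew_\<phi>: "z \<in> S \<Longrightarrow> G z (\<phi> z u) v = - G z u (\<phi> z v)"
proof -
  assume z: "z \<in> S"
  have "G z (\<phi> z u) (\<phi> z (\<phi> z v)) = G z u (\<phi> z v)" using G\<phi>[OF z, of u "\<phi> z v"] \<eta>\<phi>[OF z] by simp
  moreover have "G z (\<phi> z u) (\<phi> z (\<phi> z v)) = - G z (\<phi> z u) v"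
    using \<eta>[OF z, of "\<phi> z u"] \<eta>\<phi>[OF z] by (simp add: \<phi>\<phi> z Gsimps)
  ultimately show ?thesis by simp
qed

text \<open>Differentiating each structure identity gives one hypothesis of
  \<open>cosymplectic_algebra\<close> for the covariant derivatives \<open>N\<close> of
  \<open>\<phi>\<close> and \<open>n\<close> of \<open>\<xi>\<close>. That algebra settles
  \<open>N\<close> on the image of \<open>\<phi>\<close>. The derivative of
  \<open>\<phi> \<xi> = 0\<close> settles it on \<open>\<xi>\<close>, and every vector is a sum of
  two such parts.\<close>

theorem parallel_\<phi>_\<xi>: "parallel_endo \<phi>" "parallel_vec S \<xi>"
proof -
  define N where "N z w u = fd (\<lambda>z. \<phi> z u) z w + \<Gamma> z w (\<phi> z u) - \<phi> z (\<Gamma> z w u)" for z w u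
  define n where "n z w = fd \<xi> z w + \<Gamma> z w (\<xi> z)" for z w
  have Dp: "fd (\<lambda>z. \<phi> z u) z w = N z w u - \<Gamma> z w (\<phi> z u) + \<phi> z (\<Gamma> z w u)" for z u w
    by (simp add: N_def)
  have Dx: "fd \<xi> z w = n z w - \<Gamma> z w (\<xi> z)" for z w by (simp add: n_def)
  have c: "smooth_on S (\<lambda>z. u)" for u :: 'a by simp
  have De: "fd (\<lambda>z. \<eta> z u) z w = G z (\<Gamma> z w u) (\<xi> z) + G z u (n z w)" if z: "z \<in> S" for z u w
  proof -
    have "fd (\<lambda>z. \<eta> z u) z w = fd (\<lambda>z. G z u (\<xi> z)) z w" by (rule fd_cong_open[OF open_S z]) (rule \<eta>)
    then show ?thesis using fd_G[OF z c sm\<xi>, of u w] by (simp add: n_def)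
  qed
  have fd_\<phi>: "fd (\<lambda>z. \<phi> z (u z)) z w = fd (\<lambda>y. \<phi> y (u z)) z w + \<phi> z (fd u z w)"
    if "z \<in> S" "smooth_on S u" for z u w
    by (rule fd_linear_apply[where A = \<phi>, OF open_S that(1) lin\<phi> sm\<phi> that(2)])
  have alg: "n z w = 0 \<and> N z w (\<phi> z u) = 0" if z: "z \<in> S" for z w u
  proof -
    note ls = linear_add[OF lin\<phi>[OF z]] linear_diff[OF lin\<phi>[OF z]] linear_neg[OF lin\<phi>[OF z]] linear_scale[OF lin\<phi>[OF z]]
    have skew: "G z (N z w u) v = - G z u (N z w v)" for w u v
    proof -
      have "fd (\<lambda>z. G z (\<phi> z u) v) z w = fd (\<lambda>z. - G z u (\<phi> z v)) z w"
        by (rule fd_cong_open[OF open_S z]) (rule G_skew_\<phi>)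
      also have "\<dots> = - fd (\<lambda>z. G z u (\<phi> z v)) z w" by (rule fd_minus[OF smooth_G[OF c sm\<phi>] z])
      finally show ?thesis
        using fd_G[OF z sm\<phi> c, of u v w] fd_G[OF z c sm\<phi>, of u v w] G_skew_\<phi>[OF z]
        by (simp add: Dp Gsimps z)
    qed
    have Nf: "N z w (\<phi> z u) + \<phi> z (N z w u) = G z u (n z w) *\<^sub>R \<xi> z + \<eta> z u *\<^sub>R n z w" for w u
    proof -
      have s\<eta>: "smooth_on S (\<lambda>z. \<eta> z u)"
        using smooth_on_cong[OF open_S, of "\<lambda>z. \<eta> z u" "\<lambda>z. G z u (\<xi> z)"] \<eta> smooth_G[OF c sm\<xi>] by simp
      have "fd (\<lambda>z. \<phi> z (\<phi> z u)) z w = fd (\<lambda>z. - u + \<eta> z u *\<^sub>R \<xi> z) z w"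
        by (rule fd_cong_open[OF open_S z]) (rule \<phi>\<phi>)
      also have "\<dots> = fd (\<lambda>z. - u) z w + fd (\<lambda>z. \<eta> z u *\<^sub>R \<xi> z) z w"
        by (rule fd_add[OF c smooth_on_scaleR[OF open_S s\<eta> sm\<xi>] z])
      also have "\<dots> = \<eta> z u *\<^sub>R fd \<xi> z w + fd (\<lambda>z. \<eta> z u) z w *\<^sub>R \<xi> z"
        using fd_eqI[OF has_derivative_scaleR[OF smooth_on_has_derivative[OF s\<eta> z] smooth_on_has_derivative[OF sm\<xi> z]]]
        by simp
      finally have "N z w (\<phi> z u) - \<Gamma> z w (\<phi> z (\<phi> z u)) + \<phi> z (\<Gamma> z w (\<phi> z u)) +
          \<phi> z (N z w u - \<Gamma> z w (\<phi> z u) + \<phi> z (\<Gamma> z w u)) =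
          \<eta> z u *\<^sub>R (n z w - \<Gamma> z w (\<xi> z)) + (G z (\<Gamma> z w u) (\<xi> z) + G z u (n z w)) *\<^sub>R \<xi> z"
        unfolding fd_\<phi>[OF z sm\<phi>] Dp Dx De[OF z] .
      then show ?thesis
        by (simp add: ls \<phi>\<phi> z \<Gamma>simps \<eta>[OF z, of "\<Gamma> z w u"] algebra_simps)
    qed
    have closed1: "G z (n z u) v = G z (n z v) u" for u v
      using d\<eta>[OF z, of v u] sym\<Gamma>[OF z, of u v] symG[OF z] by (simp add: De z)
    have closed2: "G z v (N z u w) + G z w (N z v u) + G z u (N z w v) = 0" for u v w
    proof -
      have "fd (\<lambda>z. G z v (\<phi> z w)) z u = G z (\<Gamma> z u v) (\<phi> z w) + G z v (N z u w) + G z v (\<phi> z (\<Gamma> z u w))" for u v w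
        using fd_G[OF z c sm\<phi>, of v w u] by (simp add: Dp Gsimps z)
      moreover have "G z w (\<phi> z (\<Gamma> z b a)) = - G z (\<Gamma> z a b) (\<phi> z w)" for a b w
        using G_skew_\<phi>[OF z, of w "\<Gamma> z b a"] sym\<Gamma>[OF z, of a b] symG[OF z, of "\<phi> z w"] by simp
      ultimately show ?thesis using d\<Phi>[OF z, of v w u] by simp
    qed
    have nor: "N z (\<phi> z u) v - N z (\<phi> z v) u + \<phi> z (N z v u) - \<phi> z (N z u v) = 0" for u v
      using normal[OF z, of v u] sym\<Gamma>[OF z, of "\<phi> z u" v] sym\<Gamma>[OF z, of "\<phi> z v" u] sym\<Gamma>[OF z, of u v]
        sym\<Gamma>[OF z, of "\<phi> z u" "\<phi> z v"]
      by (simp add: Dp ls \<phi>\<phi> z algebra_simps)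
    have "\<And>u. G z u (\<xi> z) = \<eta> z u" using \<eta>[OF z] by simp
    note ca = cosymplectic_algebra[of "G z" "\<phi> z" "\<xi> z" "\<eta> z" "N z" "n z", OF bilG[OF z] posG[OF z] symG[OF z]
        G_skew_\<phi>[OF z] \<phi>\<xi>[OF z] \<eta>\<xi>[OF z] skew Nf this closed1 closed2 nor]
    show ?thesis using ca by simp
  qed
  show x: "parallel_vec S \<xi>"
    unfolding parallel_vec_def using sm\<xi> alg by (simp add: Dx)
  have Nx: "N z w (\<xi> z) = 0" if z: "z \<in> S" for z w
  proof -
    have "fd (\<lambda>z. \<phi> z (\<xi> z)) z w = fd (\<lambda>z. 0) z w" by (rule fd_cong_open[OF open_S z]) (rule \<phi>\<xi>)
    then show ?thesis using fd_\<phi>[OF z sm\<xi>, of w] alg[OF z]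
      by (simp add: N_def Dx \<phi>\<xi> z \<Gamma>simps linear_neg[OF lin\<phi>[OF z]])
  qed
  have N0: "N z w u = 0" if z: "z \<in> S" for z w u
  proof -
    have l: "linear (N z w)"
      unfolding N_def[abs_def]
      using linear_fd_param[OF open_S z lin\<phi> differentiableI[OF smooth_on_has_derivative[OF sm\<phi> z]], of w]
        linear_compose[OF lin\<phi>[OF z] lin\<Gamma>(2)[OF z]] linear_compose[OF lin\<Gamma>(2)[OF z] lin\<phi>[OF z]]
      by (intro linear_compose_add linear_compose_sub) (auto simp: o_def)
    have "u = - \<phi> z (\<phi> z u) + \<eta> z u *\<^sub>R \<xi> z" by (simp add: \<phi>\<phi> z)
    then have "N z w u = N z w (- \<phi> z (\<phi> z u) + \<eta> z u *\<^sub>R \<xi> z)" by simp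
    also have "\<dots> = - N z w (\<phi> z (\<phi> z u)) + \<eta> z u *\<^sub>R N z w (\<xi> z)"
      by (simp only: linear_add[OF l] linear_neg[OF l] linear_scale[OF l])
    finally show ?thesis using alg[OF z] Nx[OF z] by simp
  qed
  show "parallel_endo \<phi>"
    unfolding parallel_endo_def using lin\<phi> sm\<phi> N0 by (simp add: Dp)
qed

end

subsection \<open>Flat charts\<close>

lemma smooth_on_Pair:
  assumes "open S" "smooth_on S f" "smooth_on S g"
  shows "smooth_on S (\<lambda>x. (f x, g x))"
proof -
  have "smooth_on S (\<lambda>x. (f x, 0) + (0, g x))"
    by (intro smooth_on_add assms smooth_on_bounded_linear[OF _ assms(1,2), of "\<lambda>y. (y, 0)"]
        smooth_on_bounded_linear[OF _ assms(1,3), of "\<lambda>y. (0, y)"] bounded_linear_Pair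
        bounded_linear_ident bounded_linear_zero)
  then show ?thesis by simp
qed

context metric_chart
begin

lemma metric_chart_subset:
  assumes "open B" "B \<subseteq> S" shows "metric_chart B G \<Gamma>"
proof
  fix z assume "z \<in> B"
  then have z: "z \<in> S" using assms by blast
  show "bilinear (G z)" "bilinear (\<Gamma> z)" by (rule bilG[OF z], rule bil\<Gamma>[OF z])
  show "G z u v = G z v u" "u \<noteq> 0 \<Longrightarrow> 0 < G z u u" "\<Gamma> z u v = \<Gamma> z v u" for u v
    by (rule symG[OF z], erule posG[OF z], rule sym\<Gamma>[OF z])
  show "fd (\<lambda>z. G z u v) z w = G z (\<Gamma> z w u) v + G z u (\<Gamma> z w v)" for u v w by (rule compat[OF z])
qed (use assms in \<open>auto intro: smooth_on_subset[OF smG] smooth_on_subset[OF sm\<Gamma>]\<close>)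

lemma parallel_G_const:
  assumes "parallel_vec S p" "parallel_vec S q" "convex S" "z \<in> S" "z0 \<in> S"
  shows "G z (p z) (q z) = G z0 (p z0) (q z0)"
proof -
  have p: "smooth_on S p" "\<And>z w. z \<in> S \<Longrightarrow> fd p z w = - \<Gamma> z w (p z)"
    and q: "smooth_on S q" "\<And>z w. z \<in> S \<Longrightarrow> fd q z w = - \<Gamma> z w (q z)"
    using assms(1,2) by (auto simp: parallel_vec_def)
  have "((\<lambda>z. G z (p z) (q z)) has_derivative (\<lambda>h. 0)) (at z within S)" if z: "z \<in> S" for z
  proof -
    have "((\<lambda>z. G z (p z) (q z)) has_derivative fd (\<lambda>z. G z (p z) (q z)) z) (at z)"
      by (rule smooth_on_has_derivative[OF smooth_G[OF p(1) q(1)] z])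
    moreover have "fd (\<lambda>z. G z (p z) (q z)) z = (\<lambda>h. 0)"
      by (rule ext) (simp add: fd_G[OF z p(1) q(1)] p(2) q(2) z Gsimps)
    ultimately show ?thesis using has_derivative_at_withinI by metis
  qed
  from has_derivative_zero_constant[OF assms(3) this]
  obtain c where "\<And>x. x \<in> S \<Longrightarrow> G x (p x) (q x) = c" by blast
  then show ?thesis using assms(4,5) by simp
qed

text \<open>For a parallel \<open>E\<close> the one-form \<open>G(E, .)\<close> is closed because
  \<open>\<Gamma>\<close> is symmetric. Adding its potential as a further unknown keeps the system
  linear and integrable, so a separate Poincare lemma is avoided.\<close>

lemma parallel_frame_potential:
  assumes z0: "z0 \<in> S" and flat: "\<And>z u v w. z \<in> S \<Longrightarrow> curv z u v w = 0"
  obtains r E f where "r > 0" "ball z0 r \<subseteq> S"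
    "\<And>b. parallel_vec (ball z0 r) (E b)" "\<And>b. E b z0 = b"
    "\<And>b. smooth_on (ball z0 r) (f b)" "\<And>b. f b z0 = (0::real)"
    "\<And>b z v. z \<in> ball z0 r \<Longrightarrow> fd (f b) z v = G z (E b z) v"
proof -
  define \<omega> :: "'e \<Rightarrow> 'e \<Rightarrow> real \<times> 'e \<Rightarrow> real \<times> 'e" where
    "\<omega> z v p = (G z (snd p) v, - \<Gamma> z v (snd p))" for z v p
  have bil: "bilinear (\<omega> z)" if z: "z \<in> S" for z
    unfolding bilinear_def \<omega>_def by (auto intro!: linearI simp: Gsimps \<Gamma>simps z)
  have sm: "smooth_on S (\<lambda>z. \<omega> z v a)" for v a
    unfolding \<omega>_def by (intro smooth_on_Pair open_S smG smooth_on_minus sm\<Gamma>)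
  have D: "fd (\<lambda>z. \<omega> z v a) z w = (G z (\<Gamma> z w (snd a)) v + G z (snd a) (\<Gamma> z w v), - fd (\<lambda>z. \<Gamma> z v (snd a)) z w)"
    if z: "z \<in> S" for z v w a
  proof -
    have "((\<lambda>z. \<omega> z v a) has_derivative (\<lambda>w. (fd (\<lambda>z. G z (snd a) v) z w, - fd (\<lambda>z. \<Gamma> z v (snd a)) z w))) (at z)"
      unfolding \<omega>_def
      by (intro has_derivative_Pair has_derivative_minus smooth_on_has_derivative[OF smG z] smooth_on_has_derivative[OF sm\<Gamma> z])
    from fd_eqI[OF this] show ?thesis by (simp add: compat z)
  qed
  have integ: "fd (\<lambda>z. \<omega> z v a) z w + \<omega> z v (\<omega> z w a) = fd (\<lambda>z. \<omega> z w a) z v + \<omega> z w (\<omega> z v a)"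
    if z: "z \<in> S" for z v w a
  proof -
    have "fd (\<lambda>z. \<Gamma> z v (snd a)) z w - \<Gamma> z v (\<Gamma> z w (snd a)) = fd (\<lambda>z. \<Gamma> z w (snd a)) z v - \<Gamma> z w (\<Gamma> z v (snd a))"
      using flat[OF z, of w v "snd a"] by (simp add: curv_def algebra_simps)
    then show ?thesis
      unfolding D[OF z] by (simp add: z \<omega>_def Gsimps \<Gamma>simps sym\<Gamma>[OF z, of w v] algebra_simps)
  qed
  obtain r u where ru: "r > 0" "ball z0 r \<subseteq> S" "\<And>a. u a z0 = a"
    "\<And>a z. z \<in> ball z0 r \<Longrightarrow> (u a has_derivative (\<lambda>v. \<omega> z v (u a z))) (at z)"
    "\<And>a. smooth_on (ball z0 r) (u a)"
    by (rule linear_total_system_solvable[OF open_S z0 bil sm integ]) blast+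
  define E f where "E b z = snd (u (0, b) z)" and "f b z = fst (u (0, b) z)" for b z
  have "parallel_vec (ball z0 r) (E b)" for b
    unfolding parallel_vec_def
  proof (intro conjI ballI allI)
    show "smooth_on (ball z0 r) (E b)"
      unfolding E_def by (rule smooth_on_bounded_linear[OF bounded_linear_snd open_ball ru(5)])
    show "fd (E b) z w = - \<Gamma> z w (E b z)" if "z \<in> ball z0 r" for z w
      using fd_eqI[OF has_derivative_snd[OF ru(4)[OF that]], of "(0, b)" w] by (simp add: E_def[abs_def] \<omega>_def)
  qed
  moreover have "smooth_on (ball z0 r) (f b)" for b
    unfolding f_def by (rule smooth_on_bounded_linear[OF bounded_linear_fst open_ball ru(5)])
  moreover have "fd (f b) z v = G z (E b z) v" if "z \<in> ball z0 r" for b z v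
    using fd_eqI[OF has_derivative_fst[OF ru(4)[OF that]], of "(0, b)" v] by (simp add: E_def[abs_def] f_def[abs_def] \<omega>_def)
  ultimately show thesis using that[of r E f] ru(1-3) by (simp add: E_def f_def)
qed

text \<open>The potential \<open>f b\<close> has gradient \<open>E b\<close>, so the derivative of
  their tuple sends a parallel field to its inner products with the frame. These are constant, and
  inverting the Gram map at \<open>z0\<close> turns them back into the components of the
  field.\<close>

lemma flat_coordinates:
  assumes z0: "z0 \<in> S" and flat: "\<And>z u v w. z \<in> S \<Longrightarrow> curv z u v w = 0"
  obtains r \<E> \<psi> where "r > 0" "ball z0 r \<subseteq> S" "\<And>a. parallel_vec (ball z0 r) (\<lambda>z. \<E> z a)"
    "\<And>z. linear (\<E> z)" "\<And>a. \<E> z0 a = a" "smooth_on (ball z0 r) \<psi>" "\<psi> z0 = 0"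
    "\<And>z a. z \<in> ball z0 r \<Longrightarrow> fd \<psi> z (\<E> z a) = a"
proof -
  obtain r E f where r: "r > 0" "ball z0 r \<subseteq> S" and E: "\<And>b. parallel_vec (ball z0 r) (E b)" "\<And>b. E b z0 = b"
    and f: "\<And>b. smooth_on (ball z0 r) (f b)" "\<And>b. f b z0 = (0::real)"
    "\<And>b z v. z \<in> ball z0 r \<Longrightarrow> fd (f b) z v = G z (E b z) v"
    by (rule parallel_frame_potential[OF z0 flat]) blast+
  interpret B: metric_chart "ball z0 r" G \<Gamma> by (rule metric_chart_subset[OF open_ball r(2)])
  have z0B: "z0 \<in> ball z0 r" using r by simp
  have sE: "smooth_on (ball z0 r) (E b)" and dE: "z \<in> ball z0 r \<Longrightarrow> fd (E b) z w = - \<Gamma> z w (E b z)" for b z w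
    using E(1) by (auto simp: B.parallel_vec_def parallel_vec_def)
  define \<E> where "\<E> z a = (\<Sum>b\<in>Basis. (a \<bullet> b) *\<^sub>R E b z)" for z a
  have lin\<E>: "linear (\<E> z)" for z
    unfolding \<E>_def by (auto intro!: linearI simp: inner_add_left scaleR_add_left sum.distrib scaleR_sum_right)
  have s\<E>: "smooth_on (ball z0 r) (\<lambda>z. \<E> z a)" for a
    unfolding \<E>_def by (rule smooth_on_sum[OF open_ball smooth_on_bounded_linear[OF bounded_linear_scaleR_right open_ball sE]])
  have d\<E>: "fd (\<lambda>z. \<E> z a) z w = - \<Gamma> z w (\<E> z a)" if z: "z \<in> ball z0 r" for z w a
  proof -
    have "((\<lambda>z. \<E> z a) has_derivative (\<lambda>w. \<Sum>b\<in>Basis. (a \<bullet> b) *\<^sub>R fd (E b) z w)) (at z)"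
      unfolding \<E>_def by (intro has_derivative_sum has_derivative_scaleR_right smooth_on_has_derivative[OF sE z])
    from fd_eqI[OF this] show ?thesis
      by (simp add: \<E>_def linear_sum[OF B.lin\<Gamma>(2)[OF z]] linear_scale[OF B.lin\<Gamma>(2)[OF z]] dE[OF z] sum_negf)
  qed
  have par: "parallel_vec (ball z0 r) (\<lambda>z. \<E> z a)" for a
    using s\<E> d\<E> by (simp add: parallel_vec_def)
  have \<E>0: "\<E> z0 a = a" for a by (simp add: \<E>_def E(2) euclidean_representation)
  have const: "G z (\<E> z a) (\<E> z b) = G z0 a b" if "z \<in> ball z0 r" for z a b
    using B.parallel_G_const[OF _ _ convex_ball that z0B, of "\<lambda>z. \<E> z a" "\<lambda>z. \<E> z b"] par \<E>0
    by (simp add: parallel_vec_def B.parallel_vec_def)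
  \<comment> \<open>The Gram map of \<open>G z0\<close>. Since inner products of parallel fields are
    constant, it also describes the derivative of \<open>\<psi>0\<close> at every other
    point.\<close>
  define A where "A a = (\<Sum>b\<in>Basis. G z0 b a *\<^sub>R b)" for a
  have Ab: "A a \<bullet> b = G z0 b a" if "b \<in> Basis" for a b
    unfolding A_def using that by (simp add: inner_sum_left inner_Basis if_distrib cong: if_cong)
  have linA: "linear A"
    unfolding A_def by (auto intro!: linearI simp: Gsimps z0 scaleR_add_left sum.distrib scaleR_sum_right)
  have AG: "A a \<bullet> c = G z0 c a" for a c
  proof -
    have "A a \<bullet> c = (\<Sum>b\<in>Basis. (c \<bullet> b) *\<^sub>R G z0 b a)"
      unfolding A_def by (simp add: inner_sum_left inner_sum_right mult.commute inner_commute)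
    then show ?thesis using linear_expansion[OF linG(1)[OF z0], of c a] by simp
  qed
  have "inj A"
  proof (rule linear_injective_0[OF linA, THEN iffD2], intro allI impI)
    fix a assume "A a = 0"
    then have "G z0 a a = 0" using AG[of a a] by simp
    then show "a = 0" using posG[OF z0] by (metis less_irrefl)
  qed
  from linear_injective_isomorphism[OF linA this]
  obtain A' where A': "linear A'" "\<And>a. A' (A a) = a" by blast
  define \<psi>0 where "\<psi>0 z = (\<Sum>b\<in>Basis. f b z *\<^sub>R b)" for z
  have s\<psi>0: "smooth_on (ball z0 r) \<psi>0"
    unfolding \<psi>0_def by (rule smooth_on_sum[OF open_ball smooth_on_bounded_linear[OF bounded_linear_scaleR_left open_ball f(1)]])
  have d\<psi>0: "fd \<psi>0 z v = (\<Sum>b\<in>Basis. G z (E b z) v *\<^sub>R b)" if z: "z \<in> ball z0 r" for z v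
  proof -
    have "(\<psi>0 has_derivative (\<lambda>v. \<Sum>b\<in>Basis. fd (f b) z v *\<^sub>R b)) (at z)"
      unfolding \<psi>0_def by (intro has_derivative_sum has_derivative_scaleR_left smooth_on_has_derivative[OF f(1) z])
    from fd_eqI[OF this] show ?thesis by (simp add: f(3)[OF z])
  qed
  have EB: "\<E> z b = E b z" if "b \<in> Basis" for z b
    unfolding \<E>_def using that by (simp add: inner_Basis if_distrib[of "\<lambda>c. c *\<^sub>R _"] cong: if_cong)
  have "fd \<psi>0 z (\<E> z a) = A a" if z: "z \<in> ball z0 r" for z a
  proof -
    have "G z (E b z) (\<E> z a) = G z0 b a" if "b \<in> Basis" for b
      using const[OF z, of b a] EB[OF that] by simp
    then show ?thesis by (simp add: d\<psi>0[OF z] A_def)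
  qed
  then have "fd (\<lambda>z. A' (\<psi>0 z)) z (\<E> z a) = a" if z: "z \<in> ball z0 r" for z a
    using fd_linear_const[OF A'(1) s\<psi>0 z] z A'(2) by simp
  moreover have "smooth_on (ball z0 r) (\<lambda>z. A' (\<psi>0 z))"
    by (rule smooth_on_linear_const[OF A'(1) open_ball s\<psi>0])
  moreover have "A' (\<psi>0 z0) = 0" by (simp add: \<psi>0_def f(2) linear_0[OF A'(1)])
  ultimately show thesis using that[of r \<E> "\<lambda>z. A' (\<psi>0 z)"] r par lin\<E> \<E>0 by simp
qed

theorem product_coordinates:
  assumes z0: "z0 \<in> S" and flat: "\<And>z u v w. z \<in> S \<Longrightarrow> curv z u v w = 0"
    and P: "parallel_endo P"
  obtains W B \<psi> g \<epsilon> where "open W" "z0 \<in> W" "W \<subseteq> S" "smooth_on W \<psi>" "\<epsilon> > 0"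
    "homeomorphism W B \<psi> g" "smooth_on B g" "open B" "B = {y. norm (P z0 y) < \<epsilon> \<and> norm (y - P z0 y) < \<epsilon>}"
    "\<And>z u v. z \<in> W \<Longrightarrow> G z u v = G z0 (fd \<psi> z u) (fd \<psi> z v)"
    "\<And>z u. z \<in> W \<Longrightarrow> fd \<psi> z (P z u) = P z0 (fd \<psi> z u)"
    "\<And>z. z \<in> W \<Longrightarrow> surj (fd \<psi> z)"
proof -
  obtain r \<E> \<psi> where r: "r > 0" "ball z0 r \<subseteq> S" and par: "\<And>a. parallel_vec (ball z0 r) (\<lambda>z. \<E> z a)"
    and lin\<E>: "\<And>z. linear (\<E> z)" and \<E>0: "\<And>a. \<E> z0 a = a" and \<psi>: "smooth_on (ball z0 r) \<psi>" "\<psi> z0 = 0"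
    and d\<psi>: "\<And>z a. z \<in> ball z0 r \<Longrightarrow> fd \<psi> z (\<E> z a) = a"
    by (rule flat_coordinates[OF z0 flat]) blast+
  interpret B: metric_chart "ball z0 r" G \<Gamma> by (rule metric_chart_subset[OF open_ball r(2)])
  have z0B: "z0 \<in> ball z0 r" using r by simp
  have lP: "z \<in> S \<Longrightarrow> linear (P z)" and sP: "smooth_on S (\<lambda>z. P z u)"
    and dP: "z \<in> S \<Longrightarrow> fd (\<lambda>z. P z u) z w = P z (\<Gamma> z w u) - \<Gamma> z w (P z u)" for z u w
    using P by (auto simp: parallel_endo_def)
  have BS: "z \<in> ball z0 r \<Longrightarrow> z \<in> S" for z using r(2) by blast
  have sP': "smooth_on (ball z0 r) (\<lambda>z. P z u)" for u by (rule smooth_on_subset[OF sP r(2)])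
  have s\<E>: "smooth_on (ball z0 r) (\<lambda>z. \<E> z a)" and d\<E>: "z \<in> ball z0 r \<Longrightarrow> fd (\<lambda>z. \<E> z a) z w = - \<Gamma> z w (\<E> z a)" for a z w
    using par by (auto simp: parallel_vec_def)
  have inv1: "\<E> z (fd \<psi> z u) = u" and surj1: "surj (fd \<psi> z)" if z: "z \<in> ball z0 r" for z u
  proof -
    have "inj (\<E> z)" using d\<psi>[OF z] by (metis injI)
    then have "surj (\<E> z)" using linear_injective_imp_surjective[OF lin\<E>] by blast
    then obtain a where "u = \<E> z a" by (meson surjD)
    then show "\<E> z (fd \<psi> z u) = u" using d\<psi>[OF z] by simp
    show "surj (fd \<psi> z)" using d\<psi>[OF z] by (metis surjI)
  qed
  have const: "G z (\<E> z a) (\<E> z b) = G z0 a b" if "z \<in> ball z0 r" for z a b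
    using B.parallel_G_const[OF _ _ convex_ball that z0B, of "\<lambda>z. \<E> z a" "\<lambda>z. \<E> z b"] par \<E>0
    by (simp add: parallel_vec_def B.parallel_vec_def)
  \<comment> \<open>Both sides are parallel in \<open>z\<close> and agree at \<open>z0\<close>.
    Their difference has constant length, hence vanishes, and so \<open>P\<close> has a constant
    matrix in the parallel frame.\<close>
  have P\<E>: "P z (\<E> z a) = \<E> z (P z0 a)" if z: "z \<in> ball z0 r" for z a
  proof -
    define q where "q z = P z (\<E> z a) - \<E> z (P z0 a)" for z
    have sP\<E>: "smooth_on (ball z0 r) (\<lambda>z. P z (\<E> z a))"
      by (rule smooth_on_linear_apply[where A = P, OF open_ball lP[OF BS] sP' s\<E>])
    have "parallel_vec (ball z0 r) q"
      unfolding parallel_vec_def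
    proof (intro conjI ballI allI)
      show "smooth_on (ball z0 r) q" unfolding q_def by (rule smooth_on_diff[OF open_ball sP\<E> s\<E>])
      fix z w assume z: "z \<in> ball z0 r"
      have "fd q z w = fd (\<lambda>z. P z (\<E> z a)) z w - fd (\<lambda>z. \<E> z (P z0 a)) z w"
        unfolding q_def by (rule fd_diff[OF sP\<E> s\<E> z])
      also have "fd (\<lambda>z. P z (\<E> z a)) z w = fd (\<lambda>y. P y (\<E> z a)) z w + P z (fd (\<lambda>z. \<E> z a) z w)"
        by (rule fd_linear_apply[where A = P, OF open_ball z lP[OF BS] sP' s\<E>])
      finally have e: "fd q z w = fd (\<lambda>y. P y (\<E> z a)) z w + P z (fd (\<lambda>z. \<E> z a) z w) - fd (\<lambda>z. \<E> z (P z0 a)) z w" .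
      show "fd q z w = - \<Gamma> z w (q z)"
        unfolding e by (simp add: dP[OF BS[OF z]] d\<E>[OF z] q_def linear_neg[OF lP[OF BS[OF z]]] \<Gamma>simps BS[OF z])
    qed
    then have "G z (q z) (q z) = G z0 (q z0) (q z0)"
      using B.parallel_G_const[OF _ _ convex_ball z z0B] by (simp add: parallel_vec_def B.parallel_vec_def)
    also have "q z0 = 0" by (simp add: q_def \<E>0)
    finally have "G z (q z) (q z) = 0" by (simp add: Gsimps z0)
    then have "q z = 0" using posG[OF BS[OF z]] by (metis less_irrefl)
    then show ?thesis by (simp add: q_def)
  qed
  define F where "F z = Blinfun (fd \<psi> z)" for z
  have F: "blinfun_apply (F z) = fd \<psi> z" if "z \<in> ball z0 r" for z
    unfolding F_def
    by (rule bounded_linear_Blinfun_apply[OF has_derivative_bounded_linear[OF smooth_on_has_derivative[OF \<psi>(1) that]]])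
  obtain U' V g g' where U': "open U'" "U' \<subseteq> ball z0 r" "z0 \<in> U'" "open V" "\<psi> z0 \<in> V" "homeomorphism U' V \<psi> g"
    and g: "\<And>y. y \<in> V \<Longrightarrow> (g has_derivative g' y) (at y)" "\<And>y. y \<in> V \<Longrightarrow> g' y = inv (blinfun_apply (F (g y)))"
  proof (rule inverse_function_theorem[of "ball z0 r" \<psi> F z0 id_blinfun])
    show "(\<psi> has_derivative blinfun_apply (F z)) (at z)" if "z \<in> ball z0 r" for z
      using smooth_on_has_derivative[OF \<psi>(1) that] F[OF that] by simp
    show "continuous_on (ball z0 r) F"
    proof (rule continuous_on_blinfun_componentwise)
      fix i :: 'e
      show "continuous_on (ball z0 r) (\<lambda>z. blinfun_apply (F z) i)"
        using smooth_on_imp_continuous_on[OF smooth_on_fd[OF \<psi>(1)], of i] by (rule continuous_on_eq) (simp add: F)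
    qed
    show "id_blinfun o\<^sub>L F z0 = id_blinfun"
      by (rule blinfun_eqI) (use d\<psi>[OF z0B] in \<open>simp add: F[OF z0B] \<E>0\<close>)
  qed (use z0B in auto)
  have gU: "g y \<in> ball z0 r" if "y \<in> V" for y using U'(2,6) that by (auto simp: homeomorphism_def)
  \<comment> \<open>The inverse of the derivative of \<open>\<psi>\<close> is the frame itself. The
    inverse map thus satisfies a differential equation with smooth right-hand side, which gives its
    smoothness by bootstrapping.\<close>
  have "g' y = \<E> (g y)" if "y \<in> V" for y
    unfolding g(2)[OF that] F[OF gU[OF that]]
    by (rule inv_equality) (use inv1[OF gU[OF that]] d\<psi>[OF gU[OF that]] in auto)
  then have dg: "(g has_derivative \<E> (g y)) (at y)" if "y \<in> V" for y using g(1)[OF that] that by simp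
  have sg: "smooth_on V g"
  proof (rule smooth_on_bootstrap[OF U'(4) dg], assumption)
    fix k v assume k: "C_k_on k V g"
    have "C_k_on k (ball z0 r) (\<lambda>z. \<E> z v)" using s\<E> by (simp add: smooth_on_def)
    then show "C_k_on k V (\<lambda>y. \<E> (g y) v)"
      by (rule C_k_on_compose[OF U'(4) open_ball k]) (use gU in auto)
  qed
  have "0 \<in> V" using U'(5) \<psi>(2) by simp
  then obtain \<delta> where \<delta>: "\<delta> > 0" "ball 0 \<delta> \<subseteq> V" using U'(4) openE by blast
  \<comment> \<open>Half the radius, because a point of \<open>B\<close> is a sum of two components
    of norm below \<open>\<epsilon>\<close>. This \<open>B\<close> is the part of the image that
    splits as a product along the range and the kernel of \<open>P z0\<close>.\<close>
  define \<epsilon> where "\<epsilon> = \<delta> / 2"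
  define B where "B = {y. norm (P z0 y) < \<epsilon> \<and> norm (y - P z0 y) < \<epsilon>}"
  have BV: "B \<subseteq> V"
  proof
    fix y assume "y \<in> B"
    then have "norm (P z0 y + (y - P z0 y)) < \<epsilon> + \<epsilon>" unfolding B_def by (intro norm_triangle_lt) auto
    then show "y \<in> V" using \<delta>(2) by (auto simp: \<epsilon>_def)
  qed
  have "continuous_on UNIV (P z0)" using lP[OF z0] by (simp add: linear_continuous_on linear_conv_bounded_linear)
  then have opB: "open B"
    unfolding B_def Collect_conj_eq by (intro open_Int open_Collect_less continuous_intros)
  define W where "W = U' \<inter> \<psi> -` B"
  have opW: "open W" unfolding W_def
    by (rule continuous_open_preimage[OF _ U'(1) opB]) (use U'(6) in \<open>simp add: homeomorphism_def\<close>)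
  have W: "W \<subseteq> ball z0 r" using U'(2) by (auto simp: W_def)
  have im: "\<psi> ` W = B" using U'(6) BV by (force simp: W_def homeomorphism_def)
  have hom: "homeomorphism W B \<psi> g"
    by (rule homeomorphism_of_subsets[OF U'(6) _ BV im]) (auto simp: W_def)
  show thesis
  proof
    show "open W" by (rule opW)
    show "z0 \<in> W" using U'(3) \<psi>(2) \<delta> by (simp add: W_def B_def \<epsilon>_def linear_0[OF lP[OF z0]])
    show "W \<subseteq> S" using W r(2) by blast
    show "smooth_on W \<psi>" by (rule smooth_on_subset[OF \<psi>(1) W])
    show "\<epsilon> > 0" using \<delta> by (simp add: \<epsilon>_def)
    show "homeomorphism W B \<psi> g" by (rule hom)
    show "smooth_on B g" by (rule smooth_on_subset[OF sg BV])
    show "open B" by (rule opB)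
    show "B = {y. norm (P z0 y) < \<epsilon> \<and> norm (y - P z0 y) < \<epsilon>}" by (rule B_def)
    fix z u assume "z \<in> W"
    then have z: "z \<in> ball z0 r" using W by blast
    show "G z u v = G z0 (fd \<psi> z u) (fd \<psi> z v)" for v
      using const[OF z, of "fd \<psi> z u" "fd \<psi> z v"] by (simp add: inv1[OF z])
    show "fd \<psi> z (P z u) = P z0 (fd \<psi> z u)"
      using P\<E>[OF z, of "fd \<psi> z u"] d\<psi>[OF z] by (simp add: inv1[OF z])
    show "surj (fd \<psi> z)" by (rule surj1[OF z])
  qed
qed

end

section \<open>Charts, vector fields and connections on a manifold\<close>

lemma topological_chart_simps:
  assumes "topological_chart c"
  shows "open (cdom c)" "open (cmap c ` cdom c)"
    "p \<in> cdom c \<Longrightarrow> cinv c (cmap c p) = p" "z \<in> cmap c ` cdom c \<Longrightarrow> cmap c (cinv c z) = z"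
    "z \<in> cmap c ` cdom c \<Longrightarrow> cinv c z \<in> cdom c"
    "continuous_on (cdom c) (cmap c)" "continuous_on (cmap c ` cdom c) (cinv c)"
  using assms unfolding topological_chart_def homeomorphism_def by auto

lemma open_cmap_image:
  assumes c: "topological_chart c" and "open V" "V \<subseteq> cdom c"
  shows "open (cmap c ` V)"
proof -
  have "cmap c ` V = cmap c ` cdom c \<inter> cinv c -` V"
    using topological_chart_simps(3-5)[OF c] assms(3) by (auto simp: image_iff)
  then show ?thesis
    using continuous_open_preimage[OF topological_chart_simps(7)[OF c] topological_chart_simps(2)[OF c] assms(2)] by simp
qed

abbreviation tr :: "('a, 'e::euclidean_space) chart \<Rightarrow> ('a, 'e) chart \<Rightarrow> 'e \<Rightarrow> 'e" where
  "tr c d \<equiv> cmap d \<circ> cinv c"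

locale smooth_mfd =
  fixes M :: "('a::{t2_space, second_countable_topology}, 'e::euclidean_space) chart set"
  assumes M: "smooth_manifold M"
begin

abbreviation "ad \<equiv> admissible_chart M"

lemma ad_top: "ad c \<Longrightarrow> topological_chart c" by (simp add: admissible_chart_def)

lemmas ad_simps = topological_chart_simps[OF ad_top]

lemma ad_in: "c \<in> M \<Longrightarrow> ad c"
  using M by (auto simp: admissible_chart_def smooth_manifold_def)

lemma chart_at: "chart_at M p \<in> M" "p \<in> cdom (chart_at M p)"
proof -
  have "p \<in> (\<Union>c\<in>M. cdom c)" using M by (simp add: smooth_manifold_def)
  then have "\<exists>c. c \<in> M \<and> p \<in> cdom c" by blast
  from someI_ex[OF this] show "chart_at M p \<in> M" "p \<in> cdom (chart_at M p)" by (auto simp: chart_at_def)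
qed

lemma ad_chart_at: "ad (chart_at M p)" using chart_at(1) ad_in by blast

lemma open_image: "ad c \<Longrightarrow> open V \<Longrightarrow> V \<subseteq> cdom c \<Longrightarrow> open (cmap c ` V)"
  by (rule open_cmap_image[OF ad_top])

lemma open_overlap: "ad c \<Longrightarrow> ad d \<Longrightarrow> open (cmap c ` (cdom c \<inter> cdom d))"
  by (rule open_image) (simp_all add: open_Int ad_simps(1))

text \<open>Admissibility compares a chart only with those of the atlas. Near each point of the
  overlap the transition is therefore factored through an atlas chart.\<close>

lemma smooth_tr:
  assumes c: "ad c" and d: "ad d"
  shows "smooth_on (cmap c ` (cdom c \<inter> cdom d)) (tr c d)"
proof (rule smooth_on_local)
  fix z assume "z \<in> cmap c ` (cdom c \<inter> cdom d)"
  then obtain p where p: "p \<in> cdom c" "p \<in> cdom d" "z = cmap c p" by blast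
  define e where "e = chart_at M p"
  have e: "e \<in> M" "p \<in> cdom e" using chart_at by (auto simp: e_def)
  have ade: "ad e" by (rule ad_in[OF e(1)])
  define T where "T = cdom c \<inter> cdom d \<inter> cdom e"
  have oT: "open T" "T \<subseteq> cdom c" unfolding T_def by (auto simp: ad_simps(1)[OF c] ad_simps(1)[OF d] ad_simps(1)[OF ade] intro!: open_Int)
  have o: "open (cmap c ` T)" by (rule open_image[OF c oT])
  have oe: "open (cmap e ` (cdom e \<inter> cdom d))"
    by (rule open_overlap[OF ade d])
  have s1: "smooth_on (cmap c ` T) (tr c e)"
    by (rule smooth_on_subset[of "cmap c ` (cdom c \<inter> cdom e)"])
      (use c e(1) in \<open>auto simp: admissible_chart_def smooth_transition_def T_def\<close>)
  have s2: "smooth_on (cmap e ` (cdom e \<inter> cdom d)) (tr e d)"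
    using d e(1) by (auto simp: admissible_chart_def smooth_transition_def)
  have im: "tr c e ` (cmap c ` T) \<subseteq> cmap e ` (cdom e \<inter> cdom d)"
    using ad_simps(3)[OF c] by (auto simp: T_def)
  have "smooth_on (cmap c ` T) (\<lambda>z. tr e d (tr c e z))"
    by (rule smooth_on_compose[OF o oe s1 s2 im])
  moreover have "smooth_on (cmap c ` T) (\<lambda>z. tr e d (tr c e z)) \<longleftrightarrow> smooth_on (cmap c ` T) (tr c d)"
    by (rule smooth_on_cong[OF o]) (use ad_simps(3)[OF c] ad_simps(3)[OF ade] in \<open>auto simp: T_def\<close>)
  ultimately have "smooth_on (cmap c ` T) (tr c d)" by blast
  then show "\<exists>T. open T \<and> z \<in> T \<and> smooth_on T (tr c d)" using o p e by (auto simp: T_def)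
qed

lemma linear_fd_tr: "ad c \<Longrightarrow> ad d \<Longrightarrow> p \<in> cdom c \<Longrightarrow> p \<in> cdom d \<Longrightarrow> linear (fd (tr c d) (cmap c p))"
  by (rule linear_fd[OF smooth_tr]) auto

lemma fd_tr_self: "ad c \<Longrightarrow> p \<in> cdom c \<Longrightarrow> fd (tr c c) (cmap c p) v = v"
proof -
  assume c: "ad c" and p: "p \<in> cdom c"
  have "fd (tr c c) (cmap c p) v = fd (\<lambda>z. z) (cmap c p) v"
    by (rule fd_cong_open[OF ad_simps(2)[OF c]]) (use p ad_simps(4)[OF c] in auto)
  then show ?thesis by simp
qed

lemma fd_tr_compose:
  assumes c: "ad c" and d: "ad d" and e: "ad e" and p: "p \<in> cdom c" "p \<in> cdom d" "p \<in> cdom e"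
  shows "fd (tr d e) (cmap d p) (fd (tr c d) (cmap c p) v) = fd (tr c e) (cmap c p) v"
proof -
  have o: "open (cmap c ` (cdom c \<inter> cdom d \<inter> cdom e))"
    by (rule open_image[OF c]) (auto simp: ad_simps(1)[OF c] ad_simps(1)[OF d] ad_simps(1)[OF e] intro!: open_Int)
  have "fd (tr c e) (cmap c p) v = fd (\<lambda>z. tr d e (tr c d z)) (cmap c p) v"
    by (rule fd_cong_open[OF o]) (use p ad_simps(3)[OF c] ad_simps(3)[OF d] in auto)
  also have "\<dots> = fd (tr d e) (tr c d (cmap c p)) (fd (tr c d) (cmap c p) v)"
    by (rule fd_chain[OF smooth_tr[OF c d] smooth_tr[OF d e]]) (use p ad_simps(3)[OF c] in auto)
  finally show ?thesis using p ad_simps(3)[OF c] by simp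
qed

lemma linear_to_chart: "ad c \<Longrightarrow> p \<in> cdom c \<Longrightarrow> linear (to_chart M c p)"
  unfolding to_chart_def[abs_def] by (rule linear_fd_tr[OF ad_chart_at _ chart_at(2)])

lemma linear_of_chart: "ad c \<Longrightarrow> p \<in> cdom c \<Longrightarrow> linear (of_chart M c p)"
  unfolding of_chart_def[abs_def] by (rule linear_fd_tr[OF _ ad_chart_at _ chart_at(2)])

lemma to_of_chart': "ad c \<Longrightarrow> ad d \<Longrightarrow> p \<in> cdom c \<Longrightarrow> p \<in> cdom d \<Longrightarrow>
    to_chart M d p (of_chart M c p u) = fd (tr c d) (cmap c p) u"
  unfolding to_chart_def of_chart_def by (rule fd_tr_compose[OF _ ad_chart_at _ _ chart_at(2)])

lemma to_of_chart: "ad c \<Longrightarrow> p \<in> cdom c \<Longrightarrow> to_chart M c p (of_chart M c p u) = u"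
  using to_of_chart'[of c c p u] fd_tr_self by simp

lemma of_to_chart: "ad c \<Longrightarrow> p \<in> cdom c \<Longrightarrow> of_chart M c p (to_chart M c p u) = u"
  unfolding to_chart_def of_chart_def
  by (subst fd_tr_compose[OF ad_chart_at _ ad_chart_at chart_at(2) _ chart_at(2)])
    (auto intro: fd_tr_self ad_chart_at chart_at)

lemma to_chart_at [simp]: "to_chart M (chart_at M p) p u = u"
  unfolding to_chart_def by (rule fd_tr_self[OF ad_chart_at chart_at(2)])

lemma to_chart_change: "ad c \<Longrightarrow> ad d \<Longrightarrow> p \<in> cdom c \<Longrightarrow> p \<in> cdom d \<Longrightarrow>
    to_chart M d p u = fd (tr c d) (cmap c p) (to_chart M c p u)"
  using to_of_chart'[of c d p "to_chart M c p u"] of_to_chart by simp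

lemma to_chart_inject: "ad c \<Longrightarrow> p \<in> cdom c \<Longrightarrow> to_chart M c p u = to_chart M c p v \<longleftrightarrow> u = v"
  using of_to_chart by metis

lemma vf_in_chart_at: "ad c \<Longrightarrow> p \<in> cdom c \<Longrightarrow> vf_in_chart M c X (cmap c p) = to_chart M c p (X p)"
  by (simp add: vf_in_chart_def ad_simps(3))

subsection \<open>Smoothness in admissible charts\<close>

lemma vf_change:
  assumes c: "ad c" and d: "ad d" and V: "open V" "V \<subseteq> cdom c" "V \<subseteq> cdom d"
    and s: "smooth_on (cmap c ` V) (vf_in_chart M c X)"
  shows "smooth_on (cmap d ` V) (vf_in_chart M d X)"
proof -
  have oc: "open (cmap c ` V)" and od: "open (cmap d ` V)" using open_image c d V by blast+
  have st: "smooth_on (cmap d ` V) (tr d c)"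
    by (rule smooth_on_subset[OF smooth_tr[OF d c]]) (use V in auto)
  have im: "tr d c ` cmap d ` V \<subseteq> cmap c ` V" using V ad_simps(3)[OF d] by auto
  have A: "smooth_on (cmap d ` V) (\<lambda>z. fd (tr c d) (tr d c z) u)" for u
    by (rule smooth_on_compose[OF od oc st _ im])
      (rule smooth_on_subset[OF smooth_on_fd[OF smooth_tr[OF c d]]], use V in auto)
  have lin: "linear (fd (tr c d) (tr d c z))" if zV: "z \<in> cmap d ` V" for z
  proof -
    obtain q where "q \<in> V" "z = cmap d q" using zV by blast
    moreover from this have "q \<in> cdom c" "q \<in> cdom d" using V by auto
    ultimately show ?thesis using linear_fd_tr[OF c d, of q] by (simp add: ad_simps(3)[OF d])
  qed
  have "smooth_on (cmap d ` V) (\<lambda>z. fd (tr c d) (tr d c z) (vf_in_chart M c X (tr d c z)))"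
    by (rule smooth_on_linear_apply[OF od lin A smooth_on_compose[OF od oc st s im]])
  moreover have "smooth_on (cmap d ` V) (\<lambda>z. fd (tr c d) (tr d c z) (vf_in_chart M c X (tr d c z))) \<longleftrightarrow>
      smooth_on (cmap d ` V) (vf_in_chart M d X)"
  proof (rule smooth_on_cong[OF od])
    fix z assume "z \<in> cmap d ` V"
    then obtain q where q: "q \<in> cdom c" "q \<in> cdom d" "z = cmap d q" using V by blast
    show "fd (tr c d) (tr d c z) (vf_in_chart M c X (tr d c z)) = vf_in_chart M d X z"
      using to_chart_change[OF c d q(1,2), of "X q"] q
      by (simp add: ad_simps(3)[OF d] vf_in_chart_at[OF c] vf_in_chart_at[OF d])
  qed
  ultimately show ?thesis by blast
qed

text \<open>A chart realizing a local product is admissible but may lie outside \<open>M\<close>,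
  and locally constructed fields are checked in whichever chart is convenient. Both require passing
  smoothness between arbitrary admissible charts.\<close>

lemma vf_smooth_local:
  assumes loc: "\<And>p. \<exists>c V. ad c \<and> open V \<and> p \<in> V \<and> V \<subseteq> cdom c \<and> smooth_on (cmap c ` V) (vf_in_chart M c X)"
    and d: "ad d"
  shows "smooth_on (cmap d ` cdom d) (vf_in_chart M d X)"
proof (rule smooth_on_local)
  fix z assume "z \<in> cmap d ` cdom d"
  then obtain p where p: "p \<in> cdom d" "z = cmap d p" by blast
  obtain c V where c: "ad c" "open V" "p \<in> V" "V \<subseteq> cdom c" "smooth_on (cmap c ` V) (vf_in_chart M c X)"
    using loc by blast
  let ?V = "V \<inter> cdom d"
  have V: "open ?V" "?V \<subseteq> cdom c" "?V \<subseteq> cdom d" using c ad_simps(1)[OF d] by auto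
  have "smooth_on (cmap d ` ?V) (vf_in_chart M d X)"
    by (rule vf_change[OF c(1) d V smooth_on_subset[OF c(5)]]) auto
  then show "\<exists>T. open T \<and> z \<in> T \<and> smooth_on T (vf_in_chart M d X)"
    using open_image[OF d V(1,3)] p c(3) by blast
qed

lemma vector_fieldI:
  assumes "\<And>p. \<exists>c V. ad c \<and> open V \<and> p \<in> V \<and> V \<subseteq> cdom c \<and> smooth_on (cmap c ` V) (vf_in_chart M c X)"
  shows "vector_field M X"
  unfolding vector_field_def using vf_smooth_local[OF assms] ad_in by blast

lemma vector_field_chart:
  assumes X: "vector_field M X" and "ad d"
  shows "smooth_on (cmap d ` cdom d) (vf_in_chart M d X)"
proof (rule vf_smooth_local[OF _ assms(2)])
  fix p
  show "\<exists>c V. ad c \<and> open V \<and> p \<in> V \<and> V \<subseteq> cdom c \<and> smooth_on (cmap c ` V) (vf_in_chart M c X)"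
    using X chart_at[of p] ad_chart_at[of p] ad_simps(1)[OF ad_chart_at[of p]] unfolding vector_field_def by blast
qed

lemma fun_smooth_local:
  assumes loc: "\<And>p. \<exists>c V. ad c \<and> open V \<and> p \<in> V \<and> V \<subseteq> cdom c \<and> smooth_on (cmap c ` V) (f \<circ> cinv c)"
    and d: "ad d"
  shows "smooth_on (cmap d ` cdom d) (f \<circ> cinv d)"
proof (rule smooth_on_local)
  fix z assume "z \<in> cmap d ` cdom d"
  then obtain p where p: "p \<in> cdom d" "z = cmap d p" by blast
  obtain c V where c: "ad c" "open V" "p \<in> V" "V \<subseteq> cdom c" "smooth_on (cmap c ` V) (f \<circ> cinv c)"
    using loc by blast
  let ?V = "V \<inter> cdom d"
  have V: "open ?V" "?V \<subseteq> cdom c" "?V \<subseteq> cdom d" using c ad_simps(1)[OF d] by auto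
  have od: "open (cmap d ` ?V)" and oc: "open (cmap c ` ?V)" using open_image c d V by blast+
  have "smooth_on (cmap d ` ?V) (\<lambda>z. (f \<circ> cinv c) (tr d c z))"
    by (rule smooth_on_compose[OF od oc smooth_on_subset[OF smooth_tr[OF d c(1)]] smooth_on_subset[OF c(5)]])
      (use c(4) ad_simps(3)[OF d] in auto)
  moreover have "smooth_on (cmap d ` ?V) (\<lambda>z. (f \<circ> cinv c) (tr d c z)) \<longleftrightarrow> smooth_on (cmap d ` ?V) (f \<circ> cinv d)"
    by (rule smooth_on_cong[OF od]) (use c(4) ad_simps(3)[OF d] ad_simps(3)[OF c(1)] in auto)
  ultimately have "smooth_on (cmap d ` ?V) (f \<circ> cinv d)" by blast
  then show "\<exists>T. open T \<and> z \<in> T \<and> smooth_on T (f \<circ> cinv d)" using od p c(3) by blast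
qed

lemma smooth_funI:
  assumes "\<And>p. \<exists>c V. ad c \<and> open V \<and> p \<in> V \<and> V \<subseteq> cdom c \<and> smooth_on (cmap c ` V) (f \<circ> cinv c)"
  shows "smooth_fun M f"
  unfolding smooth_fun_def using fun_smooth_local[OF assms] ad_in by blast

lemma smooth_fun_chart:
  assumes f: "smooth_fun M f" and "ad d"
  shows "smooth_on (cmap d ` cdom d) (f \<circ> cinv d)"
proof (rule fun_smooth_local[OF _ assms(2)])
  fix p
  show "\<exists>c V. ad c \<and> open V \<and> p \<in> V \<and> V \<subseteq> cdom c \<and> smooth_on (cmap c ` V) (f \<circ> cinv c)"
    using f chart_at[of p] ad_chart_at[of p] ad_simps(1)[OF ad_chart_at[of p]] unfolding smooth_fun_def by blast
qed

lemma smooth_fun_const: "smooth_fun M (\<lambda>p. r)"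
  by (simp add: smooth_fun_def o_def)

lemma smooth_fun_mult: "smooth_fun M f \<Longrightarrow> smooth_fun M h \<Longrightarrow> smooth_fun M (\<lambda>p. f p * h p)"
  unfolding smooth_fun_def o_def using smooth_on_mult ad_simps(2)[OF ad_in] by blast

lemma vector_field_zero: "vector_field M (\<lambda>p. 0)"
proof -
  have "smooth_on (cmap c ` cdom c) (vf_in_chart M c (\<lambda>p. 0))" if "c \<in> M" for c
  proof -
    have "smooth_on (cmap c ` cdom c) (vf_in_chart M c (\<lambda>p. 0)) \<longleftrightarrow> smooth_on (cmap c ` cdom c) (\<lambda>z. 0 :: 'e)"
      by (rule smooth_on_cong[OF ad_simps(2)[OF ad_in[OF that]]])
        (auto simp: vf_in_chart_at[OF ad_in[OF that]] linear_0[OF linear_to_chart[OF ad_in[OF that]]])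
    then show ?thesis by simp
  qed
  then show ?thesis by (simp add: vector_field_def)
qed

lemma vector_field_add:
  assumes "vector_field M X" "vector_field M Y" shows "vector_field M (\<lambda>p. X p + Y p)"
proof -
  have "smooth_on (cmap c ` cdom c) (vf_in_chart M c (\<lambda>p. X p + Y p))" if "c \<in> M" for c
  proof -
    have "smooth_on (cmap c ` cdom c) (vf_in_chart M c (\<lambda>p. X p + Y p)) \<longleftrightarrow>
        smooth_on (cmap c ` cdom c) (\<lambda>z. vf_in_chart M c X z + vf_in_chart M c Y z)"
      by (rule smooth_on_cong[OF ad_simps(2)[OF ad_in[OF that]]])
        (auto simp: vf_in_chart_at[OF ad_in[OF that]] linear_add[OF linear_to_chart[OF ad_in[OF that]]])
    moreover have "smooth_on (cmap c ` cdom c) (\<lambda>z. vf_in_chart M c X z + vf_in_chart M c Y z)"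
      by (rule smooth_on_add[OF ad_simps(2)[OF ad_in[OF that]]])
        (use assms that in \<open>simp_all add: vector_field_def\<close>)
    ultimately show ?thesis by blast
  qed
  then show ?thesis by (simp add: vector_field_def)
qed

lemma vector_field_scale:
  assumes "smooth_fun M f" "vector_field M X" shows "vector_field M (\<lambda>p. f p *\<^sub>R X p)"
proof -
  have "smooth_on (cmap c ` cdom c) (vf_in_chart M c (\<lambda>p. f p *\<^sub>R X p))" if "c \<in> M" for c
  proof -
    have "smooth_on (cmap c ` cdom c) (vf_in_chart M c (\<lambda>p. f p *\<^sub>R X p)) \<longleftrightarrow>
        smooth_on (cmap c ` cdom c) (\<lambda>z. (f \<circ> cinv c) z *\<^sub>R vf_in_chart M c X z)"
      by (rule smooth_on_cong[OF ad_simps(2)[OF ad_in[OF that]]])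
        (auto simp: vf_in_chart_at[OF ad_in[OF that]] ad_simps(3)[OF ad_in[OF that]]
          linear_scale[OF linear_to_chart[OF ad_in[OF that]]])
    moreover have "smooth_on (cmap c ` cdom c) (\<lambda>z. (f \<circ> cinv c) z *\<^sub>R vf_in_chart M c X z)"
      by (rule smooth_on_scaleR[OF ad_simps(2)[OF ad_in[OF that]]])
        (use assms that in \<open>unfold vector_field_def smooth_fun_def, blast+\<close>)
    ultimately show ?thesis by blast
  qed
  then show ?thesis by (simp add: vector_field_def)
qed

lemma vector_field_sum:
  assumes "finite I" "\<And>i. i \<in> I \<Longrightarrow> vector_field M (X i)"
  shows "vector_field M (\<lambda>p. \<Sum>i\<in>I. X i p)"
  using assms
proof (induction I rule: finite_induct)
  case (insert a I)
  then have "vector_field M (\<lambda>p. X a p + (\<Sum>i\<in>I. X i p))" by (intro vector_field_add) auto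
  then show ?case using insert by simp
qed (simp add: vector_field_zero)

lemma vector_field_diff:
  assumes "vector_field M X" "vector_field M Y" shows "vector_field M (\<lambda>p. X p - Y p)"
  using vector_field_add[OF assms(1) vector_field_scale[OF smooth_fun_const[of "-1"] assms(2)]] by simp

lemma vec_deriv_chart:
  assumes f: "smooth_fun M f" and c: "ad c" and p: "p \<in> cdom c"
  shows "vec_deriv M f p u = fd (f \<circ> cinv c) (cmap c p) (to_chart M c p u)"
proof -
  let ?a = "chart_at M p"
  have a: "ad ?a" "p \<in> cdom ?a" by (rule ad_chart_at chart_at)+
  have "vec_deriv M f p u = fd (\<lambda>z. (f \<circ> cinv c) (tr ?a c z)) (cmap ?a p) u"
    unfolding vec_deriv_def
    by (rule fd_cong_open[OF open_overlap[OF a(1) c]]) (use p a ad_simps(3)[OF a(1)] ad_simps(3)[OF c] in auto)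
  also have "\<dots> = fd (f \<circ> cinv c) (tr ?a c (cmap ?a p)) (fd (tr ?a c) (cmap ?a p) u)"
    by (rule fd_chain[OF smooth_tr[OF a(1) c] smooth_fun_chart[OF f c]]) (use p a ad_simps(3)[OF a(1)] in auto)
  finally show ?thesis using ad_simps(3)[OF a(1)] a(2) by (simp add: to_chart_def)
qed

text \<open>The bracket is defined in the chart \<open>chart_at M p\<close>. Changing the chart
  produces second derivatives of the transition map, which are symmetric and cancel in the
  difference.\<close>

lemma lie_bracket_chart:
  assumes X: "vector_field M X" and Y: "vector_field M Y" and c: "ad c" and p: "p \<in> cdom c"
  shows "to_chart M c p (lie_bracket M X Y p) =
    fd (vf_in_chart M c Y) (cmap c p) (to_chart M c p (X p)) -
    fd (vf_in_chart M c X) (cmap c p) (to_chart M c p (Y p))"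
proof -
  define a where "a = chart_at M p"
  have a: "ad a" "p \<in> cdom a" unfolding a_def by (rule ad_chart_at chart_at)+
  define S where "S = cmap a ` (cdom a \<inter> cdom c)"
  have oS: "open S" unfolding S_def by (rule open_overlap[OF a(1) c])
  have z: "cmap a p \<in> S" using a p by (simp add: S_def)
  have t: "smooth_on S (tr a c)" unfolding S_def by (rule smooth_tr[OF a(1) c])
  have lt: "linear (fd (tr a c) z)" if "z \<in> S" for z by (rule linear_fd[OF t that])
  have pa: "tr a c (cmap a p) = cmap c p" using ad_simps(3)[OF a(1)] a(2) by simp
  have D: "fd (vf_in_chart M c Z) (cmap c p) (fd (tr a c) (cmap a p) w) =
      fd (\<lambda>z. fd (tr a c) z (Z p)) (cmap a p) w + fd (tr a c) (cmap a p) (fd (vf_in_chart M a Z) (cmap a p) w)"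
    if Z: "vector_field M Z" for Z w
  proof -
    have sa: "smooth_on S (vf_in_chart M a Z)"
      by (rule smooth_on_subset[OF vector_field_chart[OF Z a(1)]]) (auto simp: S_def)
    have "fd (vf_in_chart M c Z) (cmap c p) (fd (tr a c) (cmap a p) w) =
        fd (\<lambda>z. vf_in_chart M c Z (tr a c z)) (cmap a p) w"
      using fd_chain[OF t vector_field_chart[OF Z c] z, of w] p by (simp only: pa) simp
    also have "\<dots> = fd (\<lambda>z. fd (tr a c) z (vf_in_chart M a Z z)) (cmap a p) w"
    proof (rule fd_cong_open[OF oS z])
      fix y assume "y \<in> S"
      then obtain q where q: "q \<in> cdom a" "q \<in> cdom c" "y = cmap a q" by (auto simp: S_def)
      then show "vf_in_chart M c Z (tr a c y) = fd (tr a c) y (vf_in_chart M a Z y)"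
        using to_chart_change[OF a(1) c q(1,2), of "Z q"]
        by (simp add: ad_simps(3)[OF a(1)] vf_in_chart_at[OF c] vf_in_chart_at[OF a(1)])
    qed
    also have "\<dots> = fd (\<lambda>z. fd (tr a c) z (vf_in_chart M a Z (cmap a p))) (cmap a p) w
        + fd (tr a c) (cmap a p) (fd (vf_in_chart M a Z) (cmap a p) w)"
      by (rule fd_linear_apply[OF oS z lt smooth_on_fd[OF t] sa])
    also have "vf_in_chart M a Z (cmap a p) = Z p"
      using vf_in_chart_at[OF a] by (simp add: a_def)
    finally show ?thesis .
  qed
  have tc: "to_chart M c p u = fd (tr a c) (cmap a p) u" for u by (simp add: to_chart_def a_def)
  have "to_chart M c p (lie_bracket M X Y p) = fd (tr a c) (cmap a p) (fd (vf_in_chart M a Y) (cmap a p) (X p))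
      - fd (tr a c) (cmap a p) (fd (vf_in_chart M a X) (cmap a p) (Y p))"
    unfolding tc lie_bracket_def Let_def a_def[symmetric] by (rule linear_diff[OF lt[OF z]])
  also have "\<dots> = fd (vf_in_chart M c Y) (cmap c p) (to_chart M c p (X p)) -
    fd (vf_in_chart M c X) (cmap c p) (to_chart M c p (Y p))"
    unfolding tc D[OF X] D[OF Y] using fd_fd_symmetric[OF oS t z, of "X p" "Y p"] by simp
  finally show ?thesis .
qed

subsection \<open>Extension of local fields\<close>

text \<open>Connections, brackets and smoothness conditions refer to global fields, so local
  coordinate data are extended by a cut-off. Its support lies in the compact set \<open>K\<close>,
  which is closed because the space is Hausdorff. Outside \<open>K\<close> the extension is locally
  0 and so smooth at points not covered by the chart.\<close>

lemma cutoff: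
  assumes c: "ad c" and p: "p \<in> cdom c"
  obtains \<kappa> V where "open V" "p \<in> V" "V \<subseteq> cdom c" "\<And>q. q \<in> V \<Longrightarrow> \<kappa> q = 1"
    "\<And>q. q \<notin> cdom c \<Longrightarrow> \<kappa> q = (0::real)"
    "\<And>f. smooth_on (cmap c ` cdom c) f \<Longrightarrow> smooth_fun M (\<lambda>q. \<kappa> q * f (cmap c q))"
    "\<And>y. smooth_on (cmap c ` cdom c) y \<Longrightarrow> vector_field M (\<lambda>q. \<kappa> q *\<^sub>R of_chart M c q (y (cmap c q)))"
proof -
  define z0 where "z0 = cmap c p"
  have "z0 \<in> cmap c ` cdom c" using p by (simp add: z0_def)
  \<comment> \<open>Three radii are used: the cut-off is 1 within \<open>R/3\<close> and 0 outside
    \<open>R/2\<close>, and the closed ball of radius \<open>R\<close> is still contained in the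
    image of the chart.\<close>
  then obtain R where R: "R > 0" "cball z0 R \<subseteq> cmap c ` cdom c"
    using ad_simps(2)[OF c] open_contains_cball by blast
  obtain \<beta> :: "'e \<Rightarrow> real" where \<beta>: "smooth_on UNIV \<beta>" "\<And>x. x \<in> ball z0 (R/3) \<Longrightarrow> \<beta> x = 1"
    "\<And>x. x \<notin> ball z0 (R/2) \<Longrightarrow> \<beta> x = 0"
    by (rule bump_function[of "R/3" "R/2" z0]) (use R in auto)
  define \<kappa> where "\<kappa> q = (if q \<in> cdom c then \<beta> (cmap c q) else 0)" for q
  define V where "V = cdom c \<inter> cmap c -` ball z0 (R/3)"
  define K where "K = cinv c ` cball z0 R"
  have "compact K" unfolding K_def
    by (rule compact_continuous_image[OF continuous_on_subset[OF ad_simps(7)[OF c] R(2)]]) simp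
  then have clK: "closed K" by (rule compact_imp_closed)
  have \<kappa>K: "\<kappa> q = 0" if "q \<notin> K" for q
  proof (cases "q \<in> cdom c")
    case True
    have "cmap c q \<notin> cball z0 R"
    proof
      assume "cmap c q \<in> cball z0 R"
      then have "cinv c (cmap c q) \<in> K" by (simp add: K_def)
      then show False using that ad_simps(3)[OF c True] by simp
    qed
    then have "cmap c q \<notin> ball z0 (R/2)" using R by auto
    then show ?thesis using \<beta>(3) by (simp add: \<kappa>_def)
  qed (simp add: \<kappa>_def)
  have s\<beta>: "smooth_on (cmap c ` cdom c) \<beta>" by (rule smooth_on_subset[OF \<beta>(1)]) simp
  have Kc: "K \<subseteq> cdom c" using R(2) ad_simps(5)[OF c] by (auto simp: K_def)
  show thesis
  proof
    show "open V" unfolding V_def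
      by (rule continuous_open_preimage[OF ad_simps(6)[OF c] ad_simps(1)[OF c] open_ball])
    show "p \<in> V" using p R by (simp add: V_def z0_def)
    show "V \<subseteq> cdom c" by (simp add: V_def)
    show "\<kappa> q = 1" if "q \<in> V" for q using that \<beta>(2) by (simp add: V_def \<kappa>_def)
    show "\<kappa> q = 0" if "q \<notin> cdom c" for q using that by (simp add: \<kappa>_def)
  next
    fix f :: "'e \<Rightarrow> real" assume f: "smooth_on (cmap c ` cdom c) f"
    show "smooth_fun M (\<lambda>q. \<kappa> q * f (cmap c q))"
    proof (rule smooth_funI)
      fix q
      show "\<exists>d V. ad d \<and> open V \<and> q \<in> V \<and> V \<subseteq> cdom d \<and>
          smooth_on (cmap d ` V) ((\<lambda>q. \<kappa> q * f (cmap c q)) \<circ> cinv d)"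
      proof (cases "q \<in> cdom c")
        case True
        have "smooth_on (cmap c ` cdom c) ((\<lambda>q. \<kappa> q * f (cmap c q)) \<circ> cinv c) \<longleftrightarrow>
            smooth_on (cmap c ` cdom c) (\<lambda>z. \<beta> z * f z)"
          by (rule smooth_on_cong[OF ad_simps(2)[OF c]]) (auto simp: ad_simps(3)[OF c] \<kappa>_def)
        then have "smooth_on (cmap c ` cdom c) ((\<lambda>q. \<kappa> q * f (cmap c q)) \<circ> cinv c)"
          using smooth_on_mult[OF ad_simps(2)[OF c] s\<beta> f] by simp
        then show ?thesis using c True ad_simps(1)[OF c] by blast
      next
        case False
        define d where "d = chart_at M q"
        have d: "ad d" "q \<in> cdom d" unfolding d_def by (rule ad_chart_at chart_at)+
        define U where "U = cdom d - K"
        have U: "open U" "U \<subseteq> cdom d" "q \<in> U"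
          using clK ad_simps(1)[OF d(1)] d(2) Kc False by (auto simp: U_def open_Diff)
        have "smooth_on (cmap d ` U) ((\<lambda>q. \<kappa> q * f (cmap c q)) \<circ> cinv d) \<longleftrightarrow> smooth_on (cmap d ` U) (\<lambda>z. 0 :: real)"
          by (rule smooth_on_cong[OF open_image[OF d(1) U(1,2)]])
            (auto simp: ad_simps(3)[OF d(1)] U_def \<kappa>K)
        then have "smooth_on (cmap d ` U) ((\<lambda>q. \<kappa> q * f (cmap c q)) \<circ> cinv d)" by simp
        then show ?thesis using d U by blast
      qed
    qed
  next
    fix y :: "'e \<Rightarrow> 'e" assume y: "smooth_on (cmap c ` cdom c) y"
    let ?Y = "\<lambda>q. \<kappa> q *\<^sub>R of_chart M c q (y (cmap c q))"
    show "vector_field M ?Y"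
    proof (rule vector_fieldI)
      fix q
      show "\<exists>d V. ad d \<and> open V \<and> q \<in> V \<and> V \<subseteq> cdom d \<and> smooth_on (cmap d ` V) (vf_in_chart M d ?Y)"
      proof (cases "q \<in> cdom c")
        case True
        have "smooth_on (cmap c ` cdom c) (vf_in_chart M c ?Y) \<longleftrightarrow>
            smooth_on (cmap c ` cdom c) (\<lambda>z. \<beta> z *\<^sub>R y z)"
          by (rule smooth_on_cong[OF ad_simps(2)[OF c]])
            (auto simp: vf_in_chart_at[OF c] linear_scale[OF linear_to_chart[OF c]] to_of_chart[OF c] \<kappa>_def)
        then have "smooth_on (cmap c ` cdom c) (vf_in_chart M c ?Y)"
          using smooth_on_scaleR[OF ad_simps(2)[OF c] s\<beta> y] by simp
        then show ?thesis using c True ad_simps(1)[OF c] by blast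
      next
        case False
        define d where "d = chart_at M q"
        have d: "ad d" "q \<in> cdom d" unfolding d_def by (rule ad_chart_at chart_at)+
        define U where "U = cdom d - K"
        have U: "open U" "U \<subseteq> cdom d" "q \<in> U"
          using clK ad_simps(1)[OF d(1)] d(2) Kc False by (auto simp: U_def open_Diff)
        have "smooth_on (cmap d ` U) (vf_in_chart M d ?Y) \<longleftrightarrow> smooth_on (cmap d ` U) (\<lambda>z. 0 :: 'e)"
          by (rule smooth_on_cong[OF open_image[OF d(1) U(1,2)]])
            (auto simp: vf_in_chart_at[OF d(1)] U_def \<kappa>K linear_0[OF linear_to_chart[OF d(1)]])
        then have "smooth_on (cmap d ` U) (vf_in_chart M d ?Y)" by simp
        then show ?thesis using d U by blast
      qed
    qed
  qed
qed

end

context smooth_mfd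
begin

lemma bilinear_of_chart:
  assumes g: "bilinear g" and c: "ad c" "p \<in> cdom c"
  shows "bilinear (\<lambda>u v. g (of_chart M c p u) (of_chart M c p v))"
  using linear_compose[OF linear_of_chart[OF c]] g by (auto simp: bilinear_def o_def)

lemma metric_smooth_fun:
  assumes g: "riemannian_metric M g" and X: "vector_field M X" and Y: "vector_field M Y"
  shows "smooth_fun M (\<lambda>p. g p (X p) (Y p))"
  unfolding smooth_fun_def
proof
  fix c assume cM: "c \<in> M"
  then have c: "ad c" by (rule ad_in)
  let ?Z = "cmap c ` cdom c"
  have "smooth_on ?Z ((\<lambda>p. g p (X p) (Y p)) \<circ> cinv c) \<longleftrightarrow>
      smooth_on ?Z (\<lambda>z. g (cinv c z) (of_chart M c (cinv c z) (vf_in_chart M c X z)) (of_chart M c (cinv c z) (vf_in_chart M c Y z)))"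
    by (rule smooth_on_cong[OF ad_simps(2)[OF c]])
      (auto simp: vf_in_chart_at[OF c] ad_simps(3)[OF c] of_to_chart[OF c])
  moreover have "smooth_on ?Z (\<lambda>z. g (cinv c z) (of_chart M c (cinv c z) (vf_in_chart M c X z)) (of_chart M c (cinv c z) (vf_in_chart M c Y z)))"
  proof (rule smooth_on_bilinear_apply[where B = "\<lambda>z u v. g (cinv c z) (of_chart M c (cinv c z) u) (of_chart M c (cinv c z) v)",
        OF ad_simps(2)[OF c] _ _ vector_field_chart[OF X c] vector_field_chart[OF Y c]])
    show "bilinear (\<lambda>u v. g (cinv c z) (of_chart M c (cinv c z) u) (of_chart M c (cinv c z) v))" if "z \<in> ?Z" for z
      by (rule bilinear_of_chart[OF _ c ad_simps(5)[OF c that]]) (use g in \<open>simp add: riemannian_metric_def\<close>)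
    show "smooth_on ?Z (\<lambda>z. g (cinv c z) (of_chart M c (cinv c z) u) (of_chart M c (cinv c z) v))" for u v
      using g cM unfolding riemannian_metric_def by blast
  qed
  ultimately show "smooth_on ?Z ((\<lambda>p. g p (X p) (Y p)) \<circ> cinv c)" by blast
qed

lemma tensor_vector_field:
  assumes \<phi>: "tensor_field_11 M \<phi>" and X: "vector_field M X"
  shows "vector_field M (\<lambda>p. \<phi> p (X p))"
  unfolding vector_field_def
proof
  fix c assume cM: "c \<in> M"
  then have c: "ad c" by (rule ad_in)
  let ?Z = "cmap c ` cdom c"
  let ?f = "\<lambda>z u. to_chart M c (cinv c z) (\<phi> (cinv c z) (of_chart M c (cinv c z) u))"
  have "smooth_on ?Z (vf_in_chart M c (\<lambda>p. \<phi> p (X p))) \<longleftrightarrow> smooth_on ?Z (\<lambda>z. ?f z (vf_in_chart M c X z))"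
    by (rule smooth_on_cong[OF ad_simps(2)[OF c]])
      (auto simp: vf_in_chart_at[OF c] ad_simps(3)[OF c] of_to_chart[OF c])
  moreover have "smooth_on ?Z (\<lambda>z. ?f z (vf_in_chart M c X z))"
  proof (rule smooth_on_linear_apply[where A = ?f, OF ad_simps(2)[OF c] _ _ vector_field_chart[OF X c]])
    show "linear (?f z)" if "z \<in> ?Z" for z
    proof -
      have "linear (\<phi> (cinv c z))" using \<phi> by (simp add: tensor_field_11_def)
      from linear_compose[OF linear_compose[OF linear_of_chart[OF c ad_simps(5)[OF c that]] this]
          linear_to_chart[OF c ad_simps(5)[OF c that]]]
      show ?thesis by (simp add: o_def)
    qed
    show "smooth_on ?Z (\<lambda>z. ?f z u)" for u
      using \<phi> cM unfolding tensor_field_11_def by blast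
  qed
  ultimately show "smooth_on ?Z (vf_in_chart M c (\<lambda>p. \<phi> p (X p)))" by blast
qed

lemma vec_deriv_local_const:
  assumes f: "smooth_fun M f" and V: "open V" "p \<in> V" "\<And>q. q \<in> V \<Longrightarrow> f q = k"
  shows "vec_deriv M f p u = 0"
proof -
  define c where "c = chart_at M p"
  have c: "ad c" "p \<in> cdom c" unfolding c_def by (rule ad_chart_at chart_at)+
  have o: "open (cmap c ` (V \<inter> cdom c))" by (rule open_image[OF c(1)]) (auto simp: V ad_simps(1)[OF c(1)] intro!: open_Int)
  have "fd (f \<circ> cinv c) (cmap c p) w = fd (\<lambda>z. k) (cmap c p) w" for w
    by (rule fd_cong_open[OF o]) (use c V in \<open>auto simp: ad_simps(3)[OF c(1)]\<close>)
  then show ?thesis by (simp add: vec_deriv_chart[OF f c])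
qed

end

section \<open>Connections on a manifold and their Christoffel symbols\<close>

locale mfd_connection = smooth_mfd +
  fixes nabla :: "('a \<Rightarrow> 'b::euclidean_space) \<Rightarrow> ('a \<Rightarrow> 'b) \<Rightarrow> ('a \<Rightarrow> 'b)"
  assumes conn: "affine_connection M nabla"
begin

lemma nabla_vf: "vector_field M X \<Longrightarrow> vector_field M Y \<Longrightarrow> vector_field M (nabla X Y)"
  using conn unfolding affine_connection_def by blast

lemma nabla_add1: "vector_field M X \<Longrightarrow> vector_field M X' \<Longrightarrow> vector_field M Y \<Longrightarrow>
    nabla (\<lambda>p. X p + X' p) Y = (\<lambda>p. nabla X Y p + nabla X' Y p)"
  using conn unfolding affine_connection_def by blast

lemma nabla_add2: "vector_field M X \<Longrightarrow> vector_field M Y \<Longrightarrow> vector_field M Y' \<Longrightarrow>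
    nabla X (\<lambda>p. Y p + Y' p) = (\<lambda>p. nabla X Y p + nabla X Y' p)"
  using conn unfolding affine_connection_def by blast

lemma nabla_scale1: "smooth_fun M f \<Longrightarrow> vector_field M X \<Longrightarrow> vector_field M Y \<Longrightarrow>
    nabla (\<lambda>p. f p *\<^sub>R X p) Y = (\<lambda>p. f p *\<^sub>R nabla X Y p)"
  using conn unfolding affine_connection_def by blast

lemma nabla_scale2: "smooth_fun M f \<Longrightarrow> vector_field M X \<Longrightarrow> vector_field M Y \<Longrightarrow>
    nabla X (\<lambda>p. f p *\<^sub>R Y p) = (\<lambda>p. vec_deriv M f p (X p) *\<^sub>R Y p + f p *\<^sub>R nabla X Y p)"
  using conn unfolding affine_connection_def by blast

lemma nabla_zero1: "vector_field M Y \<Longrightarrow> nabla (\<lambda>p. 0) Y = (\<lambda>p. 0)"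
  using nabla_scale1[OF smooth_fun_const[of 0] vector_field_zero, of Y] by simp

lemma nabla_zero2: "vector_field M X \<Longrightarrow> nabla X (\<lambda>p. 0) = (\<lambda>p. 0)"
  using nabla_scale2[OF smooth_fun_const[of 0] _ vector_field_zero, of X]
    vec_deriv_local_const[OF smooth_fun_const[of 0] open_UNIV UNIV_I refl] by simp

lemma nabla_sum1:
  assumes "finite I" "\<And>i. i \<in> I \<Longrightarrow> vector_field M (X i)" "vector_field M Y"
  shows "nabla (\<lambda>p. \<Sum>i\<in>I. X i p) Y = (\<lambda>p. \<Sum>i\<in>I. nabla (X i) Y p)"
  using assms(1,2)
proof (induction I rule: finite_induct)
  case (insert a I)
  have "nabla (\<lambda>p. X a p + (\<Sum>i\<in>I. X i p)) Y = (\<lambda>p. nabla (X a) Y p + nabla (\<lambda>p. \<Sum>i\<in>I. X i p) Y p)"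
    by (rule nabla_add1[OF _ vector_field_sum assms(3)]) (use insert in auto)
  then show ?case using insert by simp
qed (simp add: nabla_zero1 assms(3))

lemma nabla_sum2:
  assumes "finite I" "\<And>i. i \<in> I \<Longrightarrow> vector_field M (Y i)" "vector_field M X"
  shows "nabla X (\<lambda>p. \<Sum>i\<in>I. Y i p) = (\<lambda>p. \<Sum>i\<in>I. nabla X (Y i) p)"
  using assms(1,2)
proof (induction I rule: finite_induct)
  case (insert a I)
  have "nabla X (\<lambda>p. Y a p + (\<Sum>i\<in>I. Y i p)) = (\<lambda>p. nabla X (Y a) p + nabla X (\<lambda>p. \<Sum>i\<in>I. Y i p) p)"
    by (rule nabla_add2[OF assms(3) _ vector_field_sum]) (use insert in auto)
  then show ?case using insert by simp
qed (simp add: nabla_zero2 assms(3))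

end

text \<open>Keeps one outcome of \<open>cutoff\<close> fixed, so that the coordinate fields of
  \<open>c\<close> have global extensions that are unchanged on \<open>V\<close>.\<close>

locale frame_chart = mfd_connection +
  fixes c and V and \<kappa> :: "'a \<Rightarrow> real"
  assumes c: "ad c" and V: "open V" "V \<subseteq> cdom c"
    and \<kappa>1: "\<And>q. q \<in> V \<Longrightarrow> \<kappa> q = 1" and \<kappa>0: "\<And>q. q \<notin> cdom c \<Longrightarrow> \<kappa> q = 0"
    and ext_fun: "\<And>f. smooth_on (cmap c ` cdom c) f \<Longrightarrow> smooth_fun M (\<lambda>q. \<kappa> q * f (cmap c q))"
    and ext_vf: "\<And>y. smooth_on (cmap c ` cdom c) y \<Longrightarrow> vector_field M (\<lambda>q. \<kappa> q *\<^sub>R of_chart M c q (y (cmap c q)))"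
begin

definition "Z = cmap c ` V"
text \<open>The field with constant components \<open>u\<close> in the chart, cut off to a global
  one. The next definition uses these fields to read off the Christoffel symbol on
  \<open>V\<close>.\<close>

definition "E u q = \<kappa> q *\<^sub>R of_chart M c q u"
definition "\<Gamma> z u v = vf_in_chart M c (nabla (E u) (E v)) z"

lemma open_Z: "open Z" unfolding Z_def by (rule open_image[OF c V])

lemma Z_sub: "Z \<subseteq> cmap c ` cdom c" using V by (auto simp: Z_def)

lemma Vc: "q \<in> V \<Longrightarrow> q \<in> cdom c" using V by blast

lemma vf_E: "vector_field M (E u)"
  unfolding E_def[abs_def] by (rule ext_vf) simp

lemma E_V: "q \<in> V \<Longrightarrow> E u q = of_chart M c q u" by (simp add: E_def \<kappa>1)

lemma to_chart_E: "q \<in> V \<Longrightarrow> to_chart M c q (E u q) = u"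
  by (simp add: E_V to_of_chart[OF c Vc])

lemma vf_in_chart_E: "z \<in> Z \<Longrightarrow> vf_in_chart M c (E u) z = u"
  using vf_in_chart_at[OF c Vc] to_chart_E by (auto simp: Z_def)

lemma fd_vf_in_chart_E: "z \<in> Z \<Longrightarrow> fd (vf_in_chart M c (E u)) z w = 0"
  using fd_cong_open[OF open_Z, of z "vf_in_chart M c (E u)" "\<lambda>z. u" w] vf_in_chart_E by simp

lemma smooth_\<kappa>2: "smooth_fun M (\<lambda>q. \<kappa> q * \<kappa> q)"
  using smooth_fun_mult[OF ext_fun[OF smooth_on_const[of _ 1]] ext_fun[OF smooth_on_const[of _ 1]]] by simp

definition "coord X b q = \<kappa> q * (vf_in_chart M c X (cmap c q) \<bullet> b)"

lemma smooth_coord: "vector_field M X \<Longrightarrow> smooth_fun M (coord X b)"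
  unfolding coord_def[abs_def]
  by (rule ext_fun) (rule smooth_on_bounded_linear[OF bounded_linear_inner_left ad_simps(2)[OF c] vector_field_chart[OF _ c]])

lemma coord_V: "q \<in> V \<Longrightarrow> coord X b q = to_chart M c q (X q) \<bullet> b"
  by (simp add: coord_def \<kappa>1 vf_in_chart_at[OF c Vc])

text \<open>The square of \<open>\<kappa>\<close> arises because the coefficients and the frame
  fields each carry one cut-off factor. This makes the expansion an identity of global fields, to
  which \<open>nabla\<close> may be applied.\<close>

lemma frame_expansion: "(\<kappa> q * \<kappa> q) *\<^sub>R X q = (\<Sum>b\<in>Basis. coord X b q *\<^sub>R E b q)"
proof (cases "q \<in> cdom c")
  case True
  have "X q = of_chart M c q (to_chart M c q (X q))" using of_to_chart[OF c True] by simp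
  also have "\<dots> = (\<Sum>b\<in>Basis. (to_chart M c q (X q) \<bullet> b) *\<^sub>R of_chart M c q b)"
    by (rule linear_expansion[OF linear_of_chart[OF c True]])
  finally have "(\<kappa> q * \<kappa> q) *\<^sub>R X q = (\<kappa> q * \<kappa> q) *\<^sub>R (\<Sum>b\<in>Basis. (to_chart M c q (X q) \<bullet> b) *\<^sub>R of_chart M c q b)"
    by simp
  then show ?thesis
    by (simp add: coord_def E_def vf_in_chart_at[OF c True] scaleR_sum_right mult_ac)
qed (simp add: \<kappa>0 coord_def)

lemma vector_field_coord_E: "vector_field M X \<Longrightarrow> vector_field M (\<lambda>q. coord X b q *\<^sub>R E b q)"
  by (rule vector_field_scale[OF smooth_coord vf_E])

text \<open>Multiplying a field by the square of \<open>\<kappa>\<close> does not affect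
  \<open>nabla\<close> on \<open>V\<close>: in the first slot by function-linearity, in the second
  because the factor is constantly 1 there and its derivative vanishes. The frame expansion then
  reduces everything to frame fields, and this also establishes that \<open>nabla\<close> is
  local.\<close>

lemma nabla_chart:
  assumes X: "vector_field M X" and Y: "vector_field M Y" and q: "q \<in> V"
  shows "to_chart M c q (nabla X Y q) = fd (vf_in_chart M c Y) (cmap c q) (to_chart M c q (X q))
    + (\<Sum>b\<in>Basis. \<Sum>b'\<in>Basis. ((to_chart M c q (X q) \<bullet> b) * (to_chart M c q (Y q) \<bullet> b')) *\<^sub>R \<Gamma> (cmap c q) b b')"
proof -
  let ?x = "to_chart M c q (X q)" and ?y = "to_chart M c q (Y q)" and ?z = "cmap c q"
  have z: "?z \<in> Z" using q by (simp add: Z_def)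
  have lt: "linear (to_chart M c q)" by (rule linear_to_chart[OF c Vc[OF q]])
  have E: "nabla (E b) Y q = (\<Sum>b'\<in>Basis. vec_deriv M (coord Y b') q (E b q) *\<^sub>R E b' q + coord Y b' q *\<^sub>R nabla (E b) (E b') q)" for b
  proof -
    have "vec_deriv M (\<lambda>q. \<kappa> q * \<kappa> q) q u = 0" for u
      by (rule vec_deriv_local_const[OF smooth_\<kappa>2 V(1) q, where k = 1]) (simp add: \<kappa>1)
    then have "nabla (E b) Y q = nabla (E b) (\<lambda>q. (\<kappa> q * \<kappa> q) *\<^sub>R Y q) q"
      by (simp add: nabla_scale2[OF smooth_\<kappa>2 vf_E Y] \<kappa>1 q)
    also have "\<dots> = nabla (E b) (\<lambda>q. \<Sum>b'\<in>Basis. coord Y b' q *\<^sub>R E b' q) q" by (simp only: frame_expansion)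
    also have "\<dots> = (\<Sum>b'\<in>Basis. nabla (E b) (\<lambda>q. coord Y b' q *\<^sub>R E b' q) q)"
      by (subst nabla_sum2[OF finite_Basis vector_field_coord_E[OF Y] vf_E]) simp
    also have "\<dots> = (\<Sum>b'\<in>Basis. vec_deriv M (coord Y b') q (E b q) *\<^sub>R E b' q + coord Y b' q *\<^sub>R nabla (E b) (E b') q)"
      by (simp only: nabla_scale2[OF smooth_coord[OF Y] vf_E vf_E])
    finally show ?thesis .
  qed
  have D: "vec_deriv M (coord Y b') q (E b q) = fd (vf_in_chart M c Y) ?z b \<bullet> b'" for b b'
  proof -
    have "vec_deriv M (coord Y b') q (E b q) = fd (coord Y b' \<circ> cinv c) ?z b"
      by (simp add: vec_deriv_chart[OF smooth_coord[OF Y] c Vc[OF q]] to_chart_E[OF q])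
    also have "\<dots> = fd (\<lambda>z. vf_in_chart M c Y z \<bullet> b') ?z b"
      by (rule fd_cong_open[OF open_Z z]) (auto simp: Z_def ad_simps(3)[OF c Vc] coord_def \<kappa>1)
    also have "\<dots> = fd (vf_in_chart M c Y) ?z b \<bullet> b'"
      by (rule fd_eqI[OF has_derivative_inner_left[OF smooth_on_has_derivative[OF vector_field_chart[OF Y c]]]])
        (use Vc[OF q] in simp)
    finally show ?thesis .
  qed
  have "to_chart M c q (nabla (E b) Y q) = (\<Sum>b'\<in>Basis. (fd (vf_in_chart M c Y) ?z b \<bullet> b') *\<^sub>R b' + (?y \<bullet> b') *\<^sub>R \<Gamma> ?z b b')" for b
    unfolding E D
    by (simp add: linear_sum[OF lt] linear_add[OF lt] linear_scale[OF lt] to_chart_E[OF q] coord_V[OF q] \<Gamma>_def vf_in_chart_at[OF c Vc[OF q]])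
  then have tE: "to_chart M c q (nabla (E b) Y q) = fd (vf_in_chart M c Y) ?z b + (\<Sum>b'\<in>Basis. (?y \<bullet> b') *\<^sub>R \<Gamma> ?z b b')" for b
    by (simp add: sum.distrib euclidean_representation)
  have "nabla X Y q = nabla (\<lambda>q. (\<kappa> q * \<kappa> q) *\<^sub>R X q) Y q"
    by (simp add: nabla_scale1[OF smooth_\<kappa>2 X Y] \<kappa>1 q)
  also have "\<dots> = nabla (\<lambda>q. \<Sum>b\<in>Basis. coord X b q *\<^sub>R E b q) Y q" by (simp only: frame_expansion)
  also have "\<dots> = (\<Sum>b\<in>Basis. nabla (\<lambda>q. coord X b q *\<^sub>R E b q) Y q)"
    by (subst nabla_sum1[OF finite_Basis vector_field_coord_E[OF X] Y]) simp
  also have "\<dots> = (\<Sum>b\<in>Basis. (?x \<bullet> b) *\<^sub>R nabla (E b) Y q)"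
    by (simp only: nabla_scale1[OF smooth_coord[OF X] vf_E Y] coord_V[OF q])
  finally have "to_chart M c q (nabla X Y q) = (\<Sum>b\<in>Basis. (?x \<bullet> b) *\<^sub>R (fd (vf_in_chart M c Y) ?z b + (\<Sum>b'\<in>Basis. (?y \<bullet> b') *\<^sub>R \<Gamma> ?z b b')))"
    by (simp add: linear_sum[OF lt] linear_scale[OF lt] tE)
  also have "\<dots> = (\<Sum>b\<in>Basis. (?x \<bullet> b) *\<^sub>R fd (vf_in_chart M c Y) ?z b)
      + (\<Sum>b\<in>Basis. \<Sum>b'\<in>Basis. ((?x \<bullet> b) * (?y \<bullet> b')) *\<^sub>R \<Gamma> ?z b b')"
    by (simp add: scaleR_add_right sum.distrib scaleR_sum_right)
  also have "(\<Sum>b\<in>Basis. (?x \<bullet> b) *\<^sub>R fd (vf_in_chart M c Y) ?z b) = fd (vf_in_chart M c Y) ?z ?x"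
    by (rule linear_expansion[symmetric], rule linear_fd[OF vector_field_chart[OF Y c]]) (use Vc[OF q] in simp)
  finally show ?thesis .
qed

text \<open>\<open>\<Gamma>\<close> is defined for all vectors separately. Applying the coordinate
  formula to frame fields, whose components have zero derivative, shows that it is determined by
  basis vectors and hence bilinear.\<close>

lemma \<Gamma>_expansion: "z \<in> Z \<Longrightarrow> \<Gamma> z u v = (\<Sum>b\<in>Basis. \<Sum>b'\<in>Basis. ((u \<bullet> b) * (v \<bullet> b')) *\<^sub>R \<Gamma> z b b')"
proof -
  assume "z \<in> Z"
  then obtain q where q: "q \<in> V" "z = cmap c q" by (auto simp: Z_def)
  have "to_chart M c q (nabla (E u) (E v) q) = \<Gamma> z u v"
    by (simp add: \<Gamma>_def q(2) vf_in_chart_at[OF c Vc[OF q(1)]])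
  then show ?thesis
    using nabla_chart[OF vf_E vf_E q(1), of u v] fd_vf_in_chart_E[OF \<open>z \<in> Z\<close>, of v u]
    unfolding to_chart_E[OF q(1)] q(2)[symmetric] by (simp only: add_0)
qed

lemma bilinear_\<Gamma>: "z \<in> Z \<Longrightarrow> bilinear (\<Gamma> z)"
proof -
  assume z: "z \<in> Z"
  have b: "bilinear (\<lambda>u v. \<Sum>b\<in>Basis. \<Sum>b'\<in>Basis. ((u \<bullet> b) * (v \<bullet> b')) *\<^sub>R K b b')" for K :: "'b \<Rightarrow> 'b \<Rightarrow> 'b"
    unfolding bilinear_def
    by (intro conjI allI linearI)
      (simp_all add: inner_add_left distrib_left distrib_right scaleR_add_left sum.distrib scaleR_sum_right mult_ac)
  have e: "\<Gamma> z = (\<lambda>u v. \<Sum>b\<in>Basis. \<Sum>b'\<in>Basis. ((u \<bullet> b) * (v \<bullet> b')) *\<^sub>R \<Gamma> z b b')"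
    by (intro ext) (rule \<Gamma>_expansion[OF z])
  show ?thesis by (subst e) (rule b)
qed

lemma smooth_\<Gamma>: "smooth_on Z (\<lambda>z. \<Gamma> z u v)"
  unfolding \<Gamma>_def by (rule smooth_on_subset[OF vector_field_chart[OF nabla_vf[OF vf_E vf_E] c] Z_sub])

theorem nabla_in_chart:
  assumes "vector_field M X" "vector_field M Y" "q \<in> V"
  shows "to_chart M c q (nabla X Y q) = fd (vf_in_chart M c Y) (cmap c q) (to_chart M c q (X q))
    + \<Gamma> (cmap c q) (to_chart M c q (X q)) (to_chart M c q (Y q))"
proof -
  have "cmap c q \<in> Z" using assms(3) by (simp add: Z_def)
  from \<Gamma>_expansion[OF this, symmetric] show ?thesis unfolding nabla_chart[OF assms] by (simp only:)
qed

end

locale lc_chart = frame_chart +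
  fixes g :: "'a \<Rightarrow> 'b \<Rightarrow> 'b \<Rightarrow> real"
  assumes lc: "levi_civita_connection M g nabla" and metric: "riemannian_metric M g"
begin

definition "G z u v = g (cinv c z) (of_chart M c (cinv c z) u) (of_chart M c (cinv c z) v)"

lemma G_at: "q \<in> V \<Longrightarrow> G (cmap c q) u v = g q (of_chart M c q u) (of_chart M c q v)"
  by (simp add: G_def ad_simps(3)[OF c Vc])

lemma g_G: "q \<in> V \<Longrightarrow> g q u v = G (cmap c q) (to_chart M c q u) (to_chart M c q v)"
  by (simp add: G_at of_to_chart[OF c Vc])

lemma vec_deriv_Z:
  assumes "smooth_fun M f" "q \<in> V" "\<And>p. p \<in> V \<Longrightarrow> f p = h (cmap c p)"
  shows "vec_deriv M f q (E w q) = fd h (cmap c q) w"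
proof -
  have "vec_deriv M f q (E w q) = fd (f \<circ> cinv c) (cmap c q) w"
    by (simp add: vec_deriv_chart[OF assms(1) c Vc[OF assms(2)]] to_chart_E[OF assms(2)])
  also have "\<dots> = fd h (cmap c q) w"
    by (rule fd_cong_open[OF open_Z]) (use assms in \<open>auto simp: Z_def ad_simps(3)[OF c Vc]\<close>)
  finally show ?thesis .
qed

lemma lie_bracket_E:
  assumes X: "vector_field M X" and q: "q \<in> V"
  shows "to_chart M c q (lie_bracket M (E u) X q) = fd (vf_in_chart M c X) (cmap c q) u"
    "to_chart M c q (lie_bracket M X (E u) q) = - fd (vf_in_chart M c X) (cmap c q) u"
proof -
  have z: "cmap c q \<in> Z" using q by (simp add: Z_def)
  show "to_chart M c q (lie_bracket M (E u) X q) = fd (vf_in_chart M c X) (cmap c q) u"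
    "to_chart M c q (lie_bracket M X (E u) q) = - fd (vf_in_chart M c X) (cmap c q) u"
    using lie_bracket_chart[OF vf_E X c Vc[OF q]] lie_bracket_chart[OF X vf_E c Vc[OF q]]
    by (simp_all add: to_chart_E[OF q] fd_vf_in_chart_E[OF z])
qed

lemma lie_bracket_EE: "q \<in> V \<Longrightarrow> lie_bracket M (E u) (E v) q = 0"
proof -
  assume q: "q \<in> V"
  have "cmap c q \<in> Z" using q by (simp add: Z_def)
  then have "to_chart M c q (lie_bracket M (E u) (E v) q) = to_chart M c q 0"
    using lie_bracket_E(1)[OF vf_E q] fd_vf_in_chart_E linear_0[OF linear_to_chart[OF c Vc[OF q]]] by simp
  then show ?thesis using to_chart_inject[OF c Vc[OF q]] by blast
qed

sublocale metric_chart Z G \<Gamma>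
proof
  show "open Z" by (rule open_Z)
  show "smooth_on Z (\<lambda>z. \<Gamma> z u v)" for u v by (rule smooth_\<Gamma>)
  have gp: "bilinear (g p)" "g p u v = g p v u" "u \<noteq> 0 \<Longrightarrow> g p u u > 0" for p u v
    using metric by (auto simp: riemannian_metric_def)
  show "smooth_on Z (\<lambda>z. G z u v)" for u v
  proof -
    have "smooth_on Z ((\<lambda>p. g p (E u p) (E v p)) \<circ> cinv c)"
      by (rule smooth_on_subset[OF smooth_fun_chart[OF metric_smooth_fun[OF metric vf_E vf_E] c] Z_sub])
    moreover have "smooth_on Z ((\<lambda>p. g p (E u p) (E v p)) \<circ> cinv c) \<longleftrightarrow> smooth_on Z (\<lambda>z. G z u v)"
      by (rule smooth_on_cong[OF open_Z]) (auto simp: Z_def ad_simps(3)[OF c Vc] G_at E_V)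
    ultimately show ?thesis by blast
  qed
  fix z assume zZ: "z \<in> Z"
  then obtain q where q: "q \<in> V" "z = cmap c q" by (auto simp: Z_def)
  show "bilinear (\<Gamma> z)" by (rule bilinear_\<Gamma>[OF zZ])
  show "bilinear (G z)"
    unfolding G_def[abs_def] q(2) ad_simps(3)[OF c Vc[OF q(1)]]
    by (rule bilinear_of_chart[OF gp(1) c Vc[OF q(1)]])
  show "G z u v = G z v u" for u v unfolding G_def by (rule gp(2))
  show "G z u u > 0" if "u \<noteq> 0" for u
  proof -
    have "of_chart M c q u \<noteq> 0" using to_of_chart[OF c Vc[OF q(1)], of u] that linear_0[OF linear_to_chart[OF c Vc[OF q(1)]]] by auto
    then show ?thesis using gp(3) by (simp add: q G_at)
  qed
  show "\<Gamma> z u v = \<Gamma> z v u" for u v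
  proof -
    have "nabla (E u) (E v) q - nabla (E v) (E u) q = lie_bracket M (E u) (E v) q"
      using lc vf_E unfolding levi_civita_connection_def by blast
    then have "nabla (E u) (E v) q = nabla (E v) (E u) q" by (simp add: lie_bracket_EE[OF q(1)])
    then show ?thesis by (simp add: \<Gamma>_def q vf_in_chart_at[OF c Vc[OF q(1)]])
  qed
  show "fd (\<lambda>z. G z u v) z w = G z (\<Gamma> z w u) v + G z u (\<Gamma> z w v)" for u v w
  proof -
    have "vec_deriv M (\<lambda>q. g q (E u q) (E v q)) q (E w q) = g q (nabla (E w) (E u) q) (E v q) + g q (E u q) (nabla (E w) (E v) q)"
      using lc vf_E unfolding levi_civita_connection_def by blast
    moreover have "vec_deriv M (\<lambda>q. g q (E u q) (E v q)) q (E w q) = fd (\<lambda>z. G z u v) (cmap c q) w"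
      by (rule vec_deriv_Z[OF metric_smooth_fun[OF metric vf_E vf_E] q(1)]) (simp add: G_at E_V)
    ultimately show ?thesis
      using q(1) by (simp add: q(2) g_G to_chart_E \<Gamma>_def vf_in_chart_at[OF c Vc])
  qed
qed

end

section \<open>Orthogonal distributions\<close>

text \<open>Gram-Schmidt with respect to an arbitrary inner product \<open>g\<close> in place of the
  one of the type. Here \<open>e\<close> is the part of the new vector \<open>b\<close> orthogonal
  to the previous ones; if it is 0, the correction to \<open>pu\<close> vanishes.\<close>

lemma orth_decomposition_span:
  fixes g :: "'e::real_vector \<Rightarrow> 'e \<Rightarrow> real"
  assumes g: "bilinear g" "\<And>u v. g u v = g v u" "\<And>u. u \<noteq> 0 \<Longrightarrow> g u u > 0" and "finite B"
  shows "\<exists>w\<in>span B. \<forall>v\<in>span B. g (u - w) v = 0"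
  using assms(4)
proof (induction B arbitrary: u rule: finite_induct)
  case empty
  have "linear (g u)" for u using g(1) by (simp add: bilinear_def)
  then show ?case by (simp add: linear_0)
next
  case (insert b B)
  have lg: "linear (\<lambda>u. g u v)" "linear (g u)" for u v using g(1) by (auto simp: bilinear_def)
  obtain pb where pb: "pb \<in> span B" "\<And>v. v \<in> span B \<Longrightarrow> g (b - pb) v = 0" using insert.IH by blast
  obtain pu where pu: "pu \<in> span B" "\<And>v. v \<in> span B \<Longrightarrow> g (u - pu) v = 0" using insert.IH by blast
  define e where "e = b - pb"
  define w where "w = pu + (g (u - pu) e / g e e) *\<^sub>R e"
  have sub: "span B \<subseteq> span (insert b B)" by (rule span_mono) auto
  have e: "e \<in> span (insert b B)" unfolding e_def using pb sub by (intro span_diff) (auto intro: span_base)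
  have "w \<in> span (insert b B)" unfolding w_def using pu sub e by (intro span_add span_scale) auto
  moreover have "g (u - w) v = 0" if v: "v \<in> span (insert b B)" for v
  proof -
    obtain k where k: "v - k *\<^sub>R b \<in> span B" using v by (auto simp: span_insert)
    have eq: "v - k *\<^sub>R e = (v - k *\<^sub>R b) + k *\<^sub>R pb" by (simp add: e_def algebra_simps)
    have s: "v - k *\<^sub>R e \<in> span B" unfolding eq by (intro span_add span_scale k pb(1))
    have 1: "g (u - w) s = 0" if "s \<in> span B" for s
      using pu(2)[OF that] pb(2)[OF that]
      by (simp add: w_def e_def linear_diff[OF lg(1)] linear_add[OF lg(1)] linear_scale[OF lg(1)])
    have 2: "g (u - w) e = 0"
    proof (cases "e = 0")
      case False
      then have "g e e \<noteq> 0" using g(3) by (metis less_irrefl)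
      then show ?thesis
        by (simp add: w_def linear_diff[OF lg(1)] linear_add[OF lg(1)] linear_scale[OF lg(1)])
    qed (simp add: linear_0[OF lg(2)])
    have "v = (v - k *\<^sub>R e) + k *\<^sub>R e" by simp
    then have "g (u - w) v = g (u - w) (v - k *\<^sub>R e) + k * g (u - w) e"
      by (metis linear_add[OF lg(2)] linear_scale[OF lg(2)] real_scaleR_def)
    then show ?thesis using 1[OF s] 2 by simp
  qed
  ultimately show ?case by blast
qed

lemma subspace_orth_complement:
  assumes "bilinear (g p)" shows "subspace (orth_complement g D p)"
proof -
  have lg: "linear (\<lambda>u. g p u v)" for v using assms by (auto simp: bilinear_def)
  show ?thesis
    by (auto simp: subspace_def orth_complement_def linear_0[OF lg] linear_add[OF lg] linear_scale[OF lg])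
qed

locale orth_splitting =
  fixes g :: "'a \<Rightarrow> 'e::euclidean_space \<Rightarrow> 'e \<Rightarrow> real" and D :: "'a \<Rightarrow> 'e set" and p :: 'a
  assumes g: "bilinear (g p)" "\<And>u v. g p u v = g p v u" "\<And>u. u \<noteq> 0 \<Longrightarrow> g p u u > 0"
    and D: "subspace (D p)"
begin

lemma C: "subspace (orth_complement g D p)"
  by (rule subspace_orth_complement) (rule g(1))

lemma lg: "linear (\<lambda>u. g p u v)" "linear (g p u)" using g(1) by (auto simp: bilinear_def)

lemma orth_inter: "u \<in> D p \<Longrightarrow> u \<in> orth_complement g D p \<Longrightarrow> u = 0"
  using g(3) unfolding orth_complement_def by (metis (mono_tags, lifting) less_irrefl mem_Collect_eq)

lemma orth_proj_eqI:
  assumes "w \<in> D p" "u - w \<in> orth_complement g D p"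
  shows "orth_proj g D p u = w"
  unfolding orth_proj_def
proof (rule the_equality)
  show "w \<in> D p \<and> u - w \<in> orth_complement g D p" using assms by blast
  fix w' assume w': "w' \<in> D p \<and> u - w' \<in> orth_complement g D p"
  then have "w - w' \<in> D p" using assms(1) D by (simp add: subspace_diff)
  moreover have "(u - w') - (u - w) \<in> orth_complement g D p"
    by (rule subspace_diff[OF C]) (use w' assms in auto)
  then have "w - w' \<in> orth_complement g D p" by simp
  ultimately show "w' = w" using orth_inter[of "w - w'"] by simp
qed

lemma orth_proj: "orth_proj g D p u \<in> D p" "u - orth_proj g D p u \<in> orth_complement g D p"
proof -
  obtain B where B: "finite B" "span B = D p"
    using basis_exists[of "D p"] D by (metis independent_imp_finite span_minimal subset_antisym)
  from orth_decomposition_span[OF g B(1), of u]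
  obtain w where "w \<in> D p" "u - w \<in> orth_complement g D p"
    unfolding B(2) by (auto simp: orth_complement_def)
  then show "orth_proj g D p u \<in> D p" "u - orth_proj g D p u \<in> orth_complement g D p"
    using orth_proj_eqI by metis+
qed

lemma orth_proj_id: "u \<in> D p \<Longrightarrow> orth_proj g D p u = u"
  by (rule orth_proj_eqI) (auto simp: orth_complement_def linear_0[OF lg(1)])

lemma orth_proj_0: "u \<in> orth_complement g D p \<Longrightarrow> orth_proj g D p u = 0"
  by (rule orth_proj_eqI) (auto simp: subspace_0[OF D])

lemma linear_orth_proj: "linear (orth_proj g D p)"
proof (rule linearI; rule orth_proj_eqI)
  fix u v r
  show "orth_proj g D p u + orth_proj g D p v \<in> D p" by (rule subspace_add[OF D orth_proj(1) orth_proj(1)])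
  show "r *\<^sub>R orth_proj g D p u \<in> D p" by (rule subspace_scale[OF D orth_proj(1)])
  have "(u - orth_proj g D p u) + (v - orth_proj g D p v) \<in> orth_complement g D p"
    by (rule subspace_add[OF C orth_proj(2) orth_proj(2)])
  then show "u + v - (orth_proj g D p u + orth_proj g D p v) \<in> orth_complement g D p" by (simp add: algebra_simps)
  have "r *\<^sub>R (u - orth_proj g D p u) \<in> orth_complement g D p" by (rule subspace_scale[OF C orth_proj(2)])
  then show "r *\<^sub>R u - r *\<^sub>R orth_proj g D p u \<in> orth_complement g D p" by (simp add: algebra_simps)
qed

lemma orth_proj_complement: "orth_proj g (orth_complement g D) p u = u - orth_proj g D p u"
proof -
  interpret C: orth_splitting g "orth_complement g D" p
    by unfold_locales (use g C in auto)
  show ?thesis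
    by (rule C.orth_proj_eqI[OF orth_proj(2)])
      (use orth_proj(1)[of u] in \<open>auto simp: orth_complement_def g(2)\<close>)
qed

lemma orth_proj_adjoint: "g p (orth_proj g D p u) v = g p u (orth_proj g D p v)"
proof -
  have 0: "g p (u - orth_proj g D p u) (orth_proj g D p v) = 0" for u v
    using orth_proj by (simp add: orth_complement_def)
  have "g p (orth_proj g D p u) v = g p (orth_proj g D p u) (orth_proj g D p v) + g p (v - orth_proj g D p v) (orth_proj g D p u)"
    using g(2)[of "orth_proj g D p u" v] g(2)[of "orth_proj g D p v" "orth_proj g D p u"]
    by (simp add: linear_diff[OF lg(1)])
  also have "\<dots> = g p u (orth_proj g D p v)"
    using 0[of u v] 0[of v u] by (simp add: linear_diff[OF lg(1)])
  finally show ?thesis .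
qed

lemma dim_orth: "dim (D p) + dim (orth_complement g D p) = DIM('e)"
proof -
  have "{x + y |x y. x \<in> D p \<and> y \<in> orth_complement g D p} = UNIV"
  proof -
    have "u \<in> {x + y |x y. x \<in> D p \<and> y \<in> orth_complement g D p}" for u
    proof -
      have "u = orth_proj g D p u + (u - orth_proj g D p u)" by simp
      then show ?thesis using orth_proj[of u] by blast
    qed
    then show ?thesis by auto
  qed
  moreover have "D p \<inter> orth_complement g D p = {0}" using orth_inter subspace_0[OF D] subspace_0[OF C] by auto
  ultimately show ?thesis using dim_sums_Int[OF D C] by simp
qed

end

section \<open>Endomorphism fields and product metrics in a chart\<close>

text \<open>Smoothness is phrased through the action on fields, since this is the form in which it
  can be shown for the orthogonal projections, which are given by a description and not by
  components.\<close>

definition (in smooth_mfd) smooth_endo :: "('a \<Rightarrow> 'e \<Rightarrow> 'e) \<Rightarrow> bool" where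
  "smooth_endo K \<longleftrightarrow> (\<forall>p. linear (K p)) \<and> (\<forall>X. vector_field M X \<longrightarrow> vector_field M (\<lambda>p. K p (X p)))"

context lc_chart
begin

definition "loc K z u = to_chart M c (cinv c z) (K (cinv c z) (of_chart M c (cinv c z) u))"

lemma loc_at: "q \<in> V \<Longrightarrow> loc K (cmap c q) u = to_chart M c q (K q (of_chart M c q u))"
  by (simp add: loc_def ad_simps(3)[OF c Vc])

lemma to_chart_loc: "q \<in> V \<Longrightarrow> to_chart M c q (K q u) = loc K (cmap c q) (to_chart M c q u)"
  by (simp add: loc_at of_to_chart[OF c Vc])

lemma vf_in_chart_loc: "z \<in> Z \<Longrightarrow> vf_in_chart M c (\<lambda>p. K p (X p)) z = loc K z (vf_in_chart M c X z)"
  by (auto simp: Z_def vf_in_chart_at[OF c Vc] to_chart_loc)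

lemma linear_loc: "smooth_endo K \<Longrightarrow> z \<in> Z \<Longrightarrow> linear (loc K z)"
proof -
  assume K: "smooth_endo K" and "z \<in> Z"
  then obtain q where q: "q \<in> V" "z = cmap c q" by (auto simp: Z_def)
  have "linear (K q)" using K by (simp add: smooth_endo_def)
  from linear_compose[OF linear_compose[OF linear_of_chart[OF c Vc[OF q(1)]] this] linear_to_chart[OF c Vc[OF q(1)]]]
  show ?thesis by (simp add: o_def q(2) loc_at[OF q(1), abs_def])
qed

lemma smooth_loc: "smooth_endo K \<Longrightarrow> smooth_on Z (\<lambda>z. loc K z u)"
proof -
  assume K: "smooth_endo K"
  have "vector_field M (\<lambda>p. K p (E u p))" using K vf_E by (simp add: smooth_endo_def)
  then have "smooth_on Z (vf_in_chart M c (\<lambda>p. K p (E u p)))"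
    using smooth_on_subset[OF vector_field_chart[OF _ c] Z_sub] by blast
  moreover have "smooth_on Z (vf_in_chart M c (\<lambda>p. K p (E u p))) \<longleftrightarrow> smooth_on Z (\<lambda>z. loc K z u)"
    by (rule smooth_on_cong[OF open_Z]) (simp add: vf_in_chart_loc vf_in_chart_E)
  ultimately show ?thesis by blast
qed

lemma fd_loc:
  assumes K: "smooth_endo K" and X: "vector_field M X" and z: "z \<in> Z"
  shows "fd (vf_in_chart M c (\<lambda>p. K p (X p))) z w =
    fd (\<lambda>y. loc K y (vf_in_chart M c X z)) z w + loc K z (fd (vf_in_chart M c X) z w)"
proof -
  have "fd (vf_in_chart M c (\<lambda>p. K p (X p))) z w = fd (\<lambda>y. loc K y (vf_in_chart M c X y)) z w"
    by (rule fd_cong_open[OF open_Z z]) (rule vf_in_chart_loc)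
  also have "\<dots> = fd (\<lambda>y. loc K y (vf_in_chart M c X z)) z w + loc K z (fd (vf_in_chart M c X) z w)"
    by (rule fd_linear_apply[OF open_Z z linear_loc[OF K] smooth_loc[OF K]
          smooth_on_subset[OF vector_field_chart[OF X c] Z_sub]])
  finally show ?thesis .
qed

text \<open>Turns parallelism in coordinates into commutation with the global operator
  \<open>nabla\<close>; \<open>parallel_endoI\<close> is the way back, by testing on the frame
  fields.\<close>

lemma nabla_parallel:
  assumes K: "smooth_endo K" "parallel_endo (loc K)" and X: "vector_field M X" and Y: "vector_field M Y" and q: "q \<in> V"
  shows "nabla X (\<lambda>p. K p (Y p)) q = K q (nabla X Y q)"
proof -
  have z: "cmap c q \<in> Z" using q by (simp add: Z_def)
  have KY: "vector_field M (\<lambda>p. K p (Y p))" using K(1) Y by (simp add: smooth_endo_def)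
  have D: "fd (\<lambda>y. loc K y u) (cmap c q) w = loc K (cmap c q) (\<Gamma> (cmap c q) w u) - \<Gamma> (cmap c q) w (loc K (cmap c q) u)" for u w
    using K(2) z by (simp add: parallel_endo_def)
  have "to_chart M c q (nabla X (\<lambda>p. K p (Y p)) q) = to_chart M c q (K q (nabla X Y q))"
    unfolding to_chart_loc[OF q] nabla_in_chart[OF X KY q] nabla_in_chart[OF X Y q] fd_loc[OF K(1) Y z] D
    by (simp add: linear_add[OF linear_loc[OF K(1) z]] vf_in_chart_at[OF c Vc[OF q]])
  then show ?thesis using to_chart_inject[OF c Vc[OF q]] by blast
qed

lemma parallel_endoI:
  assumes K: "smooth_endo K"
    and par: "\<And>X Y q. vector_field M X \<Longrightarrow> vector_field M Y \<Longrightarrow> nabla X (\<lambda>p. K p (Y p)) q = K q (nabla X Y q)"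
  shows "parallel_endo (loc K)"
  unfolding parallel_endo_def
proof (intro conjI ballI allI)
  fix z u w assume z: "z \<in> Z"
  then obtain q where q: "q \<in> V" "z = cmap c q" by (auto simp: Z_def)
  have KY: "vector_field M (\<lambda>p. K p (E u p))" using K vf_E by (simp add: smooth_endo_def)
  have "to_chart M c q (nabla (E w) (\<lambda>p. K p (E u p)) q) = to_chart M c q (K q (nabla (E w) (E u) q))"
    by (simp add: par[OF vf_E vf_E])
  then have "fd (\<lambda>y. loc K y u) z w + \<Gamma> z w (loc K z u) = loc K z (\<Gamma> z w u)"
    unfolding to_chart_loc[OF q(1)] nabla_in_chart[OF vf_E KY q(1)] nabla_in_chart[OF vf_E vf_E q(1)]
      q(2)[symmetric] fd_loc[OF K vf_E z] fd_vf_in_chart_E[OF z] vf_in_chart_E[OF z] to_chart_E[OF q(1)]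
    by (simp add: linear_0[OF linear_loc[OF K z]])
  then show "fd (\<lambda>z. loc K z u) z w = loc K z (\<Gamma> z w u) - \<Gamma> z w (loc K z u)" by (simp add: algebra_simps)
qed (use linear_loc[OF K] smooth_loc[OF K] in auto)

end

lemma (in metric_chart) koszul:
  assumes z: "z \<in> S"
  shows "2 * G z (\<Gamma> z u v) w = fd (\<lambda>z. G z v w) z u + fd (\<lambda>z. G z u w) z v - fd (\<lambda>z. G z u v) z w"
  using sym\<Gamma>[OF z, of u v] sym\<Gamma>[OF z, of u w] sym\<Gamma>[OF z, of v w] symG[OF z]
  by (simp add: compat[OF z])

lemma fd_zero_along:
  fixes f :: "'e::real_normed_vector \<Rightarrow> real"
  assumes "open S" "smooth_on S f" "z \<in> S" "\<And>t. z + t *\<^sub>R w \<in> S \<Longrightarrow> f (z + t *\<^sub>R w) = f z"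
  shows "fd f z w = 0"
proof -
  have "((\<lambda>t. f (z + t *\<^sub>R w)) has_real_derivative fd f (z + 0 *\<^sub>R w) w) (at 0)"
    by (rule DERIV_along_line[OF assms(2)]) (simp add: assms(3))
  moreover have "open ((\<lambda>t::real. z + t *\<^sub>R w) -` S)"
    by (rule open_vimage[OF assms(1)]) (intro continuous_intros)
  then have "((\<lambda>t. f (z + t *\<^sub>R w)) has_real_derivative 0) (at 0)"
    by (intro has_field_derivative_transform_within_open[OF DERIV_const[of "f z"]]) (use assms in auto)
  ultimately show ?thesis using DERIV_unique by fastforce
qed

text \<open>By the Koszul formula, the component of \<open>\<Gamma> z x y\<close> along the kernel
  of \<open>\<pi>\<close> is a sum of derivatives of mixed components, which are identically 0, and
  of derivatives of one factor's metric in the direction of the other factor, which vanish as well.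
  So \<open>\<Gamma> z x y\<close> is orthogonal to the kernel and lies in the range.\<close>

lemma (in metric_chart) product_metric_Christoffel:
  assumes \<pi>: "linear \<pi>" "\<And>x. \<pi> (\<pi> x) = \<pi> x"
    and G: "\<And>z u v. z \<in> S \<Longrightarrow> G z u v = h1 (\<pi> z) (\<pi> u) (\<pi> v) + h2 (z - \<pi> z) (u - \<pi> u) (v - \<pi> v)"
    and h1: "\<And>z u. z \<in> S \<Longrightarrow> h1 (\<pi> z) (\<pi> u) 0 = 0" "\<And>z u. z \<in> S \<Longrightarrow> h1 (\<pi> z) 0 (\<pi> u) = 0"
    and h2: "\<And>z u. z \<in> S \<Longrightarrow> h2 (z - \<pi> z) (u - \<pi> u) 0 = 0" "\<And>z u. z \<in> S \<Longrightarrow> h2 (z - \<pi> z) 0 (u - \<pi> u) = 0"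
    and z: "z \<in> S" and y: "\<pi> y = y"
  shows "\<pi> (\<Gamma> z x y) = \<Gamma> z x y"
proof -
  note l = linear_add[OF \<pi>(1)] linear_scale[OF \<pi>(1)] linear_diff[OF \<pi>(1)] linear_0[OF \<pi>(1)]
  have h0: "h1 (\<pi> z) 0 0 = 0" "h2 (z - \<pi> z) 0 0 = 0" if "z \<in> S" for z
    using h1(1)[OF that, of 0] h2(1)[OF that, of 0] by (simp_all add: l)
  have cross: "G z u v = 0" if "z \<in> S" "\<pi> u = u" "\<pi> v = 0" for z u v
    using h1(1)[OF that(1), of u] h2(2)[OF that(1), of v] that by (simp add: G)
  have dcross: "fd (\<lambda>z. G z u v) z w = 0" "fd (\<lambda>z. G z v u) z w = 0" if "\<pi> u = u" "\<pi> v = 0" for u v w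
  proof -
    have "fd (\<lambda>z. G z u v) z w = fd (\<lambda>z. 0) z w"
      by (rule fd_cong_open[OF open_S z]) (rule cross[OF _ that])
    then show "fd (\<lambda>z. G z u v) z w = 0" by simp
    have "fd (\<lambda>z. G z v u) z w = fd (\<lambda>z. 0) z w"
      by (rule fd_cong_open[OF open_S z]) (simp add: symG[of _ v u] cross[OF _ that])
    then show "fd (\<lambda>z. G z v u) z w = 0" by simp
  qed
  have dQ: "fd (\<lambda>z. G z u v) z w = 0" if "\<pi> u = u" "\<pi> v = v" "\<pi> w = 0" for u v w
  proof (rule fd_zero_along[OF open_S smG z])
    fix t assume t: "z + t *\<^sub>R w \<in> S"
    show "G (z + t *\<^sub>R w) u v = G z u v"
      using h0(2)[OF t] by (simp add: G z t that l h0)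
  qed
  have dP: "fd (\<lambda>z. G z u v) z w = 0" if "\<pi> u = 0" "\<pi> v = 0" "\<pi> w = w" for u v w
  proof (rule fd_zero_along[OF open_S smG z])
    fix t assume t: "z + t *\<^sub>R w \<in> S"
    have "z + t *\<^sub>R w - (\<pi> z + t *\<^sub>R w) = z - \<pi> z" by simp
    then show "G (z + t *\<^sub>R w) u v = G z u v"
      using h0(1)[OF t] by (simp add: G z t that l h0)
  qed
  have PP: "G z (\<Gamma> z x y) w = 0" if x: "\<pi> x = x" and w: "\<pi> w = 0" for x w
    using koszul[OF z, of x y w] dcross(1)[OF y w] dcross(1)[OF x w] dQ[OF x y w] by simp
  have QP: "G z (\<Gamma> z x y) w = 0" if x: "\<pi> x = 0" and w: "\<pi> w = 0" for x w
    using koszul[OF z, of x y w] dcross(1)[OF y w] dP[OF x w y] dcross(2)[OF y x] by simp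
  have r: "G z (\<Gamma> z x y) w = 0" if w: "\<pi> w = 0" for w
  proof -
    have "\<Gamma> z x y = \<Gamma> z (\<pi> x) y + \<Gamma> z (x - \<pi> x) y" by (simp add: \<Gamma>simps z)
    then show ?thesis using PP[OF \<pi>(2) w, of x] QP[OF _ w, of "x - \<pi> x"] by (simp add: Gsimps z l \<pi>(2))
  qed
  define b where "b = \<Gamma> z x y - \<pi> (\<Gamma> z x y)"
  have b: "\<pi> b = 0" by (simp add: b_def l \<pi>(2))
  have "G z (\<pi> (\<Gamma> z x y)) b = 0" by (rule cross[OF z \<pi>(2) b])
  then have "G z b b = 0" using r[OF b] b_def Gsimps(3)[OF z, of "\<Gamma> z x y" "\<pi> (\<Gamma> z x y)" b] by simp
  then have "b = 0" using posG[OF z] by (metis less_irrefl)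
  then show ?thesis by (simp add: b_def)
qed

section \<open>Cosymplectic manifolds\<close>

locale cosymplectic_mfd = mfd_connection +
  fixes \<phi> :: "'a \<Rightarrow> 'b \<Rightarrow> 'b" and \<xi> :: "'a \<Rightarrow> 'b" and \<eta> :: "'a \<Rightarrow> 'b \<Rightarrow> real" and g :: "'a \<Rightarrow> 'b \<Rightarrow> 'b \<Rightarrow> real"
  assumes cos: "cosymplectic M \<phi> \<xi> \<eta> g" and lc: "levi_civita_connection M g nabla"
begin

lemma acm: "almost_contact_metric M \<phi> \<xi> \<eta> g" using cos by (simp add: cosymplectic_def)

lemma metric: "riemannian_metric M g" using acm by (simp add: almost_contact_metric_def)

lemma g: "bilinear (g p)" "g p u v = g p v u" "u \<noteq> 0 \<Longrightarrow> g p u u > 0"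
  using metric by (auto simp: riemannian_metric_def)

lemma lin_g: "linear (\<lambda>u. g p u v)" "linear (g p u)" using g(1)[of p] by (auto simp: bilinear_def)

lemma vf_\<xi>: "vector_field M \<xi>" using acm by (simp add: almost_contact_metric_def)

lemma \<phi>_tensor: "tensor_field_11 M \<phi>" using acm by (simp add: almost_contact_metric_def)

lemma lin_\<phi>: "linear (\<phi> p)" using \<phi>_tensor by (simp add: tensor_field_11_def)

lemma lin_\<eta>: "linear (\<eta> p)" using acm by (simp add: almost_contact_metric_def one_form_def)

lemma endo_\<phi>: "smooth_endo \<phi>" using tensor_vector_field[OF \<phi>_tensor] lin_\<phi> by (simp add: smooth_endo_def)

lemma vf_\<phi>: "vector_field M X \<Longrightarrow> vector_field M (\<lambda>p. \<phi> p (X p))"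
  by (rule tensor_vector_field[OF \<phi>_tensor])

lemma contact: "\<phi> p (\<phi> p u) = - u + \<eta> p u *\<^sub>R \<xi> p" "\<phi> p (\<xi> p) = 0" "\<eta> p (\<phi> p u) = 0" "\<eta> p (\<xi> p) = 1"
  "g p (\<phi> p u) (\<phi> p v) = g p u v - \<eta> p u * \<eta> p v" "\<eta> p u = g p u (\<xi> p)"
proof -
  have "\<phi> p (\<phi> p u) = - u + \<eta> p u *\<^sub>R \<xi> p \<and> \<phi> p (\<xi> p) = 0 \<and> \<eta> p (\<phi> p u) = 0 \<and> \<eta> p (\<xi> p) = 1 \<and>
        g p (\<phi> p u) (\<phi> p v) = g p u v - \<eta> p u * \<eta> p v \<and> \<eta> p u = g p u (\<xi> p)"
    using acm unfolding almost_contact_metric_def by blast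
  then show "\<phi> p (\<phi> p u) = - u + \<eta> p u *\<^sub>R \<xi> p" "\<phi> p (\<xi> p) = 0" "\<eta> p (\<phi> p u) = 0" "\<eta> p (\<xi> p) = 1"
    "g p (\<phi> p u) (\<phi> p v) = g p u v - \<eta> p u * \<eta> p v" "\<eta> p u = g p u (\<xi> p)" by auto
qed

lemma compat: "vector_field M X \<Longrightarrow> vector_field M Y \<Longrightarrow> vector_field M Z \<Longrightarrow>
    vec_deriv M (\<lambda>q. g q (Y q) (Z q)) p (X p) = g p (nabla X Y p) (Z p) + g p (Y p) (nabla X Z p)"
  using lc unfolding levi_civita_connection_def by blast

lemma frame_at:
  assumes "ad c" "p \<in> cdom c"
  obtains V \<kappa> where "lc_chart M nabla c V \<kappa> g" "p \<in> V"
proof -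
  obtain \<kappa> V where k: "open V" "p \<in> V" "V \<subseteq> cdom c" "\<And>q. q \<in> V \<Longrightarrow> \<kappa> q = 1"
    "\<And>q. q \<notin> cdom c \<Longrightarrow> \<kappa> q = (0::real)"
    "\<And>f. smooth_on (cmap c ` cdom c) f \<Longrightarrow> smooth_fun M (\<lambda>q. \<kappa> q * f (cmap c q))"
    "\<And>y. smooth_on (cmap c ` cdom c) y \<Longrightarrow> vector_field M (\<lambda>q. \<kappa> q *\<^sub>R of_chart M c q (y (cmap c q)))"
    by (rule cutoff[OF assms]) blast
  have "lc_chart M nabla c V \<kappa> g"
    by unfold_locales (fact assms k lc metric)+
  then show thesis using that k(2) by blast
qed

end

locale cosym_chart = cosymplectic_mfd M nabla \<phi> \<xi> \<eta> g + lc_chart M nabla c V \<kappa> g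
  for M :: "('a::{t2_space, second_countable_topology}, 'e::euclidean_space) chart set"
    and nabla \<phi> \<xi> \<eta> g c V \<kappa>
begin

definition "\<eta>c z u = \<eta> (cinv c z) (of_chart M c (cinv c z) u)"

lemma \<eta>c_at: "q \<in> V \<Longrightarrow> \<eta>c (cmap c q) u = \<eta> q (of_chart M c q u)"
  by (simp add: \<eta>c_def ad_simps(3)[OF c Vc])

lemma fd_vf_\<phi>E: "z \<in> Z \<Longrightarrow> fd (vf_in_chart M c (\<lambda>p. \<phi> p (E u p))) z w = fd (\<lambda>z. loc \<phi> z u) z w"
  by (rule fd_cong_open[OF open_Z]) (simp_all add: vf_in_chart_loc vf_in_chart_E)

text \<open>The invariant conditions are evaluated on the frame fields. Their brackets vanish on
  \<open>V\<close>, so the exterior derivatives and the Nijenhuis tensor reduce to partial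
  derivatives.\<close>

sublocale cosymplectic_chart Z G \<Gamma> "loc \<phi>" "vf_in_chart M c \<xi>" \<eta>c
proof (intro cosymplectic_chart.intro cosymplectic_chart_axioms.intro)
  show "metric_chart Z G \<Gamma>" by (rule metric_chart_axioms)
  show "linear (loc \<phi> z)" if "z \<in> Z" for z by (rule linear_loc[OF endo_\<phi> that])
  show "smooth_on Z (\<lambda>z. loc \<phi> z u)" for u by (rule smooth_loc[OF endo_\<phi>])
  show "smooth_on Z (vf_in_chart M c \<xi>)" by (rule smooth_on_subset[OF vector_field_chart[OF vf_\<xi> c] Z_sub])
  fix z assume zZ: "z \<in> Z"
  then obtain q where q: "q \<in> V" "z = cmap c q" by (auto simp: Z_def)
  have lt: "linear (to_chart M c q)" by (rule linear_to_chart[OF c Vc[OF q(1)]])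
  note s = q(2) loc_at[OF q(1)] \<eta>c_at[OF q(1)] G_at[OF q(1)] vf_in_chart_at[OF c Vc[OF q(1)]]
    of_to_chart[OF c Vc[OF q(1)]] to_of_chart[OF c Vc[OF q(1)]]
  show "loc \<phi> z (loc \<phi> z u) = - u + \<eta>c z u *\<^sub>R vf_in_chart M c \<xi> z" for u
    by (simp add: s contact(1) linear_add[OF lt] linear_diff[OF lt] linear_scale[OF lt])
  show "loc \<phi> z (vf_in_chart M c \<xi> z) = 0" by (simp add: s contact linear_0[OF lt])
  show "\<eta>c z (loc \<phi> z u) = 0" for u by (simp add: s contact(3))
  show "\<eta>c z (vf_in_chart M c \<xi> z) = 1" by (simp add: s contact(4))
  show "G z (loc \<phi> z u) (loc \<phi> z v) = G z u v - \<eta>c z u * \<eta>c z v" for u v by (simp add: s contact(5))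
  show "\<eta>c z u = G z u (vf_in_chart M c \<xi> z)" for u by (simp add: s contact(6))
  have vfE: "vector_field M (E u)" "vector_field M (\<lambda>p. \<phi> p (E u p))" for u using vf_E vf_\<phi> by blast+
  show "fd (\<lambda>z. \<eta>c z v) z u = fd (\<lambda>z. \<eta>c z u) z v" for u v
  proof -
    have "smooth_fun M (\<lambda>q. \<eta> q (E v q))" for v
      using metric_smooth_fun[OF metric vfE(1) vf_\<xi>] by (simp add: contact(6))
    then have 1: "vec_deriv M (\<lambda>q. \<eta> q (E v q)) q (E u q) = fd (\<lambda>z. \<eta>c z v) z u" for u v
      unfolding q(2) by (rule vec_deriv_Z[OF _ q(1)]) (simp add: \<eta>c_at E_V)
    have "d_one_form M \<eta> (E u) (E v) q = 0" using cos vfE(1) unfolding cosymplectic_def by blast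
    then show ?thesis by (simp add: d_one_form_def 1 lie_bracket_EE[OF q(1)] linear_0[OF lin_\<eta>])
  qed
  show "fd (\<lambda>z. G z v (loc \<phi> z w)) z u + fd (\<lambda>z. G z w (loc \<phi> z u)) z v + fd (\<lambda>z. G z u (loc \<phi> z v)) z w = 0" for u v w
  proof -
    have 1: "vec_deriv M (\<lambda>q. g q (E v q) (\<phi> q (E w q))) q (E u q) = fd (\<lambda>z. G z v (loc \<phi> z w)) z u" for u v w
      unfolding q(2)
      by (rule vec_deriv_Z[OF metric_smooth_fun[OF metric vfE] q(1)])
        (simp add: G_at E_V loc_at of_to_chart[OF c Vc])
    have "d_two_form M (\<lambda>q u v. g q u (\<phi> q v)) (E u) (E v) (E w) q = 0"
      using cos vfE(1) unfolding cosymplectic_def by blast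
    then show ?thesis
      by (simp add: d_two_form_def 1 lie_bracket_EE[OF q(1)] linear_0[OF lin_g(1)])
  qed
  show "fd (\<lambda>z. loc \<phi> z v) z (loc \<phi> z u) - fd (\<lambda>z. loc \<phi> z u) z (loc \<phi> z v)
       + loc \<phi> z (fd (\<lambda>z. loc \<phi> z u) z v) - loc \<phi> z (fd (\<lambda>z. loc \<phi> z v) z u) = 0" for u v
  proof -
    have "nijenhuis M \<phi> (E u) (E v) q + (2 * d_one_form M \<eta> (E u) (E v) q) *\<^sub>R \<xi> q = 0"
      using cos vfE(1) unfolding cosymplectic_def normal_structure_def by blast
    moreover have "d_one_form M \<eta> (E u) (E v) q = 0" using cos vfE(1) unfolding cosymplectic_def by blast
    ultimately have "nijenhuis M \<phi> (E u) (E v) q = 0" by simp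
    then have "to_chart M c q (nijenhuis M \<phi> (E u) (E v) q) = 0" by (simp add: linear_0[OF lt])
    moreover have "to_chart M c q (lie_bracket M (\<lambda>q. \<phi> q (E u q)) (\<lambda>q. \<phi> q (E v q)) q) =
        fd (\<lambda>z. loc \<phi> z v) z (loc \<phi> z u) - fd (\<lambda>z. loc \<phi> z u) z (loc \<phi> z v)"
      unfolding lie_bracket_chart[OF vfE(2) vfE(2) c Vc[OF q(1)]] q(2)[symmetric] fd_vf_\<phi>E[OF zZ]
      by (simp add: to_chart_loc[OF q(1)] to_chart_E[OF q(1)] q(2))
    moreover have "to_chart M c q (lie_bracket M (\<lambda>q. \<phi> q (E u q)) (E v) q) = - fd (\<lambda>z. loc \<phi> z u) z v"
      unfolding lie_bracket_E(2)[OF vfE(2) q(1)] q(2)[symmetric] fd_vf_\<phi>E[OF zZ] ..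
    moreover have "to_chart M c q (lie_bracket M (E u) (\<lambda>q. \<phi> q (E v q)) q) = fd (\<lambda>z. loc \<phi> z v) z u"
      unfolding lie_bracket_E(1)[OF vfE(2) q(1)] q(2)[symmetric] fd_vf_\<phi>E[OF zZ] ..
    ultimately show ?thesis
      by (simp add: nijenhuis_def lie_bracket_EE[OF q(1)] linear_0[OF lin_\<phi>] linear_add[OF lt] linear_diff[OF lt]
          to_chart_loc[OF q(1)] q(2)[symmetric] linear_neg[OF linear_loc[OF endo_\<phi> zZ]])
  qed
qed

end

context cosymplectic_mfd
begin

lemma nabla_\<phi>_\<xi>:
  assumes X: "vector_field M X"
  shows "vector_field M Y \<Longrightarrow> nabla X (\<lambda>p. \<phi> p (Y p)) q = \<phi> q (nabla X Y q)" "nabla X \<xi> q = 0"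
proof -
  define c where "c = chart_at M q"
  have cp: "ad c" "q \<in> cdom c" unfolding c_def by (rule ad_chart_at chart_at)+
  obtain V \<kappa> where V: "lc_chart M nabla c V \<kappa> g" "q \<in> V" by (rule frame_at[OF cp])
  note qV = V(2)
  interpret lc_chart M nabla c V \<kappa> g by (rule V(1))
  interpret cosym_chart M nabla \<phi> \<xi> \<eta> g c V \<kappa> by unfold_locales
  show "vector_field M Y \<Longrightarrow> nabla X (\<lambda>p. \<phi> p (Y p)) q = \<phi> q (nabla X Y q)"
    by (rule nabla_parallel[OF endo_\<phi> parallel_\<phi>_\<xi>(1) X _ qV])
  have z: "cmap c q \<in> Z" using qV by (simp add: Z_def)
  have "to_chart M c q (nabla X \<xi> q) = to_chart M c q 0"
    using parallel_\<phi>_\<xi>(2) z unfolding nabla_in_chart[OF X vf_\<xi> qV] parallel_vec_def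
    by (simp add: vf_in_chart_at[OF cp] linear_0[OF linear_to_chart[OF cp]])
  then show "nabla X \<xi> q = 0" using to_chart_inject[OF cp] by blast
qed

end

section \<open>Anti-invariant Riemannian submersions\<close>

locale anti_invariant_submersion = cosymplectic_mfd M nabla \<phi> \<xi> \<eta> g + N: smooth_mfd N
  for M :: "('a::{t2_space, second_countable_topology}, 'e::euclidean_space) chart set"
    and N :: "('b::{t2_space, second_countable_topology}, 'f::euclidean_space) chart set"
    and nabla \<phi> \<xi> \<eta> g +
  fixes h :: "'b \<Rightarrow> 'f \<Rightarrow> 'f \<Rightarrow> real" and F :: "'a \<Rightarrow> 'b" and m :: nat
  assumes dim: "DIM('e) = 2 * m + 1" and h_metric: "riemannian_metric N h"
    and sub: "riemannian_submersion M g N h F"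
    and onto: "\<And>p. \<phi> p ` vertical M N F p = horizontal M N g F p"
begin

abbreviation "vert \<equiv> vertical M N F"
abbreviation "hor \<equiv> horizontal M N g F"
abbreviation "push \<equiv> pushforward M N F"
abbreviation "vp \<equiv> orth_proj g vert"
abbreviation "hp \<equiv> orth_proj g hor"

lemma h: "bilinear (h p)" "h p u v = h p v u"
  using h_metric by (auto simp: riemannian_metric_def)

lemma lin_h: "linear (\<lambda>u. h p u v)" "linear (h p u)" using h(1)[of p] by (auto simp: bilinear_def)

lemma smF: "c \<in> M \<Longrightarrow> d \<in> N \<Longrightarrow> smooth_on (cmap c ` (cdom c \<inter> F -` cdom d)) (cmap d \<circ> F \<circ> cinv c)"
  using sub unfolding riemannian_submersion_def smooth_map_def by blast

lemma openF: "open U \<Longrightarrow> open (F -` U)"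
proof -
  assume "open U"
  moreover have "continuous_on UNIV F" using sub unfolding riemannian_submersion_def smooth_map_def by blast
  ultimately show ?thesis using open_vimage by blast
qed

lemma open_dom: "c \<in> M \<Longrightarrow> d \<in> N \<Longrightarrow> open (cdom c \<inter> F -` cdom d)"
  by (intro open_Int openF ad_simps(1)[OF ad_in] N.ad_simps(1)[OF N.ad_in])

lemma linear_push: "linear (push p)"
  unfolding pushforward_def[abs_def]
  by (rule linear_fd[OF smF[OF chart_at(1) N.chart_at(1)]]) (use chart_at(2) N.chart_at(2) in auto)

lemma push_chart:
  assumes cM: "c \<in> M" and dN: "d \<in> N" and q: "q \<in> cdom c" "F q \<in> cdom d"
  shows "to_chart N d (F q) (push q u) = fd (cmap d \<circ> F \<circ> cinv c) (cmap c q) (to_chart M c q u)"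
proof -
  define a b where "a = chart_at M q" and "b = chart_at N (F q)"
  have a: "a \<in> M" "q \<in> cdom a" and b: "b \<in> N" "F q \<in> cdom b"
    unfolding a_def b_def by (rule chart_at N.chart_at)+
  note ad = ad_in[OF a(1)] ad_in[OF cM] and nd = N.ad_in[OF b(1)] N.ad_in[OF dN]
  have o: "open (cmap a ` (cdom a \<inter> cdom c \<inter> (F -` cdom b \<inter> F -` cdom d)))"
    by (rule open_image[OF ad(1)])
      (auto intro!: open_Int openF simp: ad_simps(1)[OF ad(1)] ad_simps(1)[OF ad(2)] N.ad_simps(1)[OF nd(1)] N.ad_simps(1)[OF nd(2)])
  have z: "cmap a q \<in> cmap a ` (cdom a \<inter> cdom c \<inter> (F -` cdom b \<inter> F -` cdom d))" using a b q by auto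
  have "to_chart N d (F q) (push q u) = fd (tr b d) ((cmap b \<circ> F \<circ> cinv a) (cmap a q)) (fd (cmap b \<circ> F \<circ> cinv a) (cmap a q) u)"
    by (simp add: to_chart_def pushforward_def a_def[symmetric] b_def[symmetric] ad_simps(3)[OF ad(1) a(2)])
  also have "\<dots> = fd (\<lambda>z. tr b d ((cmap b \<circ> F \<circ> cinv a) z)) (cmap a q) u"
    by (rule fd_chain[symmetric, OF smF[OF a(1) b(1)] N.smooth_tr[OF nd]])
      (use a b q in \<open>auto simp: ad_simps(3)[OF ad(1)]\<close>)
  also have "\<dots> = fd (\<lambda>z. (cmap d \<circ> F \<circ> cinv c) (tr a c z)) (cmap a q) u"
    by (rule fd_cong_open[OF o z]) (auto simp: ad_simps(3)[OF ad(1)] ad_simps(3)[OF ad(2)] N.ad_simps(3)[OF nd(1)])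
  also have "\<dots> = fd (cmap d \<circ> F \<circ> cinv c) (tr a c (cmap a q)) (fd (tr a c) (cmap a q) u)"
    by (rule fd_chain[OF smooth_tr[OF ad] smF[OF cM dN]]) (use a q in \<open>auto simp: ad_simps(3)[OF ad(1)]\<close>)
  finally show ?thesis by (simp add: to_chart_def a_def[symmetric] ad_simps(3)[OF ad(1) a(2)])
qed

lemma subspace_vert: "subspace (vert p)"
  unfolding vertical_def subspace_def
  by (simp add: linear_0[OF linear_push] linear_add[OF linear_push] linear_scale[OF linear_push])

lemma orth_splitting_vert: "orth_splitting g vert p"
  by unfold_locales (auto intro: g subspace_vert)

sublocale os: orth_splitting g vert p for p by (rule orth_splitting_vert)

lemma hor_def: "hor p = orth_complement g vert p" by (simp add: horizontal_def)

lemma vp_vert: "vp p u \<in> vert p" by (rule os.orth_proj(1))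

lemma hp_eq: "hp p u = u - vp p u"
  unfolding horizontal_def by (rule os.orth_proj_complement)

lemma hp_hor: "hp p u \<in> hor p" unfolding hp_eq hor_def by (rule os.orth_proj(2))

lemma orth: "u \<in> hor p \<Longrightarrow> v \<in> vert p \<Longrightarrow> g p u v = 0" "u \<in> hor p \<Longrightarrow> v \<in> vert p \<Longrightarrow> g p v u = 0"
  using g(2)[of p v u] by (simp_all add: hor_def orth_complement_def)

lemma vp_iff: "u \<in> vert p \<longleftrightarrow> vp p u = u" using os.orth_proj_id vp_vert by metis

lemma hor_iff: "u \<in> hor p \<longleftrightarrow> vp p u = 0"
  using os.orth_proj_0[of u p] hp_hor[of p u] by (auto simp: hor_def hp_eq)

lemma subspace_hor: "subspace (hor p)" unfolding hor_def by (rule os.C)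

lemma lin_vp: "linear (vp p)" by (rule os.linear_orth_proj)

lemma push_hp: "push p (hp p u) = push p u"
  using vp_vert[of p u] by (simp add: hp_eq linear_diff[OF linear_push] vertical_def)

text \<open>A submersion is only required to preserve lengths of horizontal vectors; polarization
  gives inner products.\<close>

lemma isometry: "h (F p) (push p u) (push p v) = g p (hp p u) (hp p v)"
proof -
  have n: "h (F p) (push p w) (push p w) = g p w w" if "w \<in> hor p" for w
    using sub that unfolding riemannian_submersion_def by simp
  let ?u = "hp p u" and ?v = "hp p v"
  have "?u + ?v \<in> hor p" using subspace_add[OF subspace_hor hp_hor hp_hor] .
  from n[OF this] n[OF hp_hor, of u] n[OF hp_hor, of v]
  have "2 * h (F p) (push p ?u) (push p ?v) = 2 * g p ?u ?v"
    using h(2)[of "F p" "push p ?v" "push p ?u"] g(2)[of p ?v ?u]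
    by (simp add: linear_add[OF linear_push] linear_add[OF lin_h(1)] linear_add[OF lin_h(2)] linear_add[OF lin_g(1)] linear_add[OF lin_g(2)])
  then show ?thesis by (simp add: push_hp)
qed

lemma hp_g: "g p (hp p u) v = h (F p) (push p u) (push p v)"
proof -
  have "g p (hp p u) v = g p (hp p u) (hp p v) + g p (hp p u) (vp p v)"
    by (simp add: hp_eq linear_diff[OF lin_g(2)])
  then show ?thesis using orth(1)[OF hp_hor vp_vert] by (simp add: isometry)
qed

text \<open>By \<open>hp_g\<close>, the inner products of the horizontal part of \<open>X\<close>
  with all vectors are given by the pullback of \<open>h\<close> under \<open>F\<close>. In
  coordinates this is an invertible linear system with smooth coefficients and smooth right-hand
  side, to which \<open>smooth_on_linear_solve\<close> applies.\<close>

lemma vf_hp: assumes X: "vector_field M X" shows "vector_field M (\<lambda>p. hp p (X p))"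
proof (rule vector_fieldI)
  fix p
  define c d where "c = chart_at M p" and "d = chart_at N (F p)"
  have cM: "c \<in> M" "p \<in> cdom c" and dN: "d \<in> N" "F p \<in> cdom d"
    unfolding c_def d_def by (rule chart_at N.chart_at)+
  note c = ad_in[OF cM(1)] and d = N.ad_in[OF dN(1)]
  define V where "V = cdom c \<inter> F -` cdom d"
  define Z where "Z = cmap c ` V"
  have V: "open V" "V \<subseteq> cdom c" "p \<in> V" using open_dom[OF cM(1) dN(1)] cM dN by (auto simp: V_def)
  have oZ: "open Z" unfolding Z_def by (rule open_image[OF c V(1,2)])
  have Zc: "Z \<subseteq> cmap c ` cdom c" using V by (auto simp: Z_def)
  define f where "f = cmap d \<circ> F \<circ> cinv c"
  define gc where "gc z u v = g (cinv c z) (of_chart M c (cinv c z) u) (of_chart M c (cinv c z) v)" for z u v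
  define hd where "hd y u v = h (cinv d y) (of_chart N d (cinv d y) u) (of_chart N d (cinv d y) v)" for y u v
  have sf: "smooth_on Z f" unfolding f_def Z_def V_def by (rule smF[OF cM(1) dN(1)])
  have fZ: "f ` Z \<subseteq> cmap d ` cdom d" by (auto simp: f_def Z_def V_def ad_simps(3)[OF c])
  have sX: "smooth_on Z (vf_in_chart M c X)" by (rule smooth_on_subset[OF vector_field_chart[OF X c] Zc])
  have at: "cinv c z \<in> cdom c" "F (cinv c z) \<in> cdom d" "cmap c (cinv c z) = z" if "z \<in> Z" for z
    using that ad_simps(3)[OF c] by (auto simp: Z_def V_def)
  have gcb: "bilinear (gc z)" if "z \<in> Z" for z
    unfolding gc_def[abs_def] by (rule bilinear_of_chart[OF g(1) c at(1)[OF that]])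
  have gcs: "smooth_on Z (\<lambda>z. gc z u v)" for u v
    by (rule smooth_on_subset[OF _ Zc]) (use metric cM(1) in \<open>unfold gc_def riemannian_metric_def, blast\<close>)
  have hdb: "bilinear (hd (f z))" if "z \<in> Z" for z
    unfolding hd_def[abs_def]
    by (rule N.bilinear_of_chart[OF h(1) d]) (use fZ that N.ad_simps(5)[OF d] in blast)
  have hds: "smooth_on Z (\<lambda>z. hd (f z) u v)" for u v
  proof (rule smooth_on_compose[OF oZ N.ad_simps(2)[OF d] sf _ fZ])
    show "smooth_on (cmap d ` cdom d) (\<lambda>y. hd y u v)"
      using h_metric dN(1) unfolding hd_def riemannian_metric_def by blast
  qed
  \<comment> \<open>\<open>A z\<close> is the Gram map of the metric in the chart. The vector
    \<open>k z\<close> lists the pulled-back inner products of \<open>X\<close> with the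
    basis.\<close>
  define A where "A z u = (\<Sum>b\<in>Basis. gc z b u *\<^sub>R b)" for z u
  define k where "k z = (\<Sum>b\<in>Basis. hd (f z) (fd f z (vf_in_chart M c X z)) (fd f z b) *\<^sub>R b)" for z
  have gl: "linear (gc z b)" "linear (\<lambda>b. gc z b u)" if "z \<in> Z" for z b u using gcb[OF that] by (auto simp: bilinear_def)
  have "smooth_on Z (vf_in_chart M c (\<lambda>p. hp p (X p)))"
  proof (rule smooth_on_linear_solve[OF oZ])
    show lA: "linear (A z)" if "z \<in> Z" for z
      unfolding A_def
      by (intro linearI) (simp_all add: linear_add[OF gl(1)[OF that]] linear_scale[OF gl(1)[OF that]]
          scaleR_add_left sum.distrib scaleR_sum_right)
    show "inj (A z)" if z: "z \<in> Z" for z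
    proof (rule linear_injective_0[OF lA[OF z], THEN iffD2], intro allI impI)
      fix u assume "A z u = 0"
      then have "A z u \<bullet> u = 0" by simp
      also have "A z u \<bullet> u = (\<Sum>b\<in>Basis. (u \<bullet> b) *\<^sub>R gc z b u)"
        unfolding A_def inner_sum_left by (simp add: mult.commute inner_commute[of _ u])
      also have "\<dots> = gc z u u" by (rule linear_expansion[OF gl(2)[OF z], symmetric])
      finally have "of_chart M c (cinv c z) u = 0" unfolding gc_def using g(3) by (metis less_irrefl)
      then show "u = 0" using to_of_chart[OF c at(1)[OF z], of u] linear_0[OF linear_to_chart[OF c at(1)[OF z]]] by simp
    qed
    show "smooth_on Z (\<lambda>z. A z u)" for u
      unfolding A_def
      by (rule smooth_on_sum[OF oZ smooth_on_bounded_linear[OF bounded_linear_scaleR_left oZ gcs]])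
    have s1: "smooth_on Z (\<lambda>z. fd f z (vf_in_chart M c X z))"
      by (rule smooth_on_linear_apply[OF oZ linear_fd[OF sf] smooth_on_fd[OF sf] sX])
    have "smooth_on Z (\<lambda>z. hd (f z) (fd f z (vf_in_chart M c X z)) (fd f z b))" for b
      by (rule smooth_on_bilinear_apply[where B = "\<lambda>z. hd (f z)", OF oZ hdb hds s1 smooth_on_fd[OF sf]])
    then show "smooth_on Z k"
      unfolding k_def
      by (rule smooth_on_sum[OF oZ smooth_on_bounded_linear[OF bounded_linear_scaleR_left oZ]])
    show "A z (vf_in_chart M c (\<lambda>p. hp p (X p)) z) = k z" if z: "z \<in> Z" for z
    proof -
      define q where "q = cinv c z"
      have q: "q \<in> cdom c" "F q \<in> cdom d" "cmap c q = z" using at[OF z] by (simp_all add: q_def)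
      have fz: "f z = cmap d (F q)" by (simp add: f_def q_def)
      have "gc z b (vf_in_chart M c (\<lambda>p. hp p (X p)) z) = hd (f z) (fd f z (vf_in_chart M c X z)) (fd f z b)" for b
      proof -
        have "gc z b (vf_in_chart M c (\<lambda>p. hp p (X p)) z) = g q (of_chart M c q b) (hp q (X q))"
          by (simp add: gc_def vf_in_chart_def q_def[symmetric] of_to_chart[OF c q(1)])
        also have "\<dots> = h (F q) (push q (X q)) (push q (of_chart M c q b))"
          using hp_g g(2) by metis
        also have "\<dots> = hd (f z) (to_chart N d (F q) (push q (X q))) (to_chart N d (F q) (push q (of_chart M c q b)))"
          by (simp add: hd_def fz N.ad_simps(3)[OF d q(2)] N.of_to_chart[OF d q(2)])
        also have "\<dots> = hd (f z) (fd f z (vf_in_chart M c X z)) (fd f z b)"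
          unfolding push_chart[OF cM(1) dN(1) q(1,2)] to_of_chart[OF c q(1)]
          by (simp add: f_def[symmetric] q(3) vf_in_chart_def q_def[symmetric])
        finally show ?thesis .
      qed
      then show ?thesis by (simp add: A_def k_def)
    qed
  qed
  then show "\<exists>c V. ad c \<and> open V \<and> p \<in> V \<and> V \<subseteq> cdom c \<and> smooth_on (cmap c ` V) (vf_in_chart M c (\<lambda>p. hp p (X p)))"
    using c V unfolding Z_def by blast
qed

lemma vf_vp: assumes X: "vector_field M X" shows "vector_field M (\<lambda>p. vp p (X p))"
  using vector_field_diff[OF X vf_hp[OF X]] by (simp add: hp_eq)

lemma endo_vp: "smooth_endo vp" using vf_vp lin_vp by (simp add: smooth_endo_def)

text \<open>The kernel of \<open>\<phi>\<close> consists of the multiples of \<open>\<xi>\<close>.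
  If \<open>\<xi>\<close> were not vertical, \<open>\<phi>\<close> would be injective on the
  vertical space and map it onto the horizontal one, so the two dimensions would agree, although
  their sum is odd.\<close>

lemma \<xi>_vert: "\<xi> p \<in> vert p"
proof (rule ccontr)
  assume n: "\<xi> p \<notin> vert p"
  have "inj_on (\<phi> p) (vert p)"
  proof (rule inj_onI)
    fix u v assume uv: "u \<in> vert p" "v \<in> vert p" "\<phi> p u = \<phi> p v"
    let ?w = "u - v"
    have "\<phi> p ?w = 0" by (simp add: linear_diff[OF lin_\<phi>] uv(3))
    then have w: "?w = \<eta> p ?w *\<^sub>R \<xi> p" using contact(1)[of p ?w] by (simp add: linear_0[OF lin_\<phi>] algebra_simps)
    have "?w \<in> vert p" using uv subspace_diff[OF subspace_vert] by blast
    obtain k where k: "?w = k *\<^sub>R \<xi> p" using w by blast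
    have "k = 0"
    proof (rule ccontr)
      assume "k \<noteq> 0"
      then have "\<xi> p = inverse k *\<^sub>R ?w" by (simp add: k)
      then show False using n subspace_scale[OF subspace_vert \<open>?w \<in> vert p\<close>] by metis
    qed
    then show "u = v" using k by simp
  qed
  then have "dim (\<phi> p ` vert p) = dim (vert p)"
    using dim_image_eq[OF lin_\<phi>[of p], of "vert p"] span_eq_iff[THEN iffD2, OF subspace_vert[of p]] by simp
  then have "dim (hor p) = dim (vert p)" by (simp add: onto)
  then show False using os.dim_orth[of p] dim unfolding hor_def by presburger
qed

lemma \<phi>_vert: "u \<in> vert p \<Longrightarrow> \<phi> p u \<in> hor p" using onto by blast

text \<open>A horizontal vector is \<open>\<phi> v\<close> for a vertical \<open>v\<close>, and
  \<open>\<phi>\<close> applied again differs from \<open>- v\<close> by a multiple of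
  \<open>\<xi>\<close>, which is vertical.\<close>

lemma \<phi>_hor: assumes "u \<in> hor p" shows "\<phi> p u \<in> vert p"
proof -
  obtain v where v: "v \<in> vert p" "u = \<phi> p v" using assms onto[of p] by blast
  have "- v + \<eta> p v *\<^sub>R \<xi> p \<in> vert p"
    by (intro subspace_add[OF subspace_vert] subspace_neg[OF subspace_vert] subspace_scale[OF subspace_vert] v \<xi>_vert)
  then show ?thesis by (simp add: v contact(1))
qed

end

section \<open>Parallel distributions and O'Neill's tensors\<close>

context anti_invariant_submersion
begin

text \<open>The middle term of the equivalence: both distributions are parallel along every field
  \<open>X\<close>, not merely along their own fields.\<close>

definition preserves :: bool where
  "preserves \<longleftrightarrow> (\<forall>X Y. vector_field M X \<longrightarrow> vector_field M Y \<longrightarrow>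
     (\<forall>p. nabla X (\<lambda>q. vp q (Y q)) p \<in> vert p \<and> nabla X (\<lambda>q. hp q (Y q)) p \<in> hor p))"

definition oneill_vanish :: bool where
  "oneill_vanish \<longleftrightarrow> (\<forall>W \<in> sections M vert. \<forall>V \<in> sections M vert. \<forall>X \<in> sections M hor. \<forall>Y \<in> sections M hor.
       (\<forall>p. oneill_A M N g F nabla X (\<lambda>q. \<phi> q (Y q)) p = 0) \<and>
       (\<forall>p. oneill_T M N g F nabla V (\<lambda>q. \<phi> q (W q)) p = 0))"

text \<open>\<open>\<phi> Y\<close> is vertical, so the summand with the horizontal part of the
  second argument differentiates the zero field.\<close>

lemma oneill_A_\<phi>:
  assumes X: "X \<in> sections M hor" and Y: "Y \<in> sections M hor"
  shows "oneill_A M N g F nabla X (\<lambda>q. \<phi> q (Y q)) p = hp p (nabla X (\<lambda>q. \<phi> q (Y q)) p)"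
proof -
  have v: "\<phi> q (Y q) \<in> vert q" "X q \<in> hor q" for q using X Y \<phi>_hor by (auto simp: sections_def)
  have "vp q (\<phi> q (Y q)) = \<phi> q (Y q)" "hp q (\<phi> q (Y q)) = 0" "hp q (X q) = X q" for q
    using v[of q] by (simp_all add: hp_eq vp_iff hor_iff)
  moreover have "vector_field M X" using X by (simp add: sections_def)
  ultimately show ?thesis
    by (simp add: oneill_A_def vert_part_def horiz_part_def nabla_zero2 linear_0[OF lin_vp])
qed

lemma oneill_T_\<phi>:
  assumes V: "V \<in> sections M vert" and W: "W \<in> sections M vert"
  shows "oneill_T M N g F nabla V (\<lambda>q. \<phi> q (W q)) p = vp p (nabla V (\<lambda>q. \<phi> q (W q)) p)"
proof -
  have v: "\<phi> q (W q) \<in> hor q" "V q \<in> vert q" for q using V W \<phi>_vert by (auto simp: sections_def)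
  have "vp q (\<phi> q (W q)) = 0" "hp q (\<phi> q (W q)) = \<phi> q (W q)" "vp q (V q) = V q" for q
    using v[of q] by (simp_all add: hp_eq vp_iff hor_iff)
  moreover have "vector_field M V" using V by (simp add: sections_def)
  ultimately show ?thesis
    by (simp add: oneill_T_def vert_part_def horiz_part_def nabla_zero2 hp_eq linear_0[OF lin_vp])
qed

lemma sections_vp: "vector_field M X \<Longrightarrow> (\<lambda>p. vp p (X p)) \<in> sections M vert"
  by (simp add: sections_def vf_vp vp_vert)

lemma sections_hp: "vector_field M X \<Longrightarrow> (\<lambda>p. hp p (X p)) \<in> sections M hor"
  by (simp add: sections_def vf_hp hp_hor)

lemma preserves_sections:
  assumes preserves and X: "vector_field M X"
  shows "Y \<in> sections M vert \<Longrightarrow> nabla X Y p \<in> vert p" "Y \<in> sections M hor \<Longrightarrow> nabla X Y p \<in> hor p"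
proof -
  assume Y: "Y \<in> sections M vert"
  then have "(\<lambda>q. vp q (Y q)) = Y" "vector_field M Y" using vp_iff by (auto simp: sections_def)
  then show "nabla X Y p \<in> vert p" using assms unfolding preserves_def by metis
next
  assume Y: "Y \<in> sections M hor"
  then have "(\<lambda>q. hp q (Y q)) = Y" "vector_field M Y" using hor_iff by (auto simp: sections_def hp_eq)
  then show "nabla X Y p \<in> hor p" using assms unfolding preserves_def by metis
qed

lemma preserves_imp_vanish: assumes preserves shows oneill_vanish
  unfolding oneill_vanish_def
proof (intro ballI conjI allI)
  fix W V X Y p
  assume W: "W \<in> sections M vert" and V: "V \<in> sections M vert" and X: "X \<in> sections M hor" and Y: "Y \<in> sections M hor"
  have vf: "vector_field M W" "vector_field M V" "vector_field M X" "vector_field M Y"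
    using W V X Y by (auto simp: sections_def)
  have "(\<lambda>q. \<phi> q (Y q)) \<in> sections M vert" using vf_\<phi>[OF vf(4)] Y \<phi>_hor by (simp add: sections_def)
  from preserves_sections(1)[OF assms vf(3) this]
  show "oneill_A M N g F nabla X (\<lambda>q. \<phi> q (Y q)) p = 0"
    by (simp add: oneill_A_\<phi>[OF X Y] hp_eq vp_iff)
  have "(\<lambda>q. \<phi> q (W q)) \<in> sections M hor" using vf_\<phi>[OF vf(1)] W \<phi>_vert by (simp add: sections_def)
  from preserves_sections(2)[OF assms vf(2) this]
  show "oneill_T M N g F nabla V (\<lambda>q. \<phi> q (W q)) p = 0"
    by (simp add: oneill_T_\<phi>[OF V W] hor_iff)
qed

lemma vert_hor_0: "u \<in> vert p \<Longrightarrow> u \<in> hor p \<Longrightarrow> u = 0" by (simp add: vp_iff hor_iff)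

lemma \<phi>_zero: "\<phi> p u = 0 \<Longrightarrow> u = \<eta> p u *\<^sub>R \<xi> p"
  using contact(1)[of p u] by (simp add: linear_0[OF lin_\<phi>] algebra_simps)

lemma split: "u = vp p u + hp p u" by (simp add: hp_eq)

text \<open>Since \<open>\<phi>\<close> commutes with \<open>nabla\<close>, the condition on
  \<open>A\<close> makes \<open>\<phi> (nabla X Y)\<close> vertical. Then \<open>\<phi>\<close> of
  the vertical part of \<open>nabla X Y\<close> is both vertical and horizontal, so this part is a
  multiple of \<open>\<xi>\<close>. Its coefficient is found by differentiating
  \<open>g Y \<xi> = 0\<close>, where \<open>\<xi>\<close> is parallel.\<close>

lemma vanish_hor:
  assumes oneill_vanish and X: "X \<in> sections M hor" and Y: "Y \<in> sections M hor"
  shows "nabla X Y p \<in> hor p"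
proof -
  have vf: "vector_field M X" "vector_field M Y" using X Y by (auto simp: sections_def)
  define u where "u = nabla X Y p"
  \<comment> \<open>The vanishing condition quantifies over all four fields jointly; the zero field
    fills the vertical places.\<close>
  have z: "(\<lambda>q. 0) \<in> sections M vert" using vector_field_zero subspace_0[OF subspace_vert] by (simp add: sections_def)
  have "oneill_A M N g F nabla X (\<lambda>q. \<phi> q (Y q)) p = 0"
    using assms(1) X Y z unfolding oneill_vanish_def by blast
  then have "hp p (\<phi> p u) = 0" unfolding oneill_A_\<phi>[OF X Y] nabla_\<phi>_\<xi>(1)[OF vf] u_def .
  then have "\<phi> p u \<in> vert p" by (simp add: hp_eq vp_iff)
  moreover have "\<phi> p (hp p u) \<in> vert p" by (rule \<phi>_hor[OF hp_hor])
  ultimately have "\<phi> p u - \<phi> p (hp p u) \<in> vert p" by (rule subspace_diff[OF subspace_vert])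
  then have "\<phi> p (vp p u) \<in> vert p" by (simp add: hp_eq linear_diff[OF lin_\<phi>])
  then have "\<phi> p (vp p u) = 0" using vert_hor_0 \<phi>_vert[OF vp_vert] by blast
  then have k: "vp p u = \<eta> p (vp p u) *\<^sub>R \<xi> p" by (rule \<phi>_zero)
  have "g p u (\<xi> p) = 0"
  proof -
    have "g q (Y q) (\<xi> q) = 0" for q using orth(1)[OF _ \<xi>_vert, of "Y q" q] Y by (simp add: sections_def)
    then have "vec_deriv M (\<lambda>q. g q (Y q) (\<xi> q)) p (X p) = 0"
      using vec_deriv_local_const[OF smooth_fun_const[of 0] open_UNIV UNIV_I refl] by simp
    then show ?thesis
      using compat[OF vf(1,2) vf_\<xi>, of p] nabla_\<phi>_\<xi>(2)[OF vf(1), of p] by (simp add: u_def linear_0[OF lin_g(2)])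
  qed
  moreover have "g p u (\<xi> p) = g p (vp p u) (\<xi> p) + g p (hp p u) (\<xi> p)"
    using split[of u p] linear_add[OF lin_g(1), of p "vp p u" "hp p u" "\<xi> p"] by simp
  ultimately have "\<eta> p (vp p u) = 0"
    using orth(1)[OF hp_hor \<xi>_vert] contact(6) by simp
  then have "vp p u = 0" using k by simp
  then show ?thesis by (simp add: hor_iff u_def)
qed

text \<open>As in \<open>vanish_hor\<close>, what remains is a multiple of \<open>\<xi>\<close>, but
  now it is a horizontal vector. Its \<open>\<eta>\<close>-value and with it the coefficient is 0
  because \<open>\<xi>\<close> is vertical.\<close>

lemma vanish_vert:
  assumes oneill_vanish and V: "V \<in> sections M vert" and W: "W \<in> sections M vert"
  shows "nabla V W p \<in> vert p"
proof -
  have vf: "vector_field M V" "vector_field M W" using V W by (auto simp: sections_def)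
  define u where "u = nabla V W p"
  have z: "(\<lambda>q. 0) \<in> sections M hor" using vector_field_zero subspace_0[OF subspace_hor] by (simp add: sections_def)
  have "oneill_T M N g F nabla V (\<lambda>q. \<phi> q (W q)) p = 0"
    using assms(1) V W z unfolding oneill_vanish_def by blast
  then have "vp p (\<phi> p u) = 0" unfolding oneill_T_\<phi>[OF V W] nabla_\<phi>_\<xi>(1)[OF vf] u_def .
  then have "\<phi> p u \<in> hor p" by (simp add: hor_iff)
  moreover have "\<phi> p (vp p u) \<in> hor p" by (rule \<phi>_vert[OF vp_vert])
  ultimately have "\<phi> p u - \<phi> p (vp p u) \<in> hor p" by (rule subspace_diff[OF subspace_hor])
  then have "\<phi> p (hp p u) \<in> hor p" by (simp add: hp_eq linear_diff[OF lin_\<phi>])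
  then have "\<phi> p (hp p u) = 0" using vert_hor_0 \<phi>_hor[OF hp_hor] by blast
  then have "hp p u = \<eta> p (hp p u) *\<^sub>R \<xi> p" by (rule \<phi>_zero)
  moreover have "\<eta> p (hp p u) = 0" using orth(1)[OF hp_hor \<xi>_vert] contact(6) by simp
  ultimately have "hp p u = 0" by simp
  then show ?thesis by (simp add: hp_eq vp_iff u_def)
qed

text \<open>Metric compatibility transfers parallelism along one distribution from one factor of the
  splitting to the other.\<close>

lemma nabla_orth:
  assumes X: "vector_field M X" and Y: "vector_field M Y" and Z: "vector_field M Z"
    and o: "\<And>q. g q (Y q) (Z q) = 0" "g p (Y p) (nabla X Z p) = 0"
  shows "g p (nabla X Y p) (Z p) = 0"
proof -
  have "vec_deriv M (\<lambda>q. g q (Y q) (Z q)) p (X p) = 0"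
    using vec_deriv_local_const[OF smooth_fun_const[of 0] open_UNIV UNIV_I refl] by (simp add: o(1))
  then show ?thesis using compat[OF X Y Z, of p] o(2) by simp
qed

text \<open>Orthogonality at a point is tested by differentiating along global fields, so every
  tangent vector has to be the value of one.\<close>

lemma vf_extension: obtains Z where "vector_field M Z" "Z p = u"
proof -
  obtain V \<kappa> where V: "lc_chart M nabla (chart_at M p) V \<kappa> g" "p \<in> V"
    by (rule frame_at[OF ad_chart_at chart_at(2)])
  interpret L: lc_chart M nabla "chart_at M p" V \<kappa> g by (rule V(1))
  have "L.E u p = u"
    using L.to_chart_E[OF V(2), of u] by simp
  then show thesis using that L.vf_E by blast
qed

text \<open>Splitting \<open>X\<close> leaves four kinds of derivatives. Those within one
  distribution are given by \<open>vanish_hor\<close> and \<open>vanish_vert\<close>; the two mixed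
  ones are dual to them under \<open>nabla_orth\<close>, tested against arbitrary vectors of the
  complementary distribution.\<close>

lemma vanish_imp_preserves: assumes v: oneill_vanish shows preserves
  unfolding preserves_def
proof (intro allI impI conjI)
  fix X Y p assume X: "vector_field M X" and Y: "vector_field M Y"
  let ?VX = "\<lambda>q. vp q (X q)" and ?HX = "\<lambda>q. hp q (X q)"
  let ?VY = "\<lambda>q. vp q (Y q)" and ?HY = "\<lambda>q. hp q (Y q)"
  have X_split: "X = (\<lambda>q. ?VX q + ?HX q)" by (simp add: hp_eq)
  have nX: "nabla X U p = nabla ?VX U p + nabla ?HX U p" if "vector_field M U" for U
    by (subst X_split) (simp only: nabla_add1[OF vf_vp[OF X] vf_hp[OF X] that])
  have "nabla ?HX ?VY p \<in> vert p"
  proof -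
    have "g p (nabla ?HX ?VY p) u = 0" if u: "u \<in> hor p" for u
    proof -
      obtain Z where Z: "vector_field M Z" "Z p = u" by (rule vf_extension)
      have "g p (nabla ?HX ?VY p) (hp p (Z p)) = 0"
        by (rule nabla_orth[OF vf_hp[OF X] vf_vp[OF Y] vf_hp[OF Z(1)]])
          (auto intro: orth(2) hp_hor vp_vert vanish_hor[OF v sections_hp[OF X] sections_hp[OF Z(1)]])
      then show ?thesis using u by (simp add: Z(2) hp_eq hor_iff)
    qed
    from this[OF hp_hor] have "g p (nabla ?HX ?VY p) (hp p (nabla ?HX ?VY p)) = 0" .
    then have "g p (hp p (nabla ?HX ?VY p)) (hp p (nabla ?HX ?VY p)) = 0"
      using orth(2)[OF hp_hor vp_vert, of p "nabla ?HX ?VY p" "nabla ?HX ?VY p"]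
      by (simp add: hp_eq linear_diff[OF lin_g(1)])
    then have "hp p (nabla ?HX ?VY p) = 0" using g(3) by (metis less_irrefl)
    then show ?thesis by (simp add: hp_eq vp_iff)
  qed
  then show "nabla X ?VY p \<in> vert p"
    unfolding nX[OF vf_vp[OF Y]]
    by (intro subspace_add[OF subspace_vert] vanish_vert[OF v sections_vp[OF X] sections_vp[OF Y]])
  have "nabla ?VX ?HY p \<in> hor p"
  proof -
    have "g p (nabla ?VX ?HY p) u = 0" if u: "u \<in> vert p" for u
    proof -
      obtain Z where Z: "vector_field M Z" "Z p = u" by (rule vf_extension)
      have "g p (nabla ?VX ?HY p) (vp p (Z p)) = 0"
        by (rule nabla_orth[OF vf_vp[OF X] vf_hp[OF Y] vf_vp[OF Z(1)]])
          (auto intro: orth(1) hp_hor vp_vert vanish_vert[OF v sections_vp[OF X] sections_vp[OF Z(1)]])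
      then show ?thesis using u by (simp add: Z(2) vp_iff)
    qed
    then show ?thesis by (simp add: hor_def orth_complement_def)
  qed
  then show "nabla X ?HY p \<in> hor p"
    unfolding nX[OF vf_hp[OF Y]]
    by (intro subspace_add[OF subspace_hor] vanish_hor[OF v sections_hp[OF X] sections_hp[OF Y]])
qed

text \<open>In the product chart both distributions are constant subspaces. A covariant derivative
  is a partial derivative, which stays in such a subspace, plus a Christoffel term, which stays in
  it by \<open>product_metric_Christoffel\<close>.\<close>

lemma locally_product_imp_preserves:
  assumes lp: "locally_product M g vert hor"
  shows preserves
  unfolding preserves_def
proof (intro allI impI)
  fix X Y p assume X: "vector_field M X" and Y: "vector_field M Y"
  obtain U \<psi> \<pi>1 \<pi>2 S1 S2 h1 h2 where
    pU: "p \<in> U" "ad (U, \<psi>)" and \<pi>: "linear \<pi>1" "\<pi>1 \<circ> \<pi>1 = \<pi>1" "\<pi>2 = (\<lambda>x. x - \<pi>1 x)"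
    and patch: "riemannian_patch \<pi>1 S1 h1" "riemannian_patch \<pi>2 S2 h2"
    and im: "\<psi> ` U = {a + b | a b. a \<in> S1 \<and> b \<in> S2}"
    and met: "\<forall>q\<in>U. \<forall>u v. g q u v =
           h1 (\<pi>1 (\<psi> q)) (\<pi>1 (to_chart M (U, \<psi>) q u)) (\<pi>1 (to_chart M (U, \<psi>) q v)) +
           h2 (\<pi>2 (\<psi> q)) (\<pi>2 (to_chart M (U, \<psi>) q u)) (\<pi>2 (to_chart M (U, \<psi>) q v))"
    and dist: "\<forall>q\<in>U. to_chart M (U, \<psi>) q ` vert q = range \<pi>1 \<and> to_chart M (U, \<psi>) q ` hor q = range \<pi>2"
    using lp unfolding locally_product_def by (elim allE[where x = p] exE conjE) (rule that)
  define k where "k = (U, \<psi>)"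
  have k: "ad k" "cdom k = U" "cmap k = \<psi>" using pU by (simp_all add: k_def cdom_def cmap_def)
  obtain V \<kappa> where V: "lc_chart M nabla k V \<kappa> g" "p \<in> V" by (rule frame_at[OF k(1)]) (use pU k in auto)
  note pV = V(2)
  interpret L: lc_chart M nabla k V \<kappa> g by (rule V(1))
  have VU: "q \<in> V \<Longrightarrow> q \<in> U" for q using L.Vc k by simp
  have \<pi>\<pi>: "\<pi>1 (\<pi>1 x) = \<pi>1 x" for x using \<pi>(2) by (metis comp_apply)
  note l1 = linear_add[OF \<pi>(1)] linear_diff[OF \<pi>(1)] linear_0[OF \<pi>(1)]
  have lin2: "linear \<pi>2" unfolding \<pi>(3) by (intro linear_compose_sub \<pi>(1) linear_ident)
  have \<pi>\<pi>2: "\<pi>2 (\<pi>2 x) = \<pi>2 x" "x - \<pi>2 x = \<pi>1 x" for x by (simp_all add: \<pi>(3) l1 \<pi>\<pi>)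
  have sub1: "S1 \<subseteq> range \<pi>1" and sub2: "S2 \<subseteq> range \<pi>2"
    using patch openin_imp_subset unfolding riemannian_patch_def by metis+
  have inS: "\<pi>1 z \<in> S1" "\<pi>2 z \<in> S2" if zZ: "z \<in> L.Z" for z
  \<comment> \<open>A point of the image is a sum \<open>a + b\<close> with \<open>a\<close> in
    \<open>range \<pi>1\<close> and \<open>b\<close> in \<open>range \<pi>2\<close>, and the
    projections recover the two summands.\<close>
  proof -
    have "z \<in> \<psi> ` U" using zZ VU by (auto simp: L.Z_def k)
    then obtain a b where ab: "z = a + b" "a \<in> S1" "b \<in> S2" using im by blast
    have "\<pi>1 a = a" "\<pi>1 b = 0" using ab sub1 sub2 \<pi>\<pi> by (auto simp: \<pi>(3) l1)
    then show "\<pi>1 z \<in> S1" "\<pi>2 z \<in> S2" using ab by (simp_all add: \<pi>(3) l1)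
  qed
  have h10: "h1 (\<pi>1 z) (\<pi>1 u) 0 = 0" "h1 (\<pi>1 z) 0 (\<pi>1 u) = 0"
    and h20: "h2 (\<pi>2 z) (\<pi>2 u) 0 = 0" "h2 (\<pi>2 z) 0 (\<pi>2 u) = 0" if zZ: "z \<in> L.Z" for z u
  proof -
    have b1: "bilinear (\<lambda>u v. h1 (\<pi>1 z) (\<pi>1 u) (\<pi>1 v))" and b2: "bilinear (\<lambda>u v. h2 (\<pi>2 z) (\<pi>2 u) (\<pi>2 v))"
      using patch inS[OF zZ] unfolding riemannian_patch_def by blast+
    have "linear (\<lambda>v. h1 (\<pi>1 z) (\<pi>1 u) (\<pi>1 v))" "linear (\<lambda>v. h1 (\<pi>1 z) (\<pi>1 v) (\<pi>1 u))"
      "linear (\<lambda>v. h2 (\<pi>2 z) (\<pi>2 u) (\<pi>2 v))" "linear (\<lambda>v. h2 (\<pi>2 z) (\<pi>2 v) (\<pi>2 u))"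
      using b1 b2 unfolding bilinear_def by blast+
    from this[THEN linear_0]
    show "h1 (\<pi>1 z) (\<pi>1 u) 0 = 0" "h1 (\<pi>1 z) 0 (\<pi>1 u) = 0" "h2 (\<pi>2 z) (\<pi>2 u) 0 = 0" "h2 (\<pi>2 z) 0 (\<pi>2 u) = 0"
      using linear_0[OF \<pi>(1)] linear_0[OF lin2] by simp_all
  qed
  have G: "L.G z u v = h1 (\<pi>1 z) (\<pi>1 u) (\<pi>1 v) + h2 (\<pi>2 z) (\<pi>2 u) (\<pi>2 v)" if zZ: "z \<in> L.Z" for z u v
  proof -
    obtain q where q: "q \<in> V" "z = cmap k q" using zZ by (auto simp: L.Z_def)
    show ?thesis
      unfolding q(2) L.G_at[OF q(1)]
      using bspec[OF met VU[OF q(1)]] to_of_chart[OF k(1) L.Vc[OF q(1)]]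
      by (simp add: k(3) k_def[symmetric])
  qed
  have \<Gamma>1: "\<pi>1 (L.\<Gamma> z x y) = L.\<Gamma> z x y" if "z \<in> L.Z" "\<pi>1 y = y" for z x y
    by (rule L.product_metric_Christoffel[OF \<pi>(1) \<pi>\<pi>, of h1 h2])
      (use that G h10 h20 in \<open>simp_all add: \<pi>(3)\<close>)
  \<comment> \<open>The same lemma with the factors exchanged, since \<open>\<pi>1\<close> is the
    projection complementary to \<open>\<pi>2\<close>.\<close>
  have \<Gamma>2: "\<pi>2 (L.\<Gamma> z x y) = L.\<Gamma> z x y" if "z \<in> L.Z" "\<pi>2 y = y" for z x y
    by (rule L.product_metric_Christoffel[OF lin2 \<pi>\<pi>2(1), of h2 h1])
      (use that G h10 h20 in \<open>simp_all add: \<pi>\<pi>2(2)\<close>)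
  have vert_iff: "u \<in> vert q \<longleftrightarrow> \<pi>1 (to_chart M k q u) = to_chart M k q u"
    and hor_iff': "u \<in> hor q \<longleftrightarrow> \<pi>2 (to_chart M k q u) = to_chart M k q u" if q: "q \<in> V" for q u
  proof -
    have d: "to_chart M k q ` vert q = range \<pi>1" "to_chart M k q ` hor q = range \<pi>2"
      using bspec[OF dist VU[OF q]] unfolding k_def by blast+
    have inj: "to_chart M k q u \<in> to_chart M k q ` D \<longleftrightarrow> u \<in> D" for D
      by (simp add: image_iff to_chart_inject[OF k(1) L.Vc[OF q]])
    have r: "y \<in> range \<pi>1 \<longleftrightarrow> \<pi>1 y = y" "y \<in> range \<pi>2 \<longleftrightarrow> \<pi>2 y = y" for y
      using \<pi>\<pi>[of _] \<pi>\<pi>2(1)[of _] by (auto simp: image_iff dest: sym)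
    show "u \<in> vert q \<longleftrightarrow> \<pi>1 (to_chart M k q u) = to_chart M k q u"
      "u \<in> hor q \<longleftrightarrow> \<pi>2 (to_chart M k q u) = to_chart M k q u"
      using inj[of "vert q"] inj[of "hor q"] unfolding d r by simp_all
  qed
  have z: "cmap k p \<in> L.Z" using pV by (simp add: L.Z_def)
  \<comment> \<open>A constant projection commutes with differentiation, so a field with values in
    its range has derivatives in its range.\<close>
  have main: "\<pi> (to_chart M k p (nabla X Y' p)) = to_chart M k p (nabla X Y' p)"
    if Y': "vector_field M Y'" and \<pi>': "linear \<pi>" "\<And>q. q \<in> V \<Longrightarrow> \<pi> (to_chart M k q (Y' q)) = to_chart M k q (Y' q)"
      and \<Gamma>': "\<And>z x y. z \<in> L.Z \<Longrightarrow> \<pi> y = y \<Longrightarrow> \<pi> (L.\<Gamma> z x y) = L.\<Gamma> z x y" for \<pi> Y'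
  proof -
    have s: "smooth_on L.Z (vf_in_chart M k Y')"
      by (rule smooth_on_subset[OF vector_field_chart[OF Y' k(1)] L.Z_sub])
    have "fd (vf_in_chart M k Y') (cmap k p) w = fd (\<lambda>z. \<pi> (vf_in_chart M k Y' z)) (cmap k p) w" for w
      by (rule fd_cong_open[OF L.open_Z z]) (auto simp: L.Z_def vf_in_chart_at[OF k(1) L.Vc] \<pi>'(2))
    then have "\<pi> (fd (vf_in_chart M k Y') (cmap k p) w) = fd (vf_in_chart M k Y') (cmap k p) w" for w
      using fd_linear_const[OF \<pi>'(1) s z] by simp
    then show ?thesis
      unfolding L.nabla_in_chart[OF X Y' pV]
      by (simp add: linear_add[OF \<pi>'(1)] \<Gamma>'[OF z \<pi>'(2)[OF pV]])
  qed
  show "nabla X (\<lambda>q. vp q (Y q)) p \<in> vert p \<and> nabla X (\<lambda>q. hp q (Y q)) p \<in> hor p"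
    unfolding vert_iff[OF pV] hor_iff'[OF pV]
    by (rule conjI, rule main[OF vf_vp[OF Y] \<pi>(1) vert_iff[THEN iffD1, OF _ vp_vert] \<Gamma>1], assumption+,
        rule main[OF vf_hp[OF Y] lin2 hor_iff'[THEN iffD1, OF _ hp_hor] \<Gamma>2], assumption+)
qed

section \<open>From parallel distributions to a local product\<close>

lemma preserves_imp_vp_parallel:
  assumes preserves and X: "vector_field M X" and Y: "vector_field M Y"
  shows "nabla X (\<lambda>p. vp p (Y p)) q = vp q (nabla X Y q)"
proof -
  have "Y = (\<lambda>p. vp p (Y p) + hp p (Y p))" by (simp add: hp_eq)
  then have "nabla X Y q = nabla X (\<lambda>p. vp p (Y p)) q + nabla X (\<lambda>p. hp p (Y p)) q"
    using nabla_add2[OF X vf_vp[OF Y] vf_hp[OF Y]] by metis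
  moreover have "vp q (nabla X (\<lambda>p. vp p (Y p)) q) = nabla X (\<lambda>p. vp p (Y p)) q" "vp q (nabla X (\<lambda>p. hp p (Y p)) q) = 0"
    using assms unfolding preserves_def vp_iff hor_iff by blast+
  ultimately show ?thesis by (simp add: linear_add[OF lin_vp])
qed

text \<open>The vertical projection is parallel, so the flat coordinates give it a constant matrix.
  The remaining work is to convert these coordinates of one chart into an admissible chart of
  \<open>M\<close> and to check the product structure there.\<close>

lemma preserves_imp_locally_product:
  assumes pr: preserves
  shows "locally_product M g vert hor"
  unfolding locally_product_def
proof
  fix p
  define c where "c = chart_at M p"
  have c: "ad c" "p \<in> cdom c" unfolding c_def by (rule ad_chart_at chart_at)+
  obtain V \<kappa> where V: "lc_chart M nabla c V \<kappa> g" "p \<in> V" by (rule frame_at[OF c])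
  note pV = V(2)
  interpret L: lc_chart M nabla c V \<kappa> g by (rule V(1))
  interpret L: cosym_chart M nabla \<phi> \<xi> \<eta> g c V \<kappa> by unfold_locales
  define z0 where "z0 = cmap c p"
  have z0: "z0 \<in> L.Z" using pV by (simp add: z0_def L.Z_def)
  define P where "P = L.loc vp"
  have parP: "L.parallel_endo P" unfolding P_def
    by (rule L.parallel_endoI[OF endo_vp preserves_imp_vp_parallel[OF pr]])
  have lP: "linear (P z)" if "z \<in> L.Z" for z unfolding P_def by (rule L.linear_loc[OF endo_vp that])
  have P_at: "P (cmap c q) u = to_chart M c q (vp q (of_chart M c q u))" if "q \<in> V" for q u
    unfolding P_def by (rule L.loc_at[OF that])
  have P_to: "P (cmap c q) (to_chart M c q u) = to_chart M c q (vp q u)" if "q \<in> V" for q u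
    unfolding P_def L.to_chart_loc[OF that] ..
  have PP: "P z (P z u) = P z u" and P_adj: "L.G z (P z u) v = L.G z u (P z v)"
    and P\<xi>: "P z (vf_in_chart M c \<xi> z) = vf_in_chart M c \<xi> z"
    and P\<phi>1: "P z u = u \<Longrightarrow> P z (L.loc \<phi> z u) = 0" and P\<phi>2: "P z u = 0 \<Longrightarrow> P z (L.loc \<phi> z u) = L.loc \<phi> z u"
    if zZ: "z \<in> L.Z" for z u v
  proof -
    obtain q where q: "q \<in> V" "z = cmap c q" using zZ by (auto simp: L.Z_def)
    note ot = of_to_chart[OF c(1) L.Vc[OF q(1)]] and inj = to_chart_inject[OF c(1) L.Vc[OF q(1)]]
      and t0 = linear_0[OF linear_to_chart[OF c(1) L.Vc[OF q(1)]]]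
    have vv: "vp q (vp q u) = vp q u" for u using vp_vert vp_iff by blast
    show "P z (P z u) = P z u" unfolding q(2) by (simp add: P_at[OF q(1)] ot vv)
    show "L.G z (P z u) v = L.G z u (P z v)"
      unfolding q(2) P_at[OF q(1)] L.G_at[OF q(1)] ot by (rule os.orth_proj_adjoint)
    show "P z (vf_in_chart M c \<xi> z) = vf_in_chart M c \<xi> z"
      unfolding q(2) vf_in_chart_at[OF c(1) L.Vc[OF q(1)]] P_to[OF q(1)] using \<xi>_vert vp_iff by simp
    have u: "u = to_chart M c q (of_chart M c q u)" using to_of_chart[OF c(1) L.Vc[OF q(1)]] by simp
    show "P z (L.loc \<phi> z u) = 0" if "P z u = u"
    proof -
      have "vp q (of_chart M c q u) = of_chart M c q u" using that u inj unfolding q(2) P_at[OF q(1)] by metis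
      then have "\<phi> q (of_chart M c q u) \<in> hor q" using \<phi>_vert vp_iff by blast
      then show ?thesis unfolding q(2) L.loc_at[OF q(1)] P_to[OF q(1)] hor_iff by (simp add: t0)
    qed
    show "P z (L.loc \<phi> z u) = L.loc \<phi> z u" if "P z u = 0"
    proof -
      have "vp q (of_chart M c q u) = 0" using that inj t0 unfolding q(2) P_at[OF q(1)] by metis
      then have "\<phi> q (of_chart M c q u) \<in> vert q" using \<phi>_hor hor_iff by blast
      then show ?thesis unfolding q(2) L.loc_at[OF q(1)] P_to[OF q(1)] vp_iff by simp
    qed
  qed
  have flat: "L.curv z u v w = 0" if z: "z \<in> L.Z" for z u v w
    by (rule curvature_algebra_zero[where g = "L.G z" and R = "L.curv z" and P = "P z" and f = "L.loc \<phi> z"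
          and e = "L.\<eta>c z" and x = "vf_in_chart M c \<xi> z"])
      (fact L.bilG[OF z] L.posG[OF z] L.curv_linear[OF z] L.curv_skew12 L.curv_Bianchi[OF z] L.curv_skew34[OF z]
        lP[OF z] PP[OF z] P_adj[OF z] L.curv_parallel_endo[OF parP z] L.lin\<phi>[OF z] L.\<phi>\<phi>[OF z]
        L.curv_parallel_endo[OF L.parallel_\<phi>_\<xi>(1) z] L.curv_parallel_vec[OF L.parallel_\<phi>_\<xi>(2) z]
        P\<xi>[OF z] P\<phi>1[OF z] P\<phi>2[OF z] L.symG[OF z])+
  obtain W B \<psi> gi \<epsilon> where W: "open W" "z0 \<in> W" "W \<subseteq> L.Z" "smooth_on W \<psi>" and \<epsilon>: "\<epsilon> > 0"
    and hom: "homeomorphism W B \<psi> gi" "smooth_on B gi" "open B"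
    and B: "B = {y. norm (P z0 y) < \<epsilon> \<and> norm (y - P z0 y) < \<epsilon>}"
    and iso: "\<And>z u v. z \<in> W \<Longrightarrow> L.G z u v = L.G z0 (fd \<psi> z u) (fd \<psi> z v)"
    and comm: "\<And>z u. z \<in> W \<Longrightarrow> fd \<psi> z (P z u) = P z0 (fd \<psi> z u)"
    and surj: "\<And>z. z \<in> W \<Longrightarrow> surj (fd \<psi> z)"
    by (rule L.product_coordinates[OF z0 flat parP]) blast+
  define \<pi>1 \<pi>2 where "\<pi>1 = P z0" and "\<pi>2 x = x - \<pi>1 x" for x
  have l1: "linear \<pi>1" unfolding \<pi>1_def by (rule lP[OF z0])
  have pp: "\<pi>1 (\<pi>1 x) = \<pi>1 x" for x unfolding \<pi>1_def by (rule PP[OF z0])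
  note ls = linear_add[OF l1] linear_diff[OF l1] linear_0[OF l1]
  define U where "U = V \<inter> cmap c -` W"
  define \<Psi> where "\<Psi> = \<psi> \<circ> cmap c"
  define k where "k = (U, \<Psi>)"
  have kd: "cdom k = U" "cmap k = \<Psi>" by (simp_all add: k_def cdom_def cmap_def)
  have UV: "U \<subseteq> V" "U \<subseteq> cdom c" using L.Vc by (auto simp: U_def)
  have opU: "open U" unfolding U_def
    by (rule continuous_open_preimage[OF continuous_on_subset[OF ad_simps(6)[OF c(1)] L.V(2)] L.V(1) W(1)])
  have imU: "cmap c ` U = W" using W(3) by (auto simp: U_def L.Z_def)
  have homU: "homeomorphism U W (cmap c) (cinv c)"
  proof (rule homeomorphism_of_subsets[OF _ UV(2) _ imU])
    show "homeomorphism (cdom c) (cmap c ` cdom c) (cmap c) (cinv c)"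
      using ad_top[OF c(1)] by (simp add: topological_chart_def)
    show "W \<subseteq> cmap c ` cdom c" using W(3) L.Z_sub by blast
  qed
  have hom': "homeomorphism U B \<Psi> (cinv c \<circ> gi)"
    unfolding \<Psi>_def by (rule homeomorphism_compose[OF homU hom(1)])
  have im\<Psi>: "\<Psi> ` U = B" and inj\<Psi>: "inj_on \<Psi> U"
    using hom' by (auto simp: homeomorphism_def intro: inj_on_inverseI)
  \<comment> \<open>\<open>cinv\<close> is defined through \<open>inv_into\<close>, so its agreement
    with the smooth inverse has to be established before smoothness of transitions can be
    discussed.\<close>
  have cinvk: "cinv k y = cinv c (gi y)" if "y \<in> B" for y
  proof -
    have "y = \<Psi> (cinv c (gi y))" "cinv c (gi y) \<in> U" using hom' that by (auto simp: homeomorphism_def)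
    then show ?thesis using inv_into_f_f[OF inj\<Psi>] unfolding cinv_def kd by metis
  qed
  have topk: "topological_chart k"
    unfolding topological_chart_def kd im\<Psi>
    by (intro conjI opU hom(3) homeomorphism_cong[OF hom']) (auto simp: cinvk)
  have gW: "gi y \<in> W" if "y \<in> B" for y using hom(1) that by (auto simp: homeomorphism_def)
  have adk: "ad k"
    unfolding admissible_chart_def smooth_transition_def
  proof (intro conjI ballI topk)
    fix d assume dM: "d \<in> M"
    note d = ad_in[OF dM]
    have oc: "open (cmap c ` (U \<inter> cdom d))"
      by (rule open_image[OF c(1)]) (use opU ad_simps(1)[OF d] UV in auto)
    have od: "open (cmap d ` (cdom d \<inter> U))"
      by (rule open_image[OF d]) (use opU ad_simps(1)[OF d] in auto)
    have ok: "open (\<Psi> ` (U \<inter> cdom d))"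
      using open_cmap_image[OF topk, of "U \<inter> cdom d"] opU ad_simps(1)[OF d] by (simp add: kd open_Int)
    have sub: "\<Psi> ` (U \<inter> cdom d) \<subseteq> B" using im\<Psi> by blast
    have gi: "gi (\<Psi> q) = cmap c q" if "q \<in> U" for q
    proof -
      have "cmap c q \<in> W" using that by (simp add: U_def)
      then show ?thesis using hom(1) by (simp add: homeomorphism_def \<Psi>_def)
    qed
    have "smooth_on (\<Psi> ` (U \<inter> cdom d)) (\<lambda>y. tr c d (gi y))"
      by (rule smooth_on_compose[OF ok oc smooth_on_subset[OF hom(2) sub] smooth_on_subset[OF smooth_tr[OF c(1) d]]])
        (use UV gi in auto)
    moreover have "smooth_on (\<Psi> ` (U \<inter> cdom d)) (\<lambda>y. tr c d (gi y)) \<longleftrightarrow> smooth_on (\<Psi> ` (U \<inter> cdom d)) (tr k d)"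
      by (rule smooth_on_cong[OF ok]) (use sub cinvk in auto)
    ultimately show "smooth_on (cmap k ` (cdom k \<inter> cdom d)) (tr k d)" unfolding kd by blast
    have "smooth_on (cmap d ` (cdom d \<inter> U)) (\<lambda>z. \<psi> (tr d c z))"
      by (rule smooth_on_compose[OF od W(1) smooth_on_subset[OF smooth_tr[OF d c(1)]] W(4)])
        (use UV ad_simps(3)[OF d] in \<open>auto simp: U_def\<close>)
    moreover have "smooth_on (cmap d ` (cdom d \<inter> U)) (\<lambda>z. \<psi> (tr d c z)) \<longleftrightarrow> smooth_on (cmap d ` (cdom d \<inter> U)) (tr d k)"
      by (rule smooth_on_cong[OF od]) (simp add: kd \<Psi>_def)
    ultimately show "smooth_on (cmap d ` (cdom d \<inter> cdom k)) (tr d k)" unfolding kd by blast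
  qed
  \<comment> \<open>Through this formula the isometry property and the commutation with
    \<open>P\<close>, known for the derivative of \<open>\<psi>\<close>, become statements about
    tangent vectors of \<open>M\<close>.\<close>
  have tk: "to_chart M k q u = fd \<psi> (cmap c q) (to_chart M c q u)" if q: "q \<in> U" for q u
  proof -
    define a where "a = chart_at M q"
    have a: "ad a" "q \<in> cdom a" unfolding a_def by (rule ad_chart_at chart_at)+
    have "to_chart M k q u = fd (\<lambda>z. \<psi> (tr a c z)) (cmap a q) u"
      by (simp add: to_chart_def a_def[symmetric] kd \<Psi>_def o_def)
    also have "\<dots> = fd \<psi> (tr a c (cmap a q)) (fd (tr a c) (cmap a q) u)"
      by (rule fd_chain[OF smooth_tr[OF a(1) c(1)] W(4)])
        (use a q UV ad_simps(3)[OF a(1)] in \<open>auto simp: U_def\<close>)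
    finally show ?thesis using ad_simps(3)[OF a] by (simp add: to_chart_def a_def[symmetric])
  qed
  have P_k: "to_chart M k q (vp q u) = \<pi>1 (to_chart M k q u)" if q: "q \<in> U" for q u
  proof -
    have "q \<in> V" "cmap c q \<in> W" using q by (auto simp: U_def)
    then show ?thesis unfolding tk[OF q] \<pi>1_def using comm[of "cmap c q" "to_chart M c q u"] P_to[of q u] by simp
  qed
  have surjk: "\<exists>u. y = to_chart M k q u" if q: "q \<in> U" for q y
    using of_to_chart[OF adk] to_of_chart[OF adk, of q y] q kd by metis
  define S1 S2 where "S1 = range \<pi>1 \<inter> ball 0 \<epsilon>" and "S2 = range \<pi>2 \<inter> ball 0 \<epsilon>"
  \<comment> \<open>Both factors carry the constant metric \<open>G z0\<close>, because the
    coordinates are flat.\<close>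
  let ?h = "\<lambda>x. L.G z0"
  have r1: "u \<in> range \<pi>1 \<longleftrightarrow> \<pi>1 u = u" and r2: "u \<in> range \<pi>2 \<longleftrightarrow> \<pi>1 u = 0" for u
  proof -
    show "u \<in> range \<pi>1 \<longleftrightarrow> \<pi>1 u = u" using pp by (metis rangeE rangeI)
    have "\<pi>1 (\<pi>2 x) = 0" for x by (simp add: \<pi>2_def ls pp)
    moreover have "\<pi>1 u = 0 \<Longrightarrow> u = \<pi>2 u" by (simp add: \<pi>2_def)
    ultimately show "u \<in> range \<pi>2 \<longleftrightarrow> \<pi>1 u = 0" by (metis rangeE rangeI)
  qed
  have l2: "linear \<pi>2" unfolding \<pi>2_def[abs_def] by (intro linear_compose_sub linear_ident l1)
  have patch: "riemannian_patch \<pi> (range \<pi> \<inter> ball 0 \<epsilon>) ?h" if "linear \<pi>" for \<pi> :: "'e \<Rightarrow> 'e"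
    unfolding riemannian_patch_def
  proof (intro conjI ballI impI)
    show "openin (top_of_set (range \<pi>)) (range \<pi> \<inter> ball 0 \<epsilon>)" by (rule openin_open_Int) simp
    show "bilinear (\<lambda>u v. L.G z0 (\<pi> u) (\<pi> v))"
      using linear_compose[OF that L.linG(1)[OF z0]] linear_compose[OF that L.linG(2)[OF z0]]
      by (simp add: bilinear_def o_def)
  qed (use L.symG[OF z0] L.posG[OF z0] in simp_all)
  have B': "B = {a + b | a b. a \<in> S1 \<and> b \<in> S2}"
  proof (intro equalityI subsetI)
    fix y assume "y \<in> B"
    then have "\<pi>1 y \<in> S1" "\<pi>2 y \<in> S2" by (auto simp: B S1_def S2_def \<pi>1_def[symmetric] \<pi>2_def)
    moreover have "y = \<pi>1 y + \<pi>2 y" by (simp add: \<pi>2_def)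
    ultimately show "y \<in> {a + b | a b. a \<in> S1 \<and> b \<in> S2}" by blast
  next
    fix y assume "y \<in> {a + b | a b. a \<in> S1 \<and> b \<in> S2}"
    then obtain a b where ab: "y = a + b" "a \<in> S1" "b \<in> S2" by blast
    then have "\<pi>1 a = a" "\<pi>1 b = 0" "norm a < \<epsilon>" "norm b < \<epsilon>" by (auto simp: S1_def S2_def r1 r2)
    then show "y \<in> B" by (simp add: B \<pi>1_def[symmetric] ab(1) ls)
  qed
  have met: "g q u v = L.G z0 (\<pi>1 (to_chart M k q u)) (\<pi>1 (to_chart M k q v)) +
      L.G z0 (\<pi>2 (to_chart M k q u)) (\<pi>2 (to_chart M k q v))" if q: "q \<in> U" for q u v
  proof -
    have qV: "q \<in> V" "cmap c q \<in> W" using q by (auto simp: U_def)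
    have "g q u v = L.G z0 (to_chart M k q u) (to_chart M k q v)"
      unfolding L.g_G[OF qV(1)] tk[OF q] by (rule iso[OF qV(2)])
    \<comment> \<open>The projection is self-adjoint, so the cross terms between its range and its
      kernel vanish and the metric splits.\<close>
    moreover have "L.G z0 (\<pi>1 a) b = L.G z0 (\<pi>1 a) (\<pi>1 b)" "L.G z0 a (\<pi>1 b) = L.G z0 (\<pi>1 a) (\<pi>1 b)" for a b
      using P_adj[OF z0, of "\<pi>1 a" b] P_adj[OF z0, of a "\<pi>1 b"] pp by (simp_all add: \<pi>1_def[symmetric])
    ultimately show ?thesis by (simp add: \<pi>2_def L.Gsimps z0)
  qed
  have dv: "to_chart M k q ` vert q = range \<pi>1" if q: "q \<in> U" for q
  proof (intro equalityI subsetI)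
    fix y assume "y \<in> to_chart M k q ` vert q"
    then obtain u where "u \<in> vert q" "y = to_chart M k q u" by blast
    then show "y \<in> range \<pi>1" using P_k[OF q, of u] by (simp add: vp_iff r1)
  next
    fix y assume "y \<in> range \<pi>1"
    then obtain x where "y = \<pi>1 x" by blast
    moreover obtain u where "x = to_chart M k q u" using surjk[OF q] by blast
    ultimately have "y = to_chart M k q (vp q u)" by (simp add: P_k[OF q])
    then show "y \<in> to_chart M k q ` vert q" using vp_vert by blast
  qed
  have tk_lin: "linear (to_chart M k q)" if "q \<in> U" for q using linear_to_chart[OF adk] that kd by simp
  have dh: "to_chart M k q ` hor q = range \<pi>2" if q: "q \<in> U" for q
  proof (intro equalityI subsetI)
    fix y assume "y \<in> to_chart M k q ` hor q"
    then obtain u where "u \<in> hor q" "y = to_chart M k q u" by blast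
    then show "y \<in> range \<pi>2" using P_k[OF q, of u] by (simp add: hor_iff r2 linear_0[OF tk_lin[OF q]])
  next
    fix y assume "y \<in> range \<pi>2"
    then obtain x where "y = x - \<pi>1 x" unfolding \<pi>2_def by blast
    moreover obtain u where "x = to_chart M k q u" using surjk[OF q] by blast
    ultimately have "y = to_chart M k q (hp q u)" by (simp add: P_k[OF q] hp_eq linear_diff[OF tk_lin[OF q]])
    then show "y \<in> to_chart M k q ` hor q" using hp_hor by blast
  qed
  have "p \<in> U" using pV W(2) by (simp add: U_def z0_def)
  moreover have "\<pi>1 \<circ> \<pi>1 = \<pi>1" using pp by (simp add: fun_eq_iff)
  moreover have "\<pi>2 = (\<lambda>x. x - \<pi>1 x)" by (simp add: \<pi>2_def fun_eq_iff)
  moreover have "riemannian_patch \<pi>1 S1 ?h" "riemannian_patch \<pi>2 S2 ?h"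
    unfolding S1_def S2_def by (rule patch[OF l1], rule patch[OF l2])
  moreover have "\<Psi> ` U = {a + b | a b. a \<in> S1 \<and> b \<in> S2}" using im\<Psi> B' by simp
  ultimately show "\<exists>U \<psi> \<pi>1 \<pi>2 S1 S2 h1 h2.
        p \<in> U \<and> admissible_chart M (U, \<psi>) \<and>
        linear \<pi>1 \<and> \<pi>1 \<circ> \<pi>1 = \<pi>1 \<and> \<pi>2 = (\<lambda>x. x - \<pi>1 x) \<and>
        riemannian_patch \<pi>1 S1 h1 \<and> riemannian_patch \<pi>2 S2 h2 \<and>
        \<psi> ` U = {a + b | a b. a \<in> S1 \<and> b \<in> S2} \<and>
        (\<forall>q\<in>U. \<forall>u v. g q u v =
           h1 (\<pi>1 (\<psi> q)) (\<pi>1 (to_chart M (U, \<psi>) q u)) (\<pi>1 (to_chart M (U, \<psi>) q v)) +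
           h2 (\<pi>2 (\<psi> q)) (\<pi>2 (to_chart M (U, \<psi>) q u)) (\<pi>2 (to_chart M (U, \<psi>) q v))) \<and>
        (\<forall>q\<in>U. to_chart M (U, \<psi>) q ` vert q = range \<pi>1 \<and>
               to_chart M (U, \<psi>) q ` hor q = range \<pi>2)"
    using adk l1 met dv dh unfolding k_def
    by (intro exI[of _ U] exI[of _ \<Psi>] exI[of _ \<pi>1] exI[of _ \<pi>2] exI[of _ S1] exI[of _ S2] exI[of _ ?h]) simp
qed

theorem locally_product_iff_vanish: "locally_product M g vert hor \<longleftrightarrow> oneill_vanish"
  using preserves_imp_vanish vanish_imp_preserves locally_product_imp_preserves preserves_imp_locally_product by blast

end

theorem theorem9:
  fixes M :: "('a::{t2_space, second_countable_topology}, 'e::euclidean_space) chart set"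
    and N :: "('b::{t2_space, second_countable_topology}, 'f::euclidean_space) chart set"
    and m :: nat
    and \<phi> :: "'a \<Rightarrow> 'e \<Rightarrow> 'e" and \<xi> :: "'a \<Rightarrow> 'e" and \<eta> :: "'a \<Rightarrow> 'e \<Rightarrow> real"
    and gM :: "'a \<Rightarrow> 'e \<Rightarrow> 'e \<Rightarrow> real" and gN :: "'b \<Rightarrow> 'f \<Rightarrow> 'f \<Rightarrow> real"
    and nabla :: "('a \<Rightarrow> 'e) \<Rightarrow> ('a \<Rightarrow> 'e) \<Rightarrow> 'a \<Rightarrow> 'e"
    and F :: "'a \<Rightarrow> 'b"
  assumes "smooth_manifold M" and "DIM('e) = 2 * m + 1"
    and "cosymplectic M \<phi> \<xi> \<eta> gM"
    and "levi_civita_connection M gM nabla"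
    and "smooth_manifold N" and "riemannian_metric N gN"
    and "riemannian_submersion M gM N gN F"
    and "anti_invariant M \<phi> gM N F"
    and "\<forall>p. \<phi> p ` vertical M N F p = horizontal M N gM F p"
  shows "locally_product M gM (vertical M N F) (horizontal M N gM F) \<longleftrightarrow>
    (\<forall>W \<in> sections M (vertical M N F). \<forall>V \<in> sections M (vertical M N F).
     \<forall>X \<in> sections M (horizontal M N gM F). \<forall>Y \<in> sections M (horizontal M N gM F).
       (\<forall>p. oneill_A M N gM F nabla X (\<lambda>q. \<phi> q (Y q)) p = 0) \<and>
       (\<forall>p. oneill_T M N gM F nabla V (\<lambda>q. \<phi> q (W q)) p = 0))"
proof -
  have "affine_connection M nabla" using assms(4) by (simp add: levi_civita_connection_def)
  interpret anti_invariant_submersion M N nabla \<phi> \<xi> \<eta> gM gN F m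
    by unfold_locales (fact assms \<open>affine_connection M nabla\<close> | rule spec[OF assms(9)])+
  show ?thesis using locally_product_iff_vanish unfolding oneill_vanish_def .
qed

end
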